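(* Suppose $\mu=\langle\mu_1,\dots,\mu_d\rangle$ is a composition of $n$ with $d$ (positive) parts and $T$ is a tabloid of shape $\mu$. If $T$ corresponds to $(P,Q)$ under RSK, then the affine evacuation $e(T)$ corresponds to $(e_n(P),e_d^*(Q))$ under RSK.
   Context: **Tabloids.** $[\overline n]$ is the set of residue classes of integers modulo $n$; $\overline i$ is the class of $i$. A tabloid of shape $\mu$ is a bijective filling with $[\overline n]$ of the left-aligned diagram with $\mu_i$ boxes in row $i$ (from the top), up to reordering entries within rows. $\mathrm{Des}(T)$ is the set of $\overline i$ such that $\overline{i+1}$ lies in a strictly lower row of $T$ than $\overline i$. Tabloids $T,T'$ are related by a Knuth move if $T'$ is obtained from $T$ by exchanging two elements $\overline i$ and $\overline{i+1}$, and $\mathrm{Des}(T)$, $\mathrm{Des}(T')$ are incomparable under inclusion. The move has type $\overline i$ if $\overline i$ is in exactly one of $\mathrm{Des}(T),\mathrm{Des}(T')$ and $\overline{i+1}$ is in exactly the other one. $\mathcal A_\mu$ is the graph on tabloids of shape $\mu$ whose edges are Knuth moves. $\mathrm{RRSS}(\mu,\overline k)$ is the tabloid with first row $\overline k,\overline{k-1},\dots,\overline{k-\mu_1+1}$, second row $\overline{k-\mu_1},\dots,\overline{k-\mu_1-\mu_2+1}$, and so on. **Affine evacuation** is the unique automorphism $e$ of $\mathcal A_\mu$ such that $e(\mathrm{RRSS}(\mu,\overline k))=\mathrm{RRSS}(\mu,\overline{n-k})$ for all $\overline k$ and such that $e$ sends every edge that is a Knuth move of type $\overline k$ to an edge that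 is a Knuth move of type $\overline{n-k-1}$. **RSK on tabloids.** Let $b_i$ be the increasing sequence of representatives in $[n]=\{1,\dots,n\}$ of the entries of row $i$ of $T$. Encode $T$ as the two-row array whose top row is $1^{\mu_d}2^{\mu_{d-1}}\cdots d^{\mu_1}$ and whose bottom row is the concatenation $b_d\,b_{d-1}\cdots b_1$ (rows read from the bottom up). RSK row-inserts the bottom row to give the insertion tableau $P$, a standard Young tableau of size $n$, and records with the top row to give the recording tableau $Q$, a semistandard tableau of the same shape and content $\langle\mu_d,\dots,\mu_1\rangle$. This is a bijection from tabloids of shape $\mu$ to pairs $(P,Q)$ of a standard tableau and a semistandard tableau of content $\langle\mu_d,\dots,\mu_1\rangle$ having the same shape. **The maps $e_d$, $e_d^*$.** The reading word of a semistandard tableau $U$ is the concatenation of its rows, each read left to right, beginning with the last (bottom) row. If $U$ has entries in $[d]$ and reading word $W_1\cdots W_n$, then $e_d(U)$ is the row-insertion tableau of the word $(d+1-W_n)\cdots(d+1-W_1)$; $e_n$ is the same map with $n$ in place of $d$. For $1\le i<d$, $s_i$ acts on semistandard tableaux with entries in $[d]$ as follows: in the reading word place a right parenthesis beneath each $i$ and a left parenthesis beneath each $i+1$, recursively remove matched pairs (a left parenthesis followed later by a right one with no remaining parentheses between), and replace the remaining unmatched subword $i^\alpha(i+1)^\beta$ by $i^\beta(i+1)^\alpha$; the result is the reading word of a unique semistandard tableau $s_i(U)$ of the same shape. These generate an action of $\mathfrak S_d$ (Lascoux–Schützenberger). Set $e_d^*=w_0\circ e_d$, where $w_0$ is the longest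 element of $\mathfrak S_d$ acting in this way. *)

theory Defs
  imports Main "HOL-Library.FuncSet" "HOL-Combinatorics.Transposition"
begin

text \<open>A residue class modulo \<open>n\<close> is represented by its representative in \<open>{1..n}\<close>;
  \<open>residue n k\<close> is the representative of the class of the integer \<open>k\<close>.\<close>

definition residue :: "nat \<Rightarrow> int \<Rightarrow> nat" where
  "residue n k = nat ((k - 1) mod int n + 1)"

definition composition_of :: "nat list \<Rightarrow> nat \<Rightarrow> bool" where
  "composition_of \<mu> n \<longleftrightarrow> (\<forall>m \<in> set \<mu>. 0 < m) \<and> sum_list \<mu> = n"


section \<open>Tabloids and Knuth moves\<close>

text \<open>A tabloid is the list of its rows from top to bottom, each row being the set of its entries.
  Indices into this list start at \<open>0\<close>, and a strictly lower row has a strictly larger index.\<close>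

type_synonym tabloid = "nat set list"

definition tabloids :: "nat list \<Rightarrow> tabloid set" where
  "tabloids \<mu> = {T. length T = length \<mu>
      \<and> (\<forall>r < length \<mu>. card (T ! r) = \<mu> ! r)
      \<and> (\<forall>r < length \<mu>. \<forall>s < length \<mu>. r \<noteq> s \<longrightarrow> T ! r \<inter> T ! s = {})
      \<and> \<Union> (set T) = {1..sum_list \<mu>}}"

definition row_of :: "tabloid \<Rightarrow> nat \<Rightarrow> nat" where
  "row_of T x = (THE r. r < length T \<and> x \<in> T ! r)"

definition next_class :: "nat \<Rightarrow> nat \<Rightarrow> nat" where
  "next_class n i = residue n (int i + 1)"

definition Des :: "nat \<Rightarrow> tabloid \<Rightarrow> nat set" where
  "Des n T = {i \<in> {1..n}. row_of T i < row_of T (next_class n i)}"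

definition exchange :: "nat \<Rightarrow> nat \<Rightarrow> tabloid \<Rightarrow> tabloid" where
  "exchange n i T = map ((`) (transpose i (next_class n i))) T"

definition knuth_move :: "nat list \<Rightarrow> tabloid \<Rightarrow> tabloid \<Rightarrow> bool" where
  "knuth_move \<mu> T T' \<longleftrightarrow> (let n = sum_list \<mu> in
      T \<in> tabloids \<mu> \<and> T' \<in> tabloids \<mu> \<and>
      (\<exists>i \<in> {1..n}. T' = exchange n i T) \<and>
      \<not> Des n T \<subseteq> Des n T' \<and> \<not> Des n T' \<subseteq> Des n T)"

text \<open>The type need not be the index of the exchanged pair, and a move may have two types.\<close>

definition knuth_move_of_type :: "nat list \<Rightarrow> nat \<Rightarrow> tabloid \<Rightarrow> tabloid \<Rightarrow> bool" where
  "knuth_move_of_type \<mu> i T T' \<longleftrightarrow> (let n = sum_list \<mu>; j = next_class n i in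
      knuth_move \<mu> T T' \<and>
      (i \<in> Des n T - Des n T' \<and> j \<in> Des n T' - Des n T \<or>
       i \<in> Des n T' - Des n T \<and> j \<in> Des n T - Des n T'))"

fun rrss_rows :: "nat \<Rightarrow> nat list \<Rightarrow> int \<Rightarrow> tabloid" where
  "rrss_rows n [] k = []"
| "rrss_rows n (m # ms) k = residue n ` {k - int m + 1..k} # rrss_rows n ms (k - int m)"

definition RRSS :: "nat list \<Rightarrow> int \<Rightarrow> tabloid" where
  "RRSS \<mu> k = rrss_rows (sum_list \<mu>) \<mu> k"


section \<open>Affine evacuation\<close>

definition graph_automorphism :: "'v set \<Rightarrow> ('v \<Rightarrow> 'v \<Rightarrow> bool) \<Rightarrow> ('v \<Rightarrow> 'v) \<Rightarrow> bool" where
  "graph_automorphism V adj f \<longleftrightarrow>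
     bij_betw f V V \<and> (\<forall>x \<in> V. \<forall>y \<in> V. adj (f x) (f y) \<longleftrightarrow> adj x y)"

definition is_affine_evacuation :: "nat list \<Rightarrow> (tabloid \<Rightarrow> tabloid) \<Rightarrow> bool" where
  "is_affine_evacuation \<mu> e \<longleftrightarrow> (let n = sum_list \<mu> in
      graph_automorphism (tabloids \<mu>) (knuth_move \<mu>) e \<and>
      (\<forall>k. e (RRSS \<mu> k) = RRSS \<mu> (int n - k)) \<and>
      (\<forall>k T T'. knuth_move_of_type \<mu> (residue n k) T T' \<longrightarrow>
         knuth_move_of_type \<mu> (residue n (int n - k - 1)) (e T) (e T')))"

text \<open>An automorphism is determined only on \<open>tabloids \<mu>\<close>; extensionality fixes the
  values of the HOL function elsewhere, so that uniqueness is meaningful.\<close>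

definition affine_evacuation :: "nat list \<Rightarrow> tabloid \<Rightarrow> tabloid" where
  "affine_evacuation \<mu> = (THE e. e \<in> extensional (tabloids \<mu>) \<and> is_affine_evacuation \<mu> e)"


section \<open>RSK on tabloids\<close>

text \<open>A tableau is the list of its rows from top to bottom.\<close>

type_synonym tableau = "nat list list"

fun insert_row :: "nat \<Rightarrow> nat list \<Rightarrow> nat list \<times> nat option" where
  "insert_row x [] = ([x], None)"
| "insert_row x (y # ys) =
     (if x < y then (x # ys, Some y)
      else (case insert_row x ys of (zs, b) \<Rightarrow> (y # zs, b)))"

text \<open>The second component is the index of the row that gains a box.\<close>

fun row_insert :: "nat \<Rightarrow> tableau \<Rightarrow> tableau \<times> nat" where
  "row_insert x [] = ([[x]], 0)"
| "row_insert x (R # U) =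
     (case insert_row x R of
        (R', None) \<Rightarrow> (R' # U, 0)
      | (R', Some y) \<Rightarrow> (case row_insert y U of (U', r) \<Rightarrow> (R' # U', Suc r)))"

definition insertion_tableau :: "nat list \<Rightarrow> tableau" where
  "insertion_tableau w = foldl (\<lambda>P x. fst (row_insert x P)) [] w"

definition append_to_row :: "nat \<Rightarrow> nat \<Rightarrow> tableau \<Rightarrow> tableau" where
  "append_to_row r a Q = (if r < length Q then Q[r := Q ! r @ [a]] else Q @ [[a]])"

text \<open>A two-row array is the list of its columns \<open>(top, bottom)\<close>.\<close>

definition rsk :: "(nat \<times> nat) list \<Rightarrow> tableau \<times> tableau" where
  "rsk A = foldl (\<lambda>(P, Q) (a, x). case row_insert x P of
      (P', r) \<Rightarrow> (P', append_to_row r a Q)) ([], []) A"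

definition tabloid_array :: "tabloid \<Rightarrow> (nat \<times> nat) list" where
  "tabloid_array T =
     concat (map (\<lambda>(a, R). map (Pair a) (sorted_list_of_set R)) (enumerate 1 (rev T)))"

definition tabloid_rsk :: "tabloid \<Rightarrow> tableau \<times> tableau" where
  "tabloid_rsk T = rsk (tabloid_array T)"


section \<open>Evacuation and the Lascoux--Schuetzenberger action\<close>

definition reading_word :: "tableau \<Rightarrow> nat list" where
  "reading_word U = concat (rev U)"

definition evac :: "nat \<Rightarrow> tableau \<Rightarrow> tableau" where
  "evac d U = insertion_tableau (map (\<lambda>x. d + 1 - x) (rev (reading_word U)))"

text \<open>The positions of the letters \<open>i\<close> and \<open>i + 1\<close> left over in the word \<open>w\<close> when each
  \<open>i + 1\<close> is read as a left parenthesis, each \<open>i\<close> as a right parenthesis, and matched pairs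
  are removed. The first argument of \<open>foldl\<close> holds the remaining positions, the last one first;
  a right parenthesis removes the left parenthesis that is last among them, if any.\<close>

definition unmatched :: "nat \<Rightarrow> nat list \<Rightarrow> nat list" where
  "unmatched i w = rev (foldl (\<lambda>st p. case st of
        [] \<Rightarrow> [p]
      | q # st' \<Rightarrow> (if w ! q = i + 1 \<and> w ! p = i then st' else p # st))
      [] (filter (\<lambda>p. w ! p = i \<or> w ! p = i + 1) [0..<length w]))"

definition s_word :: "nat \<Rightarrow> nat list \<Rightarrow> nat list" where
  "s_word i w = (let ps = unmatched i w;
       \<alpha> = length (filter (\<lambda>p. w ! p = i) ps);
       \<beta> = length (filter (\<lambda>p. w ! p = i + 1) ps)
     in foldl (\<lambda>v (p, x). v[p := x]) w (zip ps (replicate \<beta> i @ replicate \<alpha> (i + 1))))"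

fun cut :: "nat list \<Rightarrow> 'a list \<Rightarrow> 'a list list" where
  "cut [] w = []"
| "cut (m # ms) w = take m w # cut ms (drop m w)"

text \<open>A tableau is recovered from its shape and its reading word by cutting the word into rows.\<close>

definition s_tableau :: "nat \<Rightarrow> tableau \<Rightarrow> tableau" where
  "s_tableau i U = rev (cut (map length (rev U)) (s_word i (reading_word U)))"

text \<open>The action of a permutation \<open>w\<close> of \<open>{1..d}\<close>: the common value of
  \<open>s\<^sub>i\<^sub>1 (s\<^sub>i\<^sub>2 (\<dots> U))\<close> over all factorizations of \<open>w\<close> as a product
  \<open>s\<^sub>i\<^sub>1 \<circ> s\<^sub>i\<^sub>2 \<circ> \<dots>\<close> of adjacent transpositions.\<close>

definition simple_product :: "nat list \<Rightarrow> nat \<Rightarrow> nat" where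
  "simple_product is = foldr (\<lambda>i f. transpose i (Suc i) \<circ> f) is id"

definition perm_action :: "nat \<Rightarrow> (nat \<Rightarrow> nat) \<Rightarrow> tableau \<Rightarrow> tableau" where
  "perm_action d w U = (THE V. \<exists>is. set is \<subseteq> {1..<d} \<and> simple_product is = w
      \<and> V = foldr s_tableau is U)"

definition longest_perm :: "nat \<Rightarrow> nat \<Rightarrow> nat" where
  "longest_perm d i = (if i \<in> {1..d} then d + 1 - i else i)"

definition evac_star :: "nat \<Rightarrow> tableau \<Rightarrow> tableau" where
  "evac_star d = perm_action d (longest_perm d) \<circ> evac d"

end

theory Submission
  imports Defs "HOL-Library.Multiset"
begin

text \<open>Write a tabloid \<open>T\<close> with \<open>d\<close> rows as the word \<open>v\<close> of length \<open>n\<close> over \<open>{1..d}\<close> whose letter at \<open>x\<close>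
  is the row of \<open>x\<close>, counted from the bottom, and continue \<open>v\<close> to an \<open>n\<close>-periodic word on the
  integers. Then \<open>Des\<close> becomes the set of cyclic descents. A Knuth move exchanges two cyclically
  adjacent letters; as long as the positions involved do not straddle the seam between \<open>n\<close> and
  \<open>1\<close>, it is an elementary Knuth transformation of \<open>v\<close>. The tabloids \<open>RRSS \<mu> k\<close> become the
  words that are weakly increasing when they are read cyclically from the position after \<open>k\<close>. By
  the symmetry of RSK (\<open>rsk_symmetry\<close>), if \<open>T\<close> corresponds to \<open>(P, Q)\<close>, then \<open>Q\<close> is the insertion
  tableau of \<open>v\<close>, while \<open>P\<close> is the insertion tableau of the list of positions of the letters \<open>1\<close>,
  then \<open>2\<close>, and so on, in \<open>v\<close>.

  The evacuation of \<open>T\<close> is constructed in two steps. The first one replaces \<open>v\<close> by its reverse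
  complement. This is compatible with the plactic relation, both for \<open>v\<close> and for the word of
  positions, so that \<open>(P, Q)\<close> becomes \<open>(e\<^sub>n P, e\<^sub>d Q)\<close>; it turns moves of type \<open>k\<close>
  into moves of type \<open>n - k - 1\<close>, and \<open>RRSS\<close> for \<open>k\<close> into \<open>RRSS\<close> for \<open>n - k\<close>. But it also reverses
  the shape. The second step restores the shape: it applies the Lascoux--Schuetzenberger operators
  \<open>s\<^sub>i\<close>, along a factorization of the longest permutation, to the word. The operator
  \<open>s\<^sub>i\<close> changes the unmatched parentheses; read around the circle, it changes exactly those
  that stay unmatched cyclically (\<open>reflect_cyc\<close>). In this form it visibly commutes with rotations,
  and a local analysis shows that it preserves cyclic descents (\<open>descent_reflect\<close>) and maps Knuth
  moves to Knuth moves of the same type (\<open>kmove_reflect\<close>), across the seam as well. It acts on \<open>Q\<close>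
  by \<open>s_tableau\<close> (\<open>s_tableau_insertion_tableau\<close>), and it does not change \<open>P\<close>
  (\<open>position_word_s_word\<close>).

  It remains to see that the conditions on affine evacuation determine it, that the map just
  constructed is an automorphism, and that the operators \<open>s\<^sub>i\<close> induce an action of the
  symmetric group. All three follow from one principle, \<open>equivariant_unique\<close>. A move of a given
  type has at most one target (\<open>kmove_unique\<close>), and every cyclic word is connected by Knuth moves
  to one that is increasing in some window of length \<open>n\<close> (\<open>reach_sorted\<close>). Hence two maps that
  translate the types of moves in the same way, and agree on those increasing words, agree
  everywhere. In particular, the braid relations need no verification: two products of operators
  \<open>s\<^sub>i\<close> for the same permutation take an increasing word to increasing words of equal
  content.\<close>

section \<open>The plactic relation\<close>

inductive knuth :: "nat list \<Rightarrow> nat list \<Rightarrow> bool" where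
  knuth_yxz: "x < y \<Longrightarrow> y \<le> z \<Longrightarrow> knuth (A @ [y, x, z] @ B) (A @ [y, z, x] @ B)"
| knuth_xzy: "x \<le> y \<Longrightarrow> y < z \<Longrightarrow> knuth (A @ [x, z, y] @ B) (A @ [z, x, y] @ B)"

abbreviation plactic :: "nat list \<Rightarrow> nat list \<Rightarrow> bool"  (infix \<open>\<approx>\<close> 50) where
  "plactic \<equiv> equivclp knuth"

lemma plactic_refl [simp]: "w \<approx> w"
  by simp

lemma plactic_sym: "v \<approx> w \<Longrightarrow> w \<approx> v"
  by (rule equivclp_sym)

lemma plactic_trans [trans]: "u \<approx> v \<Longrightarrow> v \<approx> w \<Longrightarrow> u \<approx> w"
  by (rule equivclp_trans)

lemma plactic_if_knuth: "knuth v w \<Longrightarrow> v \<approx> w"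
  by (rule r_into_equivclp)

lemma knuth_append: "knuth v w \<Longrightarrow> knuth (A @ v @ B) (A @ w @ B)"
proof (induction rule: knuth.induct)
  case (knuth_yxz x y z A' B')
  then show ?case using knuth.knuth_yxz[of x y z "A @ A'" "B' @ B"] by simp
next
  case (knuth_xzy x y z A' B')
  then show ?case using knuth.knuth_xzy[of x y z "A @ A'" "B' @ B"] by simp
qed

lemma plactic_map:
  assumes "\<And>v w. knuth v w \<Longrightarrow> f v \<approx> f w" and "v \<approx> w"
  shows "f v \<approx> f w"
  using assms(2)
proof (induction rule: equivclp_induct)
  case base
  show ?case by simp
next
  case (step w w')
  then have "f w \<approx> f w'" using assms(1) plactic_sym by metis
  with step.IH show ?case by (rule plactic_trans)
qed

lemma plactic_append: "v \<approx> w \<Longrightarrow> A @ v @ B \<approx> A @ w @ B"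
  by (rule plactic_map[where f = "\<lambda>v. A @ v @ B"]) (auto intro: plactic_if_knuth knuth_append)

lemma plactic_append1: "v \<approx> w \<Longrightarrow> A @ v \<approx> A @ w"
  using plactic_append[of v w A "[]"] by simp

lemma plactic_append2: "v \<approx> w \<Longrightarrow> v @ B \<approx> w @ B"
  using plactic_append[of v w "[]" B] by simp

lemma plactic_Cons: "v \<approx> w \<Longrightarrow> a # v \<approx> a # w"
  using plactic_append1[of v w "[a]"] by simp

lemma mset_knuth: "knuth v w \<Longrightarrow> mset v = mset w"
  by (induction rule: knuth.induct) auto

lemma mset_plactic: "v \<approx> w \<Longrightarrow> mset v = mset w"
  by (induction rule: equivclp_induct) (auto dest: mset_knuth)

section \<open>Row insertion\<close>

definition bump_index :: "nat \<Rightarrow> nat list \<Rightarrow> nat" where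
  "bump_index x R = length (takeWhile (\<lambda>y. y \<le> x) R)"

lemma bump_index_le: "bump_index x R \<le> length R"
  by (simp add: bump_index_def length_takeWhile_le)

lemma bump_index_less: "c < bump_index x R \<Longrightarrow> R ! c \<le> x"
  unfolding bump_index_def using nth_mem set_takeWhileD takeWhile_nth by fastforce

lemma bump_index_nth: "bump_index x R < length R \<Longrightarrow> x < R ! bump_index x R"
  unfolding bump_index_def using nth_length_takeWhile by fastforce

lemma insert_row_eq:
  "insert_row x R = (if bump_index x R < length R
     then (R[bump_index x R := x], Some (R ! bump_index x R)) else (R @ [x], None))"
  by (induction R) (auto simp: bump_index_def)

lemma sorted_append_bump:
  assumes "sorted R" "\<not> bump_index x R < length R"
  shows "sorted (R @ [x])"
proof -
  have "y \<le> x" if y: "y \<in> set R" for y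
  proof -
    obtain c where "c < length R" "R ! c = y" using y by (metis in_set_conv_nth)
    then show ?thesis using bump_index_less[of c x R] assms(2) by simp
  qed
  then show ?thesis using assms(1) by (simp add: sorted_append)
qed

lemma sorted_update_bump:
  assumes "sorted R" "bump_index x R < length R"
  shows "sorted (R[bump_index x R := x])"
  unfolding sorted_iff_nth_mono_less
proof (intro allI impI)
  fix a b assume ab: "a < b" "b < length (R[bump_index x R := x])"
  let ?c = "bump_index x R"
  have "R ! a \<le> R ! b" using assms ab by (simp add: sorted_iff_nth_mono_less)
  moreover have "b = ?c \<Longrightarrow> R ! a \<le> x" using bump_index_less ab by simp
  moreover have "a = ?c \<Longrightarrow> x \<le> R ! b"
    using bump_index_nth[OF assms(2)] calculation(1) by simp
  ultimately show "R[?c := x] ! a \<le> R[?c := x] ! b"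
    using ab by (cases "a = ?c"; cases "b = ?c") simp_all
qed

lemma sorted_insert_row: "sorted R \<Longrightarrow> sorted (fst (insert_row x R))"
  by (simp add: insert_row_eq sorted_append_bump sorted_update_bump)

text \<open>Inserting a word into a tableau can be done one row at a time: the first row takes the whole word
  and hands down, in order, the letters that it bumps (see \<open>insert_word_Cons\<close>).\<close>

fun feed :: "nat list \<Rightarrow> nat list \<Rightarrow> nat list \<times> nat list" where
  "feed R [] = (R, [])"
| "feed R (x # w) = (case insert_row x R of (R', b) \<Rightarrow>
     (case feed R' w of (R'', bs) \<Rightarrow> (R'', case b of None \<Rightarrow> bs | Some y \<Rightarrow> y # bs)))"

definition insert_word :: "tableau \<Rightarrow> nat list \<Rightarrow> tableau" where
  "insert_word P w = foldl (\<lambda>P x. fst (row_insert x P)) P w"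

lemma insertion_tableau_eq: "insertion_tableau w = insert_word [] w"
  by (simp add: insertion_tableau_def insert_word_def)

lemma insert_word_simps [simp]:
  "insert_word P [] = P"
  "insert_word P (x # w) = insert_word (fst (row_insert x P)) w"
  "insert_word P (v @ w) = insert_word (insert_word P v) w"
  by (simp_all add: insert_word_def)

lemma insert_word_Cons: "insert_word (R # U) w = fst (feed R w) # insert_word U (snd (feed R w))"
  by (induction w arbitrary: R U) (auto split: prod.split option.split)

lemma insert_word_Nil: "w \<noteq> [] \<Longrightarrow> insert_word [] w = insert_word [[]] w"
  by (cases w) auto

text \<open>A weakly increasing row is determined by the multiset of its entries. On multisets, the insertion
  of \<open>x\<close> replaces the least entry \<open>y\<close> above \<open>x\<close> by \<open>x\<close>, and the interaction of several insertions
  reduces to membership and minimality.\<close>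

definition bump :: "nat multiset \<Rightarrow> nat \<Rightarrow> nat \<Rightarrow> nat multiset \<Rightarrow> bool" where
  "bump M x y M' \<longleftrightarrow> y \<in># M \<and> x < y \<and> (\<forall>r \<in># M. x < r \<longrightarrow> y \<le> r) \<and> M' = add_mset x (M - {#y#})"

lemma bump_unique: "bump M x y M' \<Longrightarrow> bump M x z N \<Longrightarrow> y = z \<and> M' = N"
  using order_antisym[of y z] by (auto simp: bump_def)

lemma bump_add_mset: "bump M x y M' \<Longrightarrow> add_mset y M' = add_mset x M"
  by (auto simp: bump_def)

lemma bump_keep: "bump M x y M' \<Longrightarrow> r \<in># M \<Longrightarrow> r \<noteq> y \<Longrightarrow> r \<in># M'"
  by (simp add: bump_def in_diff_count)

lemma bump_new: "bump M x y M' \<Longrightarrow> x \<in># M'"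
  by (auto simp: bump_def)

lemma bump_old: "bump M x y M' \<Longrightarrow> r \<in># M' \<Longrightarrow> r = x \<or> r \<in># M"
  by (auto simp: bump_def dest: in_diffD)

lemma bump_mem: "bump M x y M' \<Longrightarrow> y \<in># M"
  and bump_gt: "bump M x y M' \<Longrightarrow> x < y"
  and bump_le: "bump M x y M' \<Longrightarrow> r \<in># M \<Longrightarrow> x < r \<Longrightarrow> y \<le> r"
  by (auto simp: bump_def)

text \<open>When \<open>x\<close> is inserted, the letter \<open>y\<close> is present, so that \<open>x\<close> bumps a letter at most \<open>y\<close>, whereas
  \<open>z\<close> bumps a letter above \<open>z\<close>. These two insertions do not interact, and their order does not
  matter.\<close>

lemma bump_yxz:
  assumes b: "bump M y b M1" and a: "bump M1 x a M2" and c: "bump M2 z c M3"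
    and c': "bump M1 z c' N2" and a': "bump N2 x a' N3" and xyz: "x < y" "y \<le> z"
  shows "a' = a \<and> c' = c \<and> N3 = M3 \<and> a < b \<and> b \<le> c"
proof -
  have ay: "a \<le> y" using bump_le[OF a bump_new[OF b] xyz(1)] .
  have cM1: "c \<in># M1" using bump_old[OF a bump_mem[OF c]] bump_gt[OF c] xyz by auto
  have "c' \<in># M2" using bump_keep[OF a bump_mem[OF c']] bump_gt[OF c'] ay xyz by auto
  then have "c \<le> c'" using bump_le[OF c] bump_gt[OF c'] by auto
  moreover have "c' \<le> c" using bump_le[OF c' cM1] bump_gt[OF c] by auto
  ultimately have cc: "c' = c" by simp
  have ac: "a < c" using ay xyz bump_gt[OF c] by simp
  have "a \<in># N2" using bump_keep[OF c' bump_mem[OF a]] ac cc by auto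
  then have "a' \<le> a" using bump_le[OF a'] bump_gt[OF a] by auto
  moreover have "a \<le> a'"
    using bump_old[OF c' bump_mem[OF a']] bump_le[OF a] bump_gt[OF a'] ay xyz by auto
  ultimately have aa: "a' = a" by simp
  have "b \<le> c" using bump_old[OF b cM1] bump_le[OF b] bump_gt[OF c] xyz by auto
  moreover have "a < b" using ay bump_gt[OF b] by simp
  moreover have "N3 = M3"
    using bump_add_mset[OF a] bump_add_mset[OF c] bump_add_mset[OF c'] bump_add_mset[OF a'] aa cc
    by (metis add_mset_commute add_mset_add_mset_same_iff)
  ultimately show ?thesis using aa cc by simp
qed

text \<open>If the row has an entry in the interval from \<open>x\<close> (exclusive) to \<open>z\<close> (inclusive), then \<open>x\<close> and \<open>z\<close>
  act on different parts of it. Otherwise they compete for the same entry, and the letter that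
  comes second bumps something else; the words of bumped letters are then related by the other of
  the two Knuth relations.\<close>

lemma bump_xzy:
  assumes a: "bump M x a M1" and c: "bump M1 z c M2" and b: "bump M2 y b M3"
    and c': "bump M z c' N1" and a': "bump N1 x a' N2" and b': "bump N2 y b' N3"
    and xyz: "x \<le> y" "y < z"
  shows "N3 = M3 \<and> (a' = a \<and> c' = c \<and> b' = b \<and> a \<le> b \<and> b < c \<or>
                     b' = c \<and> c' = a \<and> a' = b \<and> b < a \<and> a \<le> c)"
proof (cases "a \<le> z")
  case True
  have cM: "c \<in># M" using bump_old[OF a bump_mem[OF c]] bump_gt[OF c] xyz by auto
  have "c' \<in># M1" using bump_keep[OF a bump_mem[OF c']] bump_gt[OF c'] True by auto
  then have "c \<le> c'" using bump_le[OF c] bump_gt[OF c'] by auto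
  moreover have "c' \<le> c" using bump_le[OF c' cM] bump_gt[OF c] by auto
  ultimately have cc: "c' = c" by simp
  have "a \<in># N1" using bump_keep[OF c' bump_mem[OF a]] True bump_gt[OF c'] by auto
  then have "a' \<le> a" using bump_le[OF a'] bump_gt[OF a] by auto
  moreover have "a \<le> a'"
    using bump_old[OF c' bump_mem[OF a']] bump_le[OF a] bump_gt[OF a'] True by auto
  ultimately have aa: "a' = a" by simp
  have N: "N2 = M2"
    using bump_add_mset[OF a] bump_add_mset[OF c] bump_add_mset[OF c'] bump_add_mset[OF a'] aa cc
    by (metis add_mset_commute add_mset_add_mset_same_iff)
  have bb: "b' = b" "N3 = M3" using bump_unique b b' N by blast+
  have "b \<le> z" using bump_le[OF b bump_new[OF c] xyz(2)] .
  then have "b < c" using bump_gt[OF c] by simp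
  moreover have "a \<le> b"
    using bump_old[OF c bump_mem[OF b]] bump_old[OF a] bump_le[OF a] bump_gt[OF b] True xyz by force
  ultimately show ?thesis using aa bb cc by simp
next
  case False
  have none: "r \<le> x \<or> a \<le> r" if "r \<in># M" for r
    using bump_le[OF a that] not_le by blast
  have "c' \<le> a" using bump_le[OF c' bump_mem[OF a]] False by auto
  moreover have "a \<le> c'" using none[OF bump_mem[OF c']] bump_gt[OF c'] xyz by auto
  ultimately have ca: "c' = a" by simp
  have "a' \<le> z" using bump_le[OF a' bump_new[OF c']] xyz by auto
  moreover have "z \<le> a'"
    using bump_old[OF c' bump_mem[OF a']] none bump_gt[OF a'] False by force
  ultimately have az: "a' = z" by simp
  have "b \<le> z" using bump_le[OF b bump_new[OF c] xyz(2)] .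
  moreover have "z \<le> b"
    using bump_old[OF c bump_mem[OF b]] bump_old[OF a] none bump_gt[OF b] False xyz by force
  ultimately have bz: "b = z" by simp
  have N: "N2 = M1"
    using bump_add_mset[OF a] bump_add_mset[OF c'] bump_add_mset[OF a'] ca az
    by (metis add_mset_commute add_mset_add_mset_same_iff)
  have "c \<in># M1" by (rule bump_mem[OF c])
  then have "b' \<le> c" using bump_le[OF b'] bump_gt[OF c] xyz N by auto
  moreover have "c \<le> b'"
  proof -
    have b'M: "b' \<in># M1" using bump_mem[OF b'] N by simp
    then have "z < b'" using bump_old[OF a b'M] none bump_gt[OF b'] False xyz by force
    then show ?thesis using bump_le[OF c b'M] by simp
  qed
  ultimately have bc: "b' = c" by simp
  have "N3 = M3"
    using bump_add_mset[OF c] bump_add_mset[OF b] bump_add_mset[OF b'] bz bc N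
    by (metis add_mset_commute add_mset_add_mset_same_iff)
  moreover have "a \<le> c"
    using bump_old[OF a bump_mem[OF c]] none bump_gt[OF c] xyz by force
  ultimately show ?thesis using ca az bz bc False by auto
qed


lemma insert_row_bump:
  assumes "sorted R" "y0 \<in> set R" "x < y0"
  obtains y R' where "insert_row x R = (R', Some y)" "sorted R'" "bump (mset R) x y (mset R')"
proof -
  let ?c = "bump_index x R"
  have c: "?c < length R"
  proof (rule ccontr)
    assume "\<not> ?c < length R"
    moreover obtain b where "b < length R" "R ! b = y0" using assms(2) by (metis in_set_conv_nth)
    ultimately show False using bump_index_less[of b x R] assms(3) by simp
  qed
  have "R ! ?c \<le> r" if r: "r \<in> set R" "x < r" for r
  proof -
    obtain b where b: "b < length R" "R ! b = r" using r(1) by (metis in_set_conv_nth)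
    then have "?c \<le> b" using bump_index_less[of b x R] r(2) by (meson not_le)
    then show ?thesis using assms(1) b by (auto simp: sorted_iff_nth_mono)
  qed
  moreover have "mset (R[?c := x]) = add_mset x (mset R - {#R ! ?c#})"
    using c by (simp add: mset_update)
  ultimately have "bump (mset R) x (R ! ?c) (mset (R[?c := x]))"
    using c bump_index_nth[OF c] by (simp add: bump_def)
  then show thesis using that c sorted_update_bump[OF assms(1) c] by (simp add: insert_row_eq)
qed

definition knuth_triple :: "nat list \<Rightarrow> nat list \<Rightarrow> bool" where
  "knuth_triple v w \<longleftrightarrow> (\<exists>x y z. x < y \<and> y \<le> z \<and> v = [y, x, z] \<and> w = [y, z, x])
     \<or> (\<exists>x y z. x \<le> y \<and> y < z \<and> v = [x, z, y] \<and> w = [z, x, y])"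

lemma knuth_iff_triple:
  "knuth v w \<longleftrightarrow> (\<exists>A B v' w'. knuth_triple v' w' \<and> v = A @ v' @ B \<and> w = A @ w' @ B)"
proof
  assume "knuth v w"
  then show "\<exists>A B v' w'. knuth_triple v' w' \<and> v = A @ v' @ B \<and> w = A @ w' @ B"
    by cases (unfold knuth_triple_def, blast+)
qed (auto simp: knuth_triple_def intro: knuth_yxz[simplified] knuth_xzy[simplified])

lemma insert_row_bump_count:
  assumes "sorted R" "Suc k \<le> count (mset R) t" "x < t"
  obtains y R' where "insert_row x R = (R', Some y)" "sorted R'" "bump (mset R) x y (mset R')"
    "k \<le> count (mset R') t" "y \<le> t"
proof -
  have t: "t \<in># mset R" using assms(2) by (metis Suc_le_D count_greater_zero_iff zero_less_Suc)
  then obtain y R' where *: "insert_row x R = (R', Some y)" "sorted R'" "bump (mset R) x y (mset R')"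
    using insert_row_bump[OF assms(1) _ assms(3)] by (metis set_mset_mset)
  moreover have "k \<le> count (mset R') t"
  proof -
    have "count (add_mset y (mset R')) t = count (add_mset x (mset R)) t"
      using bump_add_mset[OF *(3)] by simp
    then show ?thesis using assms(2) by (auto split: if_splits)
  qed
  moreover have "y \<le> t" using bump_le[OF *(3) t assms(3)] .
  ultimately show thesis by (rule that)
qed

text \<open>The letter \<open>t\<close> serves as padding: with three copies of it at hand, each of the three insertions
  bumps a letter, so that appending needs no separate treatment.\<close>

lemma feed_triple_padded:
  assumes "knuth_triple v w" "sorted R" "3 \<le> count (mset R) t" "\<forall>x \<in> set v. x < t"
  shows "fst (feed R v) = fst (feed R w) \<and>
    (knuth_triple (snd (feed R v)) (snd (feed R w)) \<or> knuth_triple (snd (feed R w)) (snd (feed R v))) \<and>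
    (\<forall>y \<in> set (snd (feed R v)). y \<le> t)"
proof -
  have feed3: "\<exists>R' p' q' r' M1 M2. feed R [p, q, r] = (R', [p', q', r']) \<and> sorted R'
     \<and> bump (mset R) p p' M1 \<and> bump M1 q q' M2 \<and> bump M2 r r' (mset R') \<and> p' \<le> t \<and> q' \<le> t \<and> r' \<le> t"
    if pqr: "p < t" "q < t" "r < t" for p q r
  proof -
    obtain R1 p' where 1: "insert_row p R = (R1, Some p')" "sorted R1" "bump (mset R) p p' (mset R1)"
      "2 \<le> count (mset R1) t" "p' \<le> t"
      by (rule insert_row_bump_count[OF assms(2), of 2 t p]) (use assms(3) pqr in auto)
    obtain R2 q' where 2: "insert_row q R1 = (R2, Some q')" "sorted R2" "bump (mset R1) q q' (mset R2)"
      "1 \<le> count (mset R2) t" "q' \<le> t"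
      by (rule insert_row_bump_count[OF 1(2), of 1 t q]) (use 1(4) pqr in auto)
    obtain R3 r' where 3: "insert_row r R2 = (R3, Some r')" "sorted R3" "bump (mset R2) r r' (mset R3)"
      "r' \<le> t"
      by (rule insert_row_bump_count[OF 2(2), of 0 t r]) (use 2(4) pqr in auto)
    show ?thesis
      by (rule exI[of _ R3], rule exI[of _ p'], rule exI[of _ q'], rule exI[of _ r'],
          rule exI[of _ "mset R1"], rule exI[of _ "mset R2"]) (use 1 2 3 in simp)
  qed
  from assms(1) consider
      (yxz) x y z where "x < y" "y \<le> z" "v = [y, x, z]" "w = [y, z, x]"
    | (xzy) x y z where "x \<le> y" "y < z" "v = [x, z, y]" "w = [z, x, y]"
    unfolding knuth_triple_def by blast
  then show ?thesis
  proof cases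
    case yxz
    obtain R1 b a c M1 M2 where 1: "feed R v = (R1, [b, a, c])" "sorted R1"
      "bump (mset R) y b M1" "bump M1 x a M2" "bump M2 z c (mset R1)" "b \<le> t" "a \<le> t" "c \<le> t"
      using feed3[of y x z] yxz assms(4) by auto
    obtain R2 b' c' a' M1' M2' where 2: "feed R w = (R2, [b', c', a'])" "sorted R2"
      "bump (mset R) y b' M1'" "bump M1' z c' M2'" "bump M2' x a' (mset R2)"
      using feed3[of y z x] yxz assms(4) by auto
    have b: "b' = b" "M1' = M1" using bump_unique[OF 1(3) 2(3)] by auto
    have "a' = a \<and> c' = c \<and> mset R2 = mset R1 \<and> a < b \<and> b \<le> c"
      using bump_yxz[OF 1(3-5) 2(4,5)[unfolded b] yxz(1,2)] .
    moreover from this have "R2 = R1" using 1(2) 2(2) by (metis properties_for_sort sorted_sort_id)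
    ultimately show ?thesis using 1 2 b by (auto simp: knuth_triple_def)
  next
    case xzy
    obtain R1 a c b M1 M2 where 1: "feed R v = (R1, [a, c, b])" "sorted R1"
      "bump (mset R) x a M1" "bump M1 z c M2" "bump M2 y b (mset R1)" "b \<le> t" "a \<le> t" "c \<le> t"
      using feed3[of x z y] xzy assms(4) by auto
    obtain R2 a' b' c' M1' M2' where 2: "feed R w = (R2, [c', a', b'])" "sorted R2"
      "bump (mset R) z c' M1'" "bump M1' x a' M2'" "bump M2' y b' (mset R2)"
      using feed3[of z x y] xzy assms(4) by auto
    have *: "mset R2 = mset R1 \<and> (a' = a \<and> c' = c \<and> b' = b \<and> a \<le> b \<and> b < c \<or>
                     b' = c \<and> c' = a \<and> a' = b \<and> b < a \<and> a \<le> c)"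
      using bump_xzy[OF 1(3-5) 2(3-5) xzy(1,2)] .
    moreover from this have "R2 = R1" using 1(2) 2(2) by (metis properties_for_sort sorted_sort_id)
    ultimately show ?thesis using 1 2 by (auto simp: knuth_triple_def)
  qed
qed

text \<open>Padding a row by large letters does not disturb the insertion. Where a letter would be appended,
  it now bumps a copy of \<open>t\<close>; erasing \<open>t\<close> from the result and from the bumped word recovers the
  original insertion.\<close>

lemma insert_row_padded:
  assumes "x < t" "\<forall>r \<in> set R. r < t"
  shows "insert_row x (R @ replicate (Suc k) t) = (case insert_row x R of
     (R', Some y) \<Rightarrow> (R' @ replicate (Suc k) t, Some y) | (R', None) \<Rightarrow> (R' @ replicate k t, Some t))"
  using assms by (induction R) (auto split: prod.split option.split)

lemma set_insert_row:
  assumes "insert_row x R = (R', b)"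
  shows "set R' \<union> set_option b = insert x (set R)"
proof -
  have "set (fst (insert_row x R)) \<union> set_option (snd (insert_row x R)) = insert x (set R)"
  proof (induction R)
    case (Cons r R)
    then show ?case by (cases "x < r") (auto simp: case_prod_beta)
  qed simp
  then show ?thesis using assms by simp
qed

lemma feed_padded:
  assumes "\<forall>x \<in> set w. x < t" "\<forall>r \<in> set R. r < t" "length w \<le> k"
  shows "(\<exists>k'. fst (feed (R @ replicate k t) w) = fst (feed R w) @ replicate k' t)
    \<and> snd (feed R w) = filter (\<lambda>y. y < t) (snd (feed (R @ replicate k t) w))"
  using assms
proof (induction w arbitrary: R k)
  case (Cons x w)
  obtain k0 where k: "k = Suc k0" using Cons.prems(3) by (cases k) auto
  obtain R1 b where ins: "insert_row x R = (R1, b)" by fastforce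
  have R1: "\<forall>r \<in> set R1. r < t" and bt: "\<forall>y \<in> set_option b. y < t"
    using set_insert_row[OF ins] Cons.prems(1,2) by auto
  have pad: "insert_row x (R @ replicate k t) = (case (R1, b) of
     (R', Some y) \<Rightarrow> (R' @ replicate (Suc k0) t, Some y) | (R', None) \<Rightarrow> (R' @ replicate k0 t, Some t))"
    using insert_row_padded[of x t R k0] Cons.prems k ins by simp
  show ?case using Cons.IH[OF _ R1, of k0] Cons.IH[OF _ R1, of k] Cons.prems k ins pad bt
    by (cases b) (auto split: prod.split)
qed auto

lemma set_feed: "set (fst (feed R w)) \<subseteq> set R \<union> set w"
proof (induction w arbitrary: R)
  case (Cons x w)
  obtain R' b where ins: "insert_row x R = (R', b)" by fastforce
  have "set (fst (feed R (x # w))) = set (fst (feed R' w))"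
    using ins by (auto split: prod.split)
  then show ?case using Cons.IH[of R'] set_insert_row[OF ins] by auto
qed simp

text \<open>Erase the padding: a Knuth relation in which the greatest letter \<open>z\<close> is erased becomes an
  equality, since what is left is a single letter, or two letters in the same order.\<close>

lemma feed_triple:
  assumes "knuth_triple v w" "sorted R"
  shows "fst (feed R v) = fst (feed R w) \<and> (snd (feed R v) = snd (feed R w) \<or>
    knuth_triple (snd (feed R v)) (snd (feed R w)) \<or> knuth_triple (snd (feed R w)) (snd (feed R v)))"
proof -
  define t where "t = Suc (Max (set (v @ w @ R)))"
  have t: "\<forall>x \<in> set v. x < t" "\<forall>x \<in> set w. x < t" "\<forall>x \<in> set R. x < t"
    by (auto simp: t_def less_Suc_eq_le)
  have len: "length v = 3" "length w = 3" using assms(1) by (auto simp: knuth_triple_def)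
  let ?R = "R @ replicate 3 t"
  have sorted: "sorted ?R" using assms(2) t(3) by (auto simp: sorted_append dest: order.strict_implies_order)
  have *: "fst (feed ?R v) = fst (feed ?R w)"
    "knuth_triple (snd (feed ?R v)) (snd (feed ?R w)) \<or> knuth_triple (snd (feed ?R w)) (snd (feed ?R v))"
    "\<forall>y \<in> set (snd (feed ?R v)). y \<le> t"
    using feed_triple_padded[OF assms(1) sorted _ t(1)] by auto
  have pad: "(\<exists>k'. fst (feed ?R u) = fst (feed R u) @ replicate k' t)
    \<and> snd (feed R u) = filter (\<lambda>y. y < t) (snd (feed ?R u))" if "u = v \<or> u = w" for u
    using feed_padded[OF _ t(3), of u 3] t(1,2) len that by auto
  then obtain k k' where "fst (feed ?R v) = fst (feed R v) @ replicate k t"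
    "fst (feed ?R w) = fst (feed R w) @ replicate k' t" by blast
  moreover have "filter (\<lambda>y. y < t) (fst (feed R u)) = fst (feed R u)" if "\<forall>x \<in> set u. x < t" for u
    using set_feed[of R u] that t(3) by (auto simp: filter_id_conv)
  ultimately have fst_eq: "fst (feed R v) = fst (feed R w)"
    using arg_cong[OF *(1), of "filter (\<lambda>y. y < t)"] t by simp
  have snd_eq: "snd (feed R v) = filter (\<lambda>y. y < t) (snd (feed ?R v))"
    "snd (feed R w) = filter (\<lambda>y. y < t) (snd (feed ?R w))"
    using pad by blast+
  have filter_triple: "filter (\<lambda>y. y < t) v' = filter (\<lambda>y. y < t) w' \<or>
      knuth_triple (filter (\<lambda>y. y < t) v') (filter (\<lambda>y. y < t) w')"
    if vw: "knuth_triple v' w'" "\<forall>y \<in> set v'. y \<le> t" for v' w'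
  proof -
    from vw(1) consider
        (yxz) x y z where "x < y" "y \<le> z" "v' = [y, x, z]" "w' = [y, z, x]"
      | (xzy) x y z where "x \<le> y" "y < z" "v' = [x, z, y]" "w' = [z, x, y]"
      unfolding knuth_triple_def by blast
    then show ?thesis
    proof cases
      case yxz
      then show ?thesis by (cases "z < t") (auto simp: knuth_triple_def)
    next
      case xzy
      then show ?thesis using vw(2) by (cases "z < t") (auto simp: knuth_triple_def)
    qed
  qed
  have "set (snd (feed ?R w)) = set (snd (feed ?R v))"
    using *(2) by (auto simp: knuth_triple_def)
  then have "\<forall>y \<in> set (snd (feed ?R w)). y \<le> t" using *(3) by simp
  then have "snd (feed R v) = snd (feed R w) \<or>
    knuth_triple (snd (feed R v)) (snd (feed R w)) \<or> knuth_triple (snd (feed R w)) (snd (feed R v))"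
    unfolding snd_eq using *(2,3) filter_triple by metis
  with fst_eq show ?thesis by simp
qed

lemma length_feed: "length (snd (feed R w)) \<le> length w"
proof (induction w arbitrary: R)
  case (Cons x w)
  obtain R' b where "insert_row x R = (R', b)" by fastforce
  then show ?case using Cons.IH[of R'] by (auto split: prod.split option.split)
qed simp

text \<open>A Knuth relation between the inserted words is passed on from row to row. It has to become an
  equality at the latest below the last row, because an empty row bumps at most two of three
  letters.\<close>

lemma insert_word_triple:
  assumes "knuth_triple v w" "\<forall>R \<in> set P. sorted R"
  shows "insert_word P v = insert_word P w"
  using assms
proof (induction P arbitrary: v w)
  case Nil
  have ne: "v \<noteq> []" "w \<noteq> []" and len: "length v = 3" "length w = 3"
    using Nil.prems by (auto simp: knuth_triple_def)
  have "length (snd (feed [] v)) < 3 \<and> length (snd (feed [] w)) < 3"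
  proof -
    have "length (snd (feed [] u)) < 3" if "length u = 3" for u
    proof -
      obtain a u' where u: "u = a # u'" "length u' = 2"
        using \<open>length u = 3\<close> by (cases u) auto
      then show ?thesis using length_feed[of "[a]" u'] by (auto split: prod.split)
    qed
    then show ?thesis using len by blast
  qed
  then have "\<not> knuth_triple (snd (feed [] v)) (snd (feed [] w))"
    "\<not> knuth_triple (snd (feed [] w)) (snd (feed [] v))" by (auto simp: knuth_triple_def)
  then have "feed [] v = feed [] w" using feed_triple[OF Nil.prems(1), of "[]"] by (auto simp: prod_eq_iff)
  then show ?case using ne by (simp add: insert_word_Nil insert_word_Cons)
next
  case (Cons R P)
  have "insert_word P (snd (feed R v)) = insert_word P (snd (feed R w))"
    using feed_triple[OF Cons.prems(1), of R] Cons.IH Cons.prems(2) by auto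
  then show ?case using feed_triple[OF Cons.prems(1), of R] Cons.prems(2) by (simp add: insert_word_Cons)
qed

lemma sorted_rows_row_insert:
  "\<forall>R \<in> set P. sorted R \<Longrightarrow> \<forall>R \<in> set (fst (row_insert x P)). sorted R"
proof (induction P arbitrary: x)
  case (Cons R P)
  obtain R' b where ins: "insert_row x R = (R', b)" by fastforce
  then have "sorted R'" using sorted_insert_row[of R x] Cons.prems by simp
  then show ?case using Cons.IH[of "the b"] Cons.prems ins by (cases b) (auto simp: case_prod_beta)
qed simp

lemma sorted_rows_insert_word:
  "\<forall>R \<in> set P. sorted R \<Longrightarrow> \<forall>R \<in> set (insert_word P w). sorted R"
proof (induction w arbitrary: P)
  case (Cons x w)
  show ?case using Cons.IH[OF sorted_rows_row_insert[OF Cons.prems]] by simp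
qed simp

theorem insertion_tableau_plactic: "v \<approx> w \<Longrightarrow> insertion_tableau v = insertion_tableau w"
proof (induction rule: equivclp_induct)
  case (step u w)
  have "insertion_tableau u = insertion_tableau w" if "knuth u w" for u w
    using that insert_word_triple sorted_rows_insert_word[of "[]"]
    by (auto simp: knuth_iff_triple insertion_tableau_eq)
  then show ?case using step by metis
qed simp

section \<open>The reading word\<close>

text \<open>The larger letters that follow \<open>r\<close> and precede \<open>x\<close> are passed from right to left; the left
  neighbour of each serves as the witness of the Knuth relation.\<close>

lemma bump_to_front:
  assumes "sorted (r # R)" "x < r"
  shows "r # R @ [x] \<approx> r # x # R"
  using assms
proof (induction R rule: rev_induct)
  case (snoc z R)
  have "last (r # R) \<in> set (r # R)" by (rule last_in_set) simp
  moreover have "\<forall>y \<in> set (r # R). r \<le> y \<and> y \<le> z" using snoc.prems by (auto simp: sorted_append)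
  ultimately have "x < last (r # R)" "last (r # R) \<le> z"
    using snoc.prems(2) by fastforce+
  then have "knuth (butlast (r # R) @ [last (r # R), x, z] @ []) (butlast (r # R) @ [last (r # R), z, x] @ [])"
    by (rule knuth_yxz)
  then have "r # R @ [z, x] \<approx> r # R @ [x, z]"
    using append_butlast_last_id[of "r # R"]
    by (metis append.assoc append_Cons append_Nil append_Nil2 list.discI plactic_if_knuth plactic_sym)
  also have "r # R @ [x, z] \<approx> r # x # R @ [z]"
    using plactic_append2[OF snoc.IH, of "[z]"] snoc.prems by (auto simp: sorted_append)
  finally show ?case by simp
qed simp

lemma insert_row_less: "insert_row x R = (R', Some y) \<Longrightarrow> x < y"
  using bump_index_nth by (auto simp: insert_row_eq split: if_splits)

text \<open>Row insertion consists of Knuth relations: the letter \<open>x\<close> moves to the left as far as the letter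
  that it bumps, which then moves on to the front.\<close>

lemma insert_row_plactic:
  "sorted R \<Longrightarrow> R @ [x] \<approx> (case insert_row x R of (R', None) \<Rightarrow> R' | (R', Some y) \<Rightarrow> y # R')"
proof (induction R)
  case (Cons r R)
  show ?case
  proof (cases "x < r")
    case True
    then show ?thesis using bump_to_front[OF Cons.prems] by simp
  next
    case False
    obtain R' b where ins: "insert_row x R = (R', b)" by fastforce
    have IH: "r # R @ [x] \<approx> r # (case b of None \<Rightarrow> R' | Some y \<Rightarrow> y # R')"
      using plactic_Cons[OF Cons.IH, of r] Cons.prems ins by simp
    show ?thesis
    proof (cases b)
      case None
      then show ?thesis using False ins IH by simp
    next
      case (Some y)
      obtain h H where R': "R' = h # H" "r \<le> h" "h < y"
        using ins Some False Cons.prems insert_row_less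
        by (cases R) (fastforce split: if_splits prod.splits)+
      have "r # y # R' \<approx> y # r # R'"
        using plactic_if_knuth[OF knuth_xzy[OF R'(2,3), of "[]" H]] R' by simp
      then show ?thesis using IH Some ins False plactic_trans by simp
    qed
  qed
qed simp

lemma reading_word_simps [simp]:
  "reading_word [] = []" "reading_word (R # U) = reading_word U @ R"
  by (simp_all add: reading_word_def)

lemma reading_word_row_insert:
  "\<forall>R \<in> set P. sorted R \<Longrightarrow> reading_word (fst (row_insert x P)) \<approx> reading_word P @ [x]"
proof (induction P arbitrary: x)
  case (Cons R P)
  obtain R' b where ins: "insert_row x R = (R', b)" by fastforce
  have R: "reading_word (R # P) @ [x] \<approx> reading_word P @ (case b of None \<Rightarrow> R' | Some y \<Rightarrow> y # R')"
    using plactic_append1[OF insert_row_plactic[of R x]] Cons.prems ins by simp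
  show ?case
  proof (cases b)
    case None
    then show ?thesis using R ins plactic_sym by simp
  next
    case (Some y)
    have "reading_word (fst (row_insert x (R # P))) = reading_word (fst (row_insert y P)) @ R'"
      using ins Some by (simp add: case_prod_beta)
    also have "\<dots> \<approx> (reading_word P @ [y]) @ R'"
      using Cons by (intro plactic_append2) auto
    also have "(reading_word P @ [y]) @ R' \<approx> reading_word (R # P) @ [x]"
      using plactic_sym[OF R] Some by simp
    finally show ?thesis .
  qed
qed simp

lemma reading_word_insert_word:
  "\<forall>R \<in> set P. sorted R \<Longrightarrow> reading_word (insert_word P w) \<approx> reading_word P @ w"
proof (induction w arbitrary: P)
  case (Cons x w)
  have "reading_word (insert_word P (x # w)) \<approx> reading_word (fst (row_insert x P)) @ w"
    using Cons sorted_rows_row_insert[OF Cons.prems] by simp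
  also have "\<dots> \<approx> (reading_word P @ [x]) @ w"
    by (rule plactic_append2[OF reading_word_row_insert[OF Cons.prems]])
  finally show ?case by simp
qed simp

theorem reading_word_insertion_tableau: "reading_word (insertion_tableau w) \<approx> w"
  using reading_word_insert_word[of "[]" w] by (simp add: insertion_tableau_eq)

corollary plactic_iff_insertion_tableau:
  "v \<approx> w \<longleftrightarrow> insertion_tableau v = insertion_tableau w"
  by (metis insertion_tableau_plactic reading_word_insertion_tableau plactic_sym plactic_trans)

section \<open>Semistandard tableaux\<close>

definition above :: "nat list \<Rightarrow> nat list \<Rightarrow> bool" where
  "above R S \<longleftrightarrow> length S \<le> length R \<and> (\<forall>c < length S. R ! c < S ! c)"

fun semistandard :: "tableau \<Rightarrow> bool" where
  "semistandard [] \<longleftrightarrow> True"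
| "semistandard (R # U) \<longleftrightarrow> sorted R \<and> R \<noteq> [] \<and> (U \<noteq> [] \<longrightarrow> above R (hd U)) \<and> semistandard U"

text \<open>The letter bumped from column \<open>c\<close> of \<open>R\<close> enters \<open>S\<close> in column \<open>c\<close> or further to the left, since
  the entry of \<open>S\<close> in column \<open>c\<close>, if any, exceeds it. There it stands below letters that are at
  most \<open>x\<close>.\<close>

lemma above_insert:
  assumes "above R S" "bump_index x R < length R" "y = R ! bump_index x R"
  shows "above (R[bump_index x R := x]) (fst (insert_row y S))"
proof -
  let ?c = "bump_index x R" and ?b = "bump_index y S"
  have xy: "x < y" using assms bump_index_nth by simp
  have bc: "?b \<le> ?c"
  proof (rule ccontr)
    assume "\<not> ?b \<le> ?c"
    then have "?c < ?b" by simp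
    then have "S ! ?c \<le> y" "?c < length S" using bump_index_less bump_index_le[of y S] by auto
    then show False using assms by (auto simp: above_def)
  qed
  have le: "R[?c := x] ! k \<le> R ! k" for k
    using assms xy by (cases "k = ?c") (auto simp: nth_list_update)
  have b: "R[?c := x] ! ?b < y"
  proof (cases "?b = ?c")
    case False
    then have "R ! ?b \<le> x" using bc bump_index_less by simp
    then show ?thesis using False xy by simp
  qed (use assms xy in auto)
  show ?thesis
  proof (cases "?b < length S")
    case True
    then have "R[?c := x] ! k < S[?b := y] ! k" if "k < length S" for k
      using that assms(1) le[of k] b by (cases "k = ?b") (auto simp: above_def intro: le_less_trans)
    then show ?thesis using True assms(1) by (auto simp: insert_row_eq above_def)
  next
    case False
    then have "?b = length S" using bump_index_le[of y S] by simp
    moreover from this have "length S < length R" using bc assms(2) by simp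
    moreover have "R[?c := x] ! k < S ! k" if "k < length S" for k
      using that assms(1) le[of k] by (auto simp: above_def intro: le_less_trans)
    ultimately show ?thesis using b False assms(1)
      by (auto simp: insert_row_eq above_def nth_append less_Suc_eq)
  qed
qed

lemma hd_row_insert: "U \<noteq> [] \<Longrightarrow> hd (fst (row_insert x U)) = fst (insert_row x (hd U))"
  by (cases U) (auto split: prod.split option.split)

lemma row_insert_neq_Nil [simp]: "fst (row_insert x U) \<noteq> []"
  by (cases U) (auto split: prod.split option.split)

lemma semistandard_row_insert: "semistandard U \<Longrightarrow> semistandard (fst (row_insert x U))"
proof (induction U arbitrary: x)
  case (Cons R U)
  let ?c = "bump_index x R"
  have s: "sorted R" "R \<noteq> []" "semistandard U" using Cons.prems by auto
  show ?case
  proof (cases "?c < length R")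
    case True
    let ?y = "R ! ?c"
    have ins: "insert_row x R = (R[?c := x], Some ?y)" using True by (simp add: insert_row_eq)
    have "above (R[?c := x]) (hd (fst (row_insert ?y U)))"
    proof (cases "U = []")
      case True
      then show ?thesis using \<open>?c < length R\<close> bump_index_nth[OF \<open>?c < length R\<close>]
          bump_index_less[of 0 x R]
        by (cases "?c = 0") (auto simp: above_def Suc_le_eq)
    next
      case False
      then show ?thesis using above_insert[OF _ True refl, of "hd U"] Cons.prems
        by (simp add: hd_row_insert)
    qed
    then show ?thesis using ins Cons.IH[OF s(3), of ?y] s(2) sorted_update_bump[OF s(1) True]
      by (auto split: prod.split)
  next
    case False
    have "above (R @ [x]) S" if "above R S" for S
      using that by (auto simp: above_def nth_append)
    then show ?thesis using False sorted_append_bump[OF s(1) False] Cons.prems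
      by (simp add: insert_row_eq)
  qed
qed (simp add: above_def)

lemma semistandard_insertion_tableau: "semistandard (insertion_tableau w)"
proof -
  have "semistandard P \<Longrightarrow> semistandard (insert_word P w)" for P
    by (induction w arbitrary: P) (auto intro: semistandard_row_insert)
  then show ?thesis by (simp add: insertion_tableau_eq)
qed

lemma insert_row_prefix:
  "\<forall>y \<in> set A. y \<le> x \<Longrightarrow> insert_row x (A @ R) = (case insert_row x R of (R', b) \<Rightarrow> (A @ R', b))"
  by (induction A) (auto split: prod.split)

text \<open>The letters of \<open>C\<close> replace the entries of \<open>S\<close> one by one from left to right; \<open>A\<close> is the part of
  the row that has been replaced already.\<close>

lemma feed_above:
  assumes "sorted (A @ C)" "length S \<le> length C" "\<forall>k < length S. C ! k < S ! k"
  shows "feed (A @ S) C = (A @ C, S)"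
  using assms
proof (induction C arbitrary: A S)
  case (Cons c C)
  have A: "\<forall>y \<in> set A. y \<le> c" using Cons.prems(1) by (auto simp: sorted_append)
  show ?case
  proof (cases S)
    case Nil
    then show ?thesis using Cons.IH[of "A @ [c]" "[]"] Cons.prems(1) insert_row_prefix[OF A, of "[]"] by simp
  next
    case (Cons s S')
    have lt: "\<forall>k < length S'. C ! k < S' ! k" and "c < s"
      using Cons.prems(3) \<open>S = s # S'\<close> by fastforce+
    then show ?thesis
      using Cons.IH[of "A @ [c]" S'] Cons.prems(1,2) insert_row_prefix[OF A, of S] \<open>S = s # S'\<close>
      by simp
  qed
qed simp

lemma insert_word_above: "semistandard (R # U) \<Longrightarrow> insert_word U R = R # U"
proof (induction U arbitrary: R)
  case Nil
  then show ?case using feed_above[of "[]" R "[]"] by (simp add: insert_word_Nil insert_word_Cons)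
next
  case (Cons S U)
  have "feed S R = (R, S)" using feed_above[of "[]" R S] Cons.prems by (auto simp: above_def)
  then show ?case using Cons.IH[of S] Cons.prems by (simp add: insert_word_Cons)
qed

theorem insertion_tableau_reading_word: "semistandard U \<Longrightarrow> insertion_tableau (reading_word U) = U"
proof (induction U)
  case (Cons R U)
  then show ?case using insert_word_above[OF Cons.prems] by (simp add: insertion_tableau_eq)
qed (simp add: insertion_tableau_eq)

section \<open>Symmetry of RSK\<close>

lemma append_to_row_simps [simp]:
  "append_to_row r a [] = [[a]]"
  "append_to_row 0 a (R # Q) = (R @ [a]) # Q"
  "append_to_row (Suc r) a (R # Q) = R # append_to_row r a Q"
  by (simp_all add: append_to_row_def)

lemma set_concat_append_to_row: "set (concat (append_to_row r a Q)) = insert a (set (concat Q))"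
proof (induction Q arbitrary: r)
  case (Cons R Q)
  then show ?case by (cases r) auto
qed simp

lemma set_concat_row_insert: "set (concat (fst (row_insert x P))) = insert x (set (concat P))"
proof (induction P arbitrary: x)
  case (Cons R P)
  obtain R' b where ins: "insert_row x R = (R', b)" by fastforce
  show ?case
  proof (cases b)
    case None
    then show ?thesis using ins set_insert_row[OF ins] by auto
  next
    case (Some y)
    have "set (concat (fst (row_insert x (R # P)))) = set R' \<union> insert y (set (concat P))"
      using ins Some Cons.IH[of y] by (simp add: case_prod_beta)
    then show ?thesis using set_insert_row[OF ins] Some by auto
  qed
qed simp

lemma row_insert_index: "snd (row_insert x P) \<le> length P"
  and length_row_insert: "length (fst (row_insert x P)) =
    (if snd (row_insert x P) = length P then Suc (length P) else length P)"
proof -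
  have "snd (row_insert x P) \<le> length P \<and> length (fst (row_insert x P)) =
    (if snd (row_insert x P) = length P then Suc (length P) else length P)"
  proof (induction P arbitrary: x)
    case (Cons R P)
    obtain R' b where ins: "insert_row x R = (R', b)" by fastforce
    then show ?case using Cons.IH[of "the b"] by (cases b) (auto split: prod.split)
  qed simp
  then show "snd (row_insert x P) \<le> length P" "length (fst (row_insert x P)) =
    (if snd (row_insert x P) = length P then Suc (length P) else length P)" by blast+
qed

lemma length_append_to_row:
  "r \<le> length Q \<Longrightarrow> length (append_to_row r a Q) = (if r = length Q then Suc (length Q) else length Q)"
  by (auto simp: append_to_row_def)

lemma insert_row_max: "\<forall>z \<in> set R. z \<le> x \<Longrightarrow> insert_row x R = (R @ [x], None)"
  using insert_row_prefix[of R x "[]"] by simp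

lemma row_insert_max: "\<forall>z \<in> set (concat P). z \<le> x \<Longrightarrow> row_insert x P = (append_to_row 0 x P, 0)"
  by (cases P) (auto simp: insert_row_max)

lemma insert_row_snoc:
  "insert_row y R = (R', b) \<Longrightarrow> y < x \<Longrightarrow>
   insert_row y (R @ [x]) = (case b of None \<Rightarrow> (R', Some x) | Some z \<Rightarrow> (R' @ [x], Some z))"
proof (induction R arbitrary: R')
  case (Cons r R)
  obtain R1 b1 where "insert_row y R = (R1, b1)" by fastforce
  then show ?case using Cons.IH[of R1] Cons.prems by (cases "y < r"; cases b) auto
qed auto

text \<open>A greatest letter \<open>x\<close> at the end of row \<open>r\<close> notices the insertion of \<open>y\<close> only if the insertion
  path ends in row \<open>r\<close>; then \<open>x\<close> is bumped and goes to the end of the next row. There may be other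
  copies of \<open>x\<close>; as they do not lie above row \<open>r\<close>, a path on its way to row \<open>r\<close> never carries an
  \<open>x\<close>.

  Both tableaux of the RSK correspondence are treated by this one lemma: the roles of \<open>x\<close> and \<open>y\<close>,
  and of the two row indices, are interchanged when one passes from the one to the other.\<close>

lemma row_insert_append_max:
  assumes "r \<le> length P" "\<forall>z \<in> set (concat P). z \<le> x" "\<forall>j < r. \<forall>z \<in> set (P ! j). z < x" "y < x"
    "row_insert y P = (P1, r1)"
  shows "row_insert y (append_to_row r x P)
    = (append_to_row (if r1 = r then Suc r else r) x P1, if r1 = r then Suc r else r1) \<and>
    (\<forall>j < (if r1 = r then Suc r else r). \<forall>z \<in> set (P1 ! j). z < x)"
  using assms
proof (induction P arbitrary: r y P1 r1)
  case (Cons R P)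
  obtain R' b where ins: "insert_row y R = (R', b)" by fastforce
  note snoc = insert_row_snoc[OF ins \<open>y < x\<close>]
  have R': "\<forall>z \<in> set R'. z < x" if "\<forall>z \<in> set R. z < x"
    using set_insert_row[OF ins] that \<open>y < x\<close> by auto
  have all: "\<forall>z \<in> set (concat P). z \<le> x" using Cons.prems(2) by auto
  show ?case
  proof (cases r)
    case 0
    show ?thesis
    proof (cases b)
      case None
      then have "\<not> bump_index y R < length R" using ins by (auto simp: insert_row_eq split: if_splits)
      then have len: "bump_index y R = length R" using bump_index_le[of y R] by simp
      have "z < x" if z: "z \<in> set R'" for z
      proof -
        have "R' = R @ [y]" using ins None by (auto simp: insert_row_eq split: if_splits)
        moreover have "z \<le> y" if "z \<in> set R"
          using that bump_index_less[of _ y R] len by (metis in_set_conv_nth)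
        ultimately show ?thesis using z \<open>y < x\<close> by auto
      qed
      then show ?thesis using 0 None ins snoc Cons.prems(5) row_insert_max[OF all] by auto
    next
      case (Some z)
      then show ?thesis using 0 ins snoc Cons.prems(5) by (auto simp: case_prod_beta)
    qed
  next
    case (Suc s)
    have Rx: "\<forall>z \<in> set R. z < x" using Cons.prems(3) Suc by auto
    show ?thesis
    proof (cases b)
      case None
      then show ?thesis using Suc ins Cons.prems(3,5) R'[OF Rx] by (auto simp: All_less_Suc2)
    next
      case (Some z)
      obtain P2 r2 where P2: "row_insert z P = (P2, r2)" by fastforce
      have z: "z < x" using Rx set_insert_row[OF ins] Some \<open>y < x\<close> by auto
      have less: "\<forall>j < s. \<forall>z \<in> set (P ! j). z < x" using Cons.prems(3) Suc by auto
      note IH = Cons.IH[OF _ all less z P2]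
      have s: "s \<le> length P" using Cons.prems(1) Suc by simp
      have P1: "P1 = R' # P2" "r1 = Suc r2" using Cons.prems(5) ins Some P2 by auto
      have "\<forall>j < (if r2 = s then Suc s else s). \<forall>z \<in> set (P2 ! j). z < x" using IH[OF s] by blast
      then have "\<forall>j < Suc (if r2 = s then Suc s else s). \<forall>z \<in> set (P1 ! j). z < x"
        using R'[OF Rx] P1 unfolding All_less_Suc2 by simp
      then show ?thesis using IH[OF s] P1 Suc ins Some by auto
    qed
  qed
qed auto

lemma rsk_Nil [simp]: "rsk [] = ([], [])"
  by (simp add: rsk_def)

lemma rsk_snoc: "rsk (A @ [(a, x)]) =
    (fst (row_insert x (fst (rsk A))), append_to_row (snd (row_insert x (fst (rsk A)))) a (snd (rsk A)))"
  by (simp add: rsk_def case_prod_beta)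

lemma fst_rsk: "fst (rsk A) = insertion_tableau (map snd A)"
  by (induction A rule: rev_induct) (auto simp: rsk_snoc insertion_tableau_def)

lemma rsk_entries:
  "set (concat (fst (rsk A))) = snd ` set A" "set (concat (snd (rsk A))) = fst ` set A"
  "length (snd (rsk A)) = length (fst (rsk A))"
proof -
  have "set (concat (fst (rsk A))) = snd ` set A \<and> set (concat (snd (rsk A))) = fst ` set A \<and>
    length (snd (rsk A)) = length (fst (rsk A))"
  proof (induction A rule: rev_induct)
    case (snoc c A)
    obtain a x where "c = (a, x)" by fastforce
    then show ?case
      using snoc row_insert_index[of x "fst (rsk A)"] length_row_insert[of x "fst (rsk A)"]
      by (simp only: rsk_snoc fst_conv snd_conv set_concat_row_insert set_concat_append_to_row)
         (simp add: length_append_to_row)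
  qed simp
  then show "set (concat (fst (rsk A))) = snd ` set A" "set (concat (snd (rsk A))) = fst ` set A"
    "length (snd (rsk A)) = length (fst (rsk A))" by blast+
qed

text \<open>An additional column \<open>(x, a)\<close> whose letter \<open>a\<close> is the greatest (and the last one among equals) has
  the effect of a row insertion of \<open>x\<close> on the recording tableau, and of appending \<open>a\<close> to the row
  in which that insertion ends on the insertion tableau. This is clear when the column comes last,
  and it persists under later insertions by \<open>row_insert_append_max\<close>, applied to each of the two
  tableaux.\<close>

lemma rsk_extra_column:
  assumes "\<forall>(x', a') \<in> set V. x' < x \<and> a' \<le> a" "\<forall>(x', a') \<in> set W. x < x' \<and> a' < a"
    "sorted_wrt (<) (map fst (V @ W))"
  shows "rsk (V @ (x, a) # W) =
     (append_to_row (snd (row_insert x (snd (rsk (V @ W))))) a (fst (rsk (V @ W))),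
      fst (row_insert x (snd (rsk (V @ W))))) \<and>
    (\<forall>j < snd (row_insert x (snd (rsk (V @ W)))). \<forall>z \<in> set (fst (rsk (V @ W)) ! j). z < a)"
  using assms
proof (induction W rule: rev_induct)
  case Nil
  have "\<forall>z \<in> set (concat (fst (rsk V))). z \<le> a" "\<forall>z \<in> set (concat (snd (rsk V))). z \<le> x"
    using Nil.prems(1) by (fastforce simp del: set_concat simp: rsk_entries)+
  then show ?case using row_insert_max by (simp add: rsk_snoc del: set_concat)
next
  case (snoc c W)
  obtain t b where c: "c = (t, b)" by fastforce
  define P where "P = fst (rsk (V @ W))"
  define Q where "Q = snd (rsk (V @ W))"
  obtain Q1 r where Q1: "row_insert x Q = (Q1, r)" by fastforce
  obtain P1 r1 where P1: "row_insert b P = (P1, r1)" by fastforce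
  have ta: "b < a" "x < t" using snoc.prems(2) c by auto
  have r: "r \<le> length P" "r1 \<le> length Q"
    using row_insert_index[of x Q] row_insert_index[of b P] P1 Q1
    by (auto simp: P_def Q_def rsk_entries)
  have IH: "rsk (V @ (x, a) # W) = (append_to_row r a P, Q1)" "\<forall>j < r. \<forall>z \<in> set (P ! j). z < a"
    using snoc.IH snoc.prems Q1 by (auto simp: sorted_wrt_append P_def Q_def)
  have Pa: "\<forall>z \<in> set (concat P). z \<le> a"
    unfolding P_def rsk_entries using snoc.prems(1,2) by fastforce
  have Qt: "\<forall>z \<in> set (concat Q). z < t"
    unfolding Q_def rsk_entries using snoc.prems(3) c by (auto simp: sorted_wrt_append)
  have rows: "\<forall>j < r1. \<forall>z \<in> set (Q ! j). z < t"
    using Qt r(2) by (auto intro: nth_mem)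
  note ins_P = row_insert_append_max[OF r(1) Pa IH(2) ta(1) P1]
  have "\<forall>z \<in> set (concat Q). z \<le> t" using Qt by (auto intro: less_imp_le)
  note ins_Q = row_insert_append_max[OF r(2) this rows ta(2) Q1]
  have "rsk (V @ W @ [c]) = (P1, append_to_row r1 t Q)"
    using rsk_snoc[of "V @ W" t b] P1 c by (simp add: P_def Q_def)
  moreover have "rsk (V @ (x, a) # W @ [c]) =
      (append_to_row (if r1 = r then Suc r else r) a P1, append_to_row (if r1 = r then Suc r else r1) t Q1)"
    using rsk_snoc[of "V @ (x, a) # W" t b] IH(1) ins_P c by simp
  ultimately show ?case using ins_Q ins_P by auto
qed

definition array_less :: "nat \<times> nat \<Rightarrow> nat \<times> nat \<Rightarrow> bool" where
  "array_less c c' \<longleftrightarrow> fst c < fst c' \<or> fst c = fst c' \<and> snd c < snd c'"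

text \<open>The last column of \<open>L\<close> has the greatest letter. On the left, it is the column inserted last; on
  the right, it is an extra column in the sense of the preceding lemma.\<close>

theorem rsk_symmetry:
  assumes "sorted_wrt array_less L" "sorted_wrt (<) (map fst V)" "mset (map prod.swap L) = mset V"
  shows "rsk L = prod.swap (rsk V)"
  using assms
proof (induction L arbitrary: V rule: rev_induct)
  case (snoc c L)
  obtain a x where c: "c = (a, x)" by fastforce
  have "(x, a) \<in># mset V" using snoc.prems(3)[symmetric] c by simp
  then obtain V1 V2 where V: "V = V1 @ (x, a) # V2" by (metis set_mset_mset split_list)
  have mset: "mset (map prod.swap L) = mset (V1 @ V2)" using snoc.prems(3) c V by simp
  then have sets: "prod.swap ` set L = set V1 \<union> set V2" by (metis set_append set_map set_mset_mset)
  have sorted: "sorted_wrt (<) (map fst (V1 @ V2))"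
    using snoc.prems(2) V by (auto simp: sorted_wrt_append)
  have IH: "rsk L = prod.swap (rsk (V1 @ V2))"
    using snoc.IH[OF _ sorted mset] snoc.prems(1) by (simp add: sorted_wrt_append)
  have less: "a' < a \<or> a' = a \<and> x' < x" if "(x', a') \<in> set V1 \<union> set V2" for x' a'
  proof -
    have "(a', x') \<in> set L" using that sets by (metis (no_types, lifting) imageE swap_simp swap_swap)
    then show ?thesis using snoc.prems(1) c by (auto simp: sorted_wrt_append array_less_def)
  qed
  have fsts: "x' < x" if "(x', a') \<in> set V1" for x' a'
    using snoc.prems(2) V that by (force simp: sorted_wrt_append)
  have fsts': "x < x'" if "(x', a') \<in> set V2" for x' a'
    using snoc.prems(2) V that by (force simp: sorted_wrt_append)
  have "\<forall>(x', a') \<in> set V1. x' < x \<and> a' \<le> a" using less fsts by force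
  moreover have "\<forall>(x', a') \<in> set V2. x < x' \<and> a' < a" using less fsts' by force
  ultimately show ?case
    using rsk_extra_column[of V1 x a V2] sorted IH V c by (simp add: rsk_snoc)
qed simp

section \<open>Cyclic words\<close>

definition periodic :: "nat \<Rightarrow> (int \<Rightarrow> nat) \<Rightarrow> bool" where
  "periodic n f \<longleftrightarrow> (\<forall>k. f (k + int n) = f k)"

text \<open>On \<open>n\<close>-periodic words this exchanges the letters at the positions congruent to \<open>j\<close> with those at
  the positions congruent to \<open>j + 1\<close>.\<close>

definition swap_at :: "nat \<Rightarrow> int \<Rightarrow> (int \<Rightarrow> nat) \<Rightarrow> int \<Rightarrow> nat" where
  "swap_at n j f k = (if int n dvd k - j then f (k + 1) else if int n dvd k - j - 1 then f (k - 1) else f k)"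

definition descent :: "(int \<Rightarrow> nat) \<Rightarrow> int \<Rightarrow> bool" where
  "descent f k \<longleftrightarrow> f (k + 1) < f k"

text \<open>Knuth moves of type \<open>k\<close>. That two descents change in opposite directions makes the descent sets
  incomparable. Words are indexed from \<open>0\<close>, so that the type of a move of tabloids is \<open>k + 1\<close>
  (\<open>knuth_move_of_type_iff\<close>).\<close>

definition kmove :: "nat \<Rightarrow> int \<Rightarrow> (int \<Rightarrow> nat) \<Rightarrow> (int \<Rightarrow> nat) \<Rightarrow> bool" where
  "kmove n k f g \<longleftrightarrow> (\<exists>j. g = swap_at n j f) \<and>
     (descent f k \<and> \<not> descent g k \<and> \<not> descent f (k + 1) \<and> descent g (k + 1) \<or>
      \<not> descent f k \<and> descent g k \<and> descent f (k + 1) \<and> \<not> descent g (k + 1))"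

lemma descent_Suc: "descent f (k + 1) \<longleftrightarrow> f (k + 2) < f (k + 1)"
  by (simp add: descent_def add.assoc)

lemma periodicD: "periodic n f \<Longrightarrow> f (k + int n) = f k"
  by (simp add: periodic_def)

lemma periodic_mult: "periodic n f \<Longrightarrow> f (k + int n * m) = f k"
proof (induction m rule: int_induct[where k = 0])
  case (step1 i)
  then show ?case using periodicD[of n f "k + int n * i"] by (simp add: algebra_simps)
next
  case (step2 i)
  then show ?case using periodicD[of n f "k + int n * (i - 1)"] by (simp add: algebra_simps)
qed simp

lemma periodic_dvd: "periodic n f \<Longrightarrow> int n dvd k - l \<Longrightarrow> f k = f l"
  using periodic_mult[of n f l] by (metis add.commute diff_add_cancel dvdE)

lemma periodic_swap_at:
  assumes "periodic n f" shows "periodic n (swap_at n j f)"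
  unfolding periodic_def
proof
  fix k
  have "int n dvd k + int n - j \<longleftrightarrow> int n dvd k - j" "int n dvd k + int n - j - 1 \<longleftrightarrow> int n dvd k - j - 1"
    using dvd_add_left_iff[of "int n" "int n" "k - j"] dvd_add_left_iff[of "int n" "int n" "k - j - 1"]
    by (simp_all add: algebra_simps)
  moreover have "f (k + int n + 1) = f (k + 1)" "f (k + int n - 1) = f (k - 1)" "f (k + int n) = f k"
    using periodicD[OF assms, of "k + 1"] periodicD[OF assms, of "k - 1"] periodicD[OF assms, of k]
    by (simp_all add: algebra_simps)
  ultimately show "swap_at n j f (k + int n) = swap_at n j f k" by (simp add: swap_at_def)
qed

lemma periodic_kmove: "periodic n f \<Longrightarrow> kmove n k f g \<Longrightarrow> periodic n g"
  by (auto simp: kmove_def periodic_swap_at)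

lemma swap_at_swap_at:
  assumes "2 \<le> n" shows "swap_at n j (swap_at n j f) = f"
proof
  fix k
  have not1: "\<not> int n dvd 1" using assms by (auto dest!: zdvd_imp_le)
  have *: "\<not> int n dvd k - j - 1" if "int n dvd k - j"
    using that not1 by (metis diff_add_cancel add.commute dvd_add_right_iff)
  have "int n dvd k - 1 - j \<longleftrightarrow> int n dvd k - j - 1" "int n dvd k + 1 - j - 1 \<longleftrightarrow> int n dvd k - j"
    by (simp_all add: algebra_simps)
  moreover have "\<not> int n dvd k + 1 - j" if "int n dvd k - j"
    using that not1 dvd_add_right_iff[of "int n" "k - j" 1] by (simp add: algebra_simps)
  ultimately show "swap_at n j (swap_at n j f) k = f k" using * by (auto simp: swap_at_def)
qed

lemma not_kmove_1: "periodic 1 f \<Longrightarrow> \<not> kmove 1 k f g"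
  using periodicD[of 1 f k] periodicD[of 1 f "k + 1"] by (simp add: kmove_def descent_def)

lemma kmove_sym: "2 \<le> n \<Longrightarrow> kmove n k f g \<Longrightarrow> kmove n k g f"
  unfolding kmove_def using swap_at_swap_at by metis

lemma swap_at_cong: "int n dvd i - j \<Longrightarrow> swap_at n i f = swap_at n j f"
proof
  fix k assume *: "int n dvd i - j"
  have "int n dvd k - i \<longleftrightarrow> int n dvd k - j" "int n dvd k - i - 1 \<longleftrightarrow> int n dvd k - j - 1"
    using dvd_add_left_iff[OF *, of "k - i"] dvd_add_left_iff[OF *, of "k - i - 1"]
    by (simp_all add: algebra_simps)
  then show "swap_at n i f k = swap_at n j f k" by (simp add: swap_at_def)
qed

lemma swap_at_values:
  assumes "3 \<le> n"
  shows "swap_at n k f k = f (k + 1)" "swap_at n k f (k + 1) = f k" "swap_at n k f (k + 2) = f (k + 2)"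
    "swap_at n k f (k - 1) = f (k - 1)"
proof -
  have "\<not> int n dvd 1" "\<not> int n dvd 2" using assms by (auto dest!: zdvd_imp_le)
  moreover from this have "\<not> int n dvd - 1" "\<not> int n dvd - 2" by simp_all
  ultimately show "swap_at n k f k = f (k + 1)" "swap_at n k f (k + 1) = f k"
    "swap_at n k f (k + 2) = f (k + 2)" "swap_at n k f (k - 1) = f (k - 1)"
    by (simp_all add: swap_at_def)
qed

lemma swap_at_Suc_values:
  assumes "3 \<le> n"
  shows "swap_at n (k + 1) f k = f k" "swap_at n (k + 1) f (k + 1) = f (k + 2)"
    "swap_at n (k + 1) f (k + 2) = f (k + 1)"
  using swap_at_values[OF assms, of "k + 1" f] by (simp_all add: add.assoc)

lemma swap_at_2: "periodic 2 f \<Longrightarrow> swap_at 2 j f = (\<lambda>k. f (k + 1))"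
proof
  fix k assume *: "periodic 2 f"
  have "f (k - 1) = f (k + 1)" using periodicD[OF *, of "k - 1"] by (simp add: algebra_simps)
  moreover have "2 dvd k - j \<or> 2 dvd k - j - 1" by presburger
  ultimately show "swap_at 2 j f k = f (k + 1)" by (auto simp: swap_at_def)
qed

text \<open>An exchange elsewhere does not move the letter at \<open>k + 1\<close>, and so it has to change the letters on
  both sides of it. This happens only for \<open>n = 3\<close>, where these two letters are exchanged with each
  other; but then the two descents cannot change in opposite directions.\<close>

lemma kmove_cases:
  assumes "3 \<le> n" "periodic n f" "kmove n k f g"
  shows "g = swap_at n k f \<or> g = swap_at n (k + 1) f"
proof (rule ccontr)
  assume neither: "\<not> ?thesis"
  obtain j where g: "g = swap_at n j f" using assms(3) by (auto simp: kmove_def)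
  have nj: "\<not> int n dvd k - j" "\<not> int n dvd k + 1 - j"
    using neither g swap_at_cong[of n k j f] swap_at_cong[of n "k + 1" j f] by metis+
  have "k + 1 - j - 1 = k - j" "k + 2 - j - 1 = k + 1 - j" by simp_all
  then have vals: "g k = (if int n dvd k - j - 1 then f (k - 1) else f k)" "g (k + 1) = f (k + 1)"
    "g (k + 2) = (if int n dvd k + 2 - j then f (k + 3) else f (k + 2))"
    using nj by (simp_all add: g swap_at_def algebra_simps)
  have "g k \<noteq> f k \<and> g (k + 2) \<noteq> f (k + 2)"
    using assms(3) vals(2) by (auto simp: kmove_def descent_def add.assoc)
  then have dvds: "int n dvd k - j - 1" "int n dvd k + 2 - j" using vals by (auto split: if_splits)
  then have "int n dvd (k + 2 - j) - (k - j - 1)" using dvd_diff by blast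
  then have "int n dvd 3" by simp
  then have n: "n = 3" using assms(1) by (auto dest: zdvd_imp_le)
  have "f (k - 1) = f (k + 2)" "f (k + 3) = f k"
    using periodicD[OF assms(2), of "k - 1"] periodicD[OF assms(2), of k] n by (simp_all add: algebra_simps)
  then show False using assms(3) vals dvds by (auto simp: kmove_def descent_def add.assoc)
qed

text \<open>The two possible exchanges require different relative orders of the three letters involved.\<close>

lemma kmove_unique:
  assumes "2 \<le> n" "periodic n f" "kmove n k f g" "kmove n k f h"
  shows "g = h"
proof (cases "n = 2")
  case True
  then show ?thesis using assms swap_at_2 by (metis kmove_def)
next
  case False
  then have n: "3 \<le> n" using assms(1) by simp
  note v = swap_at_values[OF n, of k f] swap_at_Suc_values[OF n, of k f]
  show ?thesis
    using kmove_cases[OF n assms(2,3)] kmove_cases[OF n assms(2,4)] assms(3,4) v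
    unfolding kmove_def descent_Suc unfolding descent_def by (elim disjE) (simp_all, linarith+)
qed

section \<open>Linear windows of a cyclic word\<close>

definition window :: "nat \<Rightarrow> int \<Rightarrow> (int \<Rightarrow> nat) \<Rightarrow> nat list" where
  "window n o' f = map (\<lambda>i. f (o' + int i)) [0..<n]"

lemma length_window [simp]: "length (window n p f) = n"
  by (simp add: window_def)

lemma nth_window [simp]: "i < n \<Longrightarrow> window n p f ! i = f (p + int i)"
  by (simp add: window_def)

lemma window_inject:
  assumes "periodic n f" "periodic n g" "0 < n" "window n p f = window n p g"
  shows "f = g"
proof
  fix k
  let ?i = "nat ((k - p) mod int n)"
  have i: "?i < n" using assms(3) by (simp add: nat_less_iff)
  have dvd: "int n dvd k - (p + int ?i)"
  proof -
    have "k - (p + int ?i) = (k - p) - (k - p) mod int n" using assms(3) by simp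
    then show ?thesis by (simp only: dvd_minus_mod)
  qed
  have "f k = window n p f ! ?i" using periodic_dvd[OF assms(1) dvd] i by simp
  also have "\<dots> = g k" using periodic_dvd[OF assms(2) dvd] i assms(4) by simp
  finally show "f k = g k" .
qed

lemma window_swap_at:
  assumes "Suc m < n"
  shows "window n p (swap_at n (p + int m) f)
    = (window n p f)[m := window n p f ! Suc m, Suc m := window n p f ! m]"
proof (rule nth_equalityI)
  fix i assume "i < length (window n p (swap_at n (p + int m) f))"
  then have i: "i < n" by simp
  have small: "int n dvd x \<longleftrightarrow> x = 0" if "\<bar>x\<bar> < int n" for x :: int
    using that by (metis abs_of_nat dvd_0_right dvd_imp_le_int not_less)
  have "int n dvd p + int i - (p + int m) \<longleftrightarrow> i = m" "int n dvd p + int i - (p + int m) - 1 \<longleftrightarrow> i = Suc m"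
    using small[of "int i - int m"] small[of "int i - int m - 1"] i assms by auto
  then show "window n p (swap_at n (p + int m) f) ! i
    = (window n p f)[m := window n p f ! Suc m, Suc m := window n p f ! m] ! i"
    using i assms by (auto simp: swap_at_def nth_list_update algebra_simps)
qed simp

lemma window_rotate:
  assumes "periodic n f" "window n p f = a # w"
  shows "window n (p + 1) f = w @ [a]"
proof -
  obtain m where n: "n = Suc m" using assms(2) by (cases n) (auto simp: window_def)
  have "window n p f = f p # map (\<lambda>i. f (p + 1 + int i)) [0..<m]"
    unfolding window_def n by (simp add: upt_conv_Cons map_Suc_upt[symmetric] del: upt_Suc)
      (simp add: algebra_simps)
  moreover have "window n (p + 1) f = map (\<lambda>i. f (p + 1 + int i)) [0..<m] @ [f p]"
    using periodicD[OF assms(1), of p] n by (simp add: window_def algebra_simps)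
  ultimately show ?thesis using assms(2) by simp
qed

text \<open>Within a window, Knuth moves and elementary Knuth transformations are the same.\<close>

lemma kmove_if_knuth:
  assumes "periodic n f" "knuth_triple v v'" "window n p f = A @ v @ B"
  obtains g where "kmove n (p + int (length A)) f g" "window n p g = A @ v' @ B"
proof -
  let ?k = "length A"
  have len: "length v = 3" using assms(2) by (auto simp: knuth_triple_def)
  have n: "n = ?k + 3 + length B" using arg_cong[OF assms(3), of length] len by simp
  have val: "f (p + int ?k + int i) = v ! i" if "i < 3" for i
  proof -
    have "f (p + int ?k + int i) = window n p f ! (?k + i)" using that n by (simp add: add.assoc)
    also have "\<dots> = v ! i" unfolding assms(3) using that len by (simp add: nth_append)
    finally show ?thesis .
  qed
  have vals: "f (p + int ?k) = v ! 0" "f (p + int ?k + 1) = v ! 1" "f (p + int ?k + 2) = v ! 2"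
    using val[of 0] val[of 1] val[of 2] by simp_all
  obtain a b c where v: "v = [a, b, c]" using assms(2) by (auto simp: knuth_triple_def)
  have bounds: "Suc ?k < n" "Suc (Suc ?k) < n" using n by simp_all
  have win: "window n p (swap_at n (p + int ?k) f) = A @ [b, a, c] @ B"
    unfolding window_swap_at[OF bounds(1)] assms(3) v by (simp add: nth_append list_update_append)
  have "window n p (swap_at n (p + int (Suc ?k)) f) = A @ [a, c, b] @ B"
    unfolding window_swap_at[OF bounds(2)] assms(3) v by (simp add: nth_append list_update_append)
  then have win': "window n p (swap_at n (p + int ?k + 1) f) = A @ [a, c, b] @ B"
    by (simp add: add.commute add.left_commute)
  have n3: "3 \<le> n" using n by simp
  from assms(2) consider
      (yxz) x y z where "x < y" "y \<le> z" "v = [y, x, z]" "v' = [y, z, x]"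
    | (xzy) x y z where "x \<le> y" "y < z" "v = [x, z, y]" "v' = [z, x, y]"
    unfolding knuth_triple_def by blast
  then show thesis
  proof cases
    case yxz
    have "kmove n (p + int ?k) f (swap_at n (p + int ?k + 1) f)"
      unfolding kmove_def descent_Suc unfolding descent_def using yxz vals swap_at_Suc_values[OF n3]
      by auto
    then show thesis using that win' yxz v by simp
  next
    case xzy
    have "kmove n (p + int ?k) f (swap_at n (p + int ?k) f)"
      unfolding kmove_def descent_Suc unfolding descent_def using xzy vals swap_at_values[OF n3]
      by auto
    then show thesis using that win xzy v by simp
  qed
qed

lemma knuth_if_kmove:
  assumes "periodic n f" "kmove n (p + int i) f g" "i + 2 < n"
  shows "knuth (window n p f) (window n p g) \<or> knuth (window n p g) (window n p f)"
proof -
  let ?K = "p + int i" and ?w = "window n p f"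
  have n3: "3 \<le> n" using assms(3) by simp
  define A B where "A = take i ?w" and "B = drop (Suc (Suc (Suc i))) ?w"
  have "drop i ?w = ?w ! i # ?w ! Suc i # ?w ! Suc (Suc i) # B"
    using assms(3) unfolding B_def by (simp add: Cons_nth_drop_Suc del: nth_window)
  also have "\<dots> = [f ?K, f (?K + 1), f (?K + 2)] @ B"
    using assms(3) by (simp add: algebra_simps)
  finally have w: "?w = A @ [f ?K, f (?K + 1), f (?K + 2)] @ B"
    unfolding A_def by (metis append_take_drop_id)
  have A: "length A = i" using assms(3) by (simp add: A_def)
  have bounds: "Suc i < n" "Suc (Suc i) < n" using assms(3) by simp_all
  have win: "window n p (swap_at n ?K f) = A @ [f (?K + 1), f ?K, f (?K + 2)] @ B"
    unfolding window_swap_at[OF bounds(1)] w using A by (simp add: nth_append list_update_append)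
  have "window n p (swap_at n (p + int (Suc i)) f) = A @ [f ?K, f (?K + 2), f (?K + 1)] @ B"
    unfolding window_swap_at[OF bounds(2)] w using A by (simp add: nth_append list_update_append)
  then have win': "window n p (swap_at n (?K + 1) f) = A @ [f ?K, f (?K + 2), f (?K + 1)] @ B"
    by (simp add: add.commute add.left_commute)
  show ?thesis
    using kmove_cases[OF n3 assms(1,2)]
  proof
    assume g: "g = swap_at n ?K f"
    then have "f (?K + 1) \<le> f (?K + 2) \<and> f (?K + 2) < f ?K \<or> f ?K \<le> f (?K + 2) \<and> f (?K + 2) < f (?K + 1)"
      using assms(2) swap_at_values[OF n3, of ?K f]
      unfolding kmove_def descent_Suc unfolding descent_def by auto
    then show ?thesis unfolding g win w
      using knuth_xzy[of "f (?K + 1)" "f (?K + 2)" "f ?K" A B]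
        knuth_xzy[of "f ?K" "f (?K + 2)" "f (?K + 1)" A B] by blast
  next
    assume g: "g = swap_at n (?K + 1) f"
    then have "f (?K + 1) < f ?K \<and> f ?K \<le> f (?K + 2) \<or> f (?K + 2) < f ?K \<and> f ?K \<le> f (?K + 1)"
      using assms(2) swap_at_Suc_values[OF n3, of ?K f]
      unfolding kmove_def descent_Suc unfolding descent_def by auto
    then show ?thesis unfolding g win' w
      using knuth_yxz[of "f (?K + 1)" "f ?K" "f (?K + 2)" A B]
        knuth_yxz[of "f (?K + 2)" "f ?K" "f (?K + 1)" A B] by blast
  qed
qed

section \<open>Connectivity\<close>

definition reach :: "nat \<Rightarrow> (int \<Rightarrow> nat) \<Rightarrow> (int \<Rightarrow> nat) \<Rightarrow> bool" where
  "reach n = (\<lambda>f g. \<exists>k. kmove n k f g)\<^sup>*\<^sup>*"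

lemma reach_refl [simp]: "reach n f f"
  by (simp add: reach_def)

lemma reach_trans: "reach n f g \<Longrightarrow> reach n g h \<Longrightarrow> reach n f h"
  unfolding reach_def by (rule rtranclp_trans)

lemma reach_if_kmove: "kmove n k f g \<Longrightarrow> reach n f g"
  unfolding reach_def by blast

lemma periodic_reach:
  assumes "periodic n f" "reach n f g" shows "periodic n g"
  using assms(2) unfolding reach_def
  by (induction rule: rtranclp_induct) (auto intro: assms(1) periodic_kmove)

lemma reach_if_knuth:
  assumes "periodic n f" "knuth (window n p f) w"
  obtains g where "reach n f g" "window n p g = w"
proof -
  obtain A B v v' where "knuth_triple v v'" "window n p f = A @ v @ B" "w = A @ v' @ B"
    using assms(2) by (auto simp: knuth_iff_triple)
  then show thesis using kmove_if_knuth[OF assms(1)] that reach_if_kmove by metis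
qed

lemma reach_if_knuth':
  assumes "periodic n f" "knuth w (window n p f)"
  obtains g where "reach n f g" "window n p g = w"
proof -
  obtain A B v v' where *: "knuth_triple v v'" "window n p f = A @ v' @ B" "w = A @ v @ B"
    using assms(2) by (auto simp: knuth_iff_triple)
  have "n = length A + length v' + length B" using arg_cong[OF *(2), of length] by simp
  moreover have "length v' = 3" using *(1) by (auto simp: knuth_triple_def)
  ultimately have n: "3 \<le> n" by simp
  define g where "g = (\<lambda>k. w ! nat ((k - p) mod int n))"
  have "length w = n" using mset_knuth[OF assms(2)] by (metis length_window size_mset)
  have g: "periodic n g"
    unfolding periodic_def g_def by (simp add: diff_add_eq[symmetric])
  have win: "window n p g = w"
    using \<open>length w = n\<close> by (intro nth_equalityI) (auto simp: g_def)
  obtain f' where f': "kmove n (p + int (length A)) g f'" "window n p f' = window n p f"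
    using kmove_if_knuth[OF g *(1), of p A B] win * by metis
  have "f' = f" using window_inject[OF periodic_kmove[OF g f'(1)] assms(1) _ f'(2)] n by simp
  then have "kmove n (p + int (length A)) f g" using f'(1) kmove_sym[of n] n by simp
  then have "reach n f g" by (rule reach_if_kmove)
  then show thesis using win that by blast
qed

lemma reach_if_plactic:
  assumes "periodic n f" "window n p f \<approx> w"
  shows "\<exists>g. reach n f g \<and> window n p g = w"
  using assms(2)
proof (induction rule: equivclp_induct)
  case base
  show ?case by (intro exI[of _ f]) simp
next
  case (step v w)
  then obtain g where g: "reach n f g" "window n p g = v" by blast
  have per: "periodic n g" using periodic_reach[OF assms(1) g(1)] .
  obtain h where "reach n g h" "window n p h = w"
    using step.hyps(2) reach_if_knuth[OF per, of p w] reach_if_knuth'[OF per, of w p] g(2) by metis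
  then show ?case using g(1) reach_trans by blast
qed

text \<open>Let \<open>xs\<close> be an increasing initial part of the word in a window, followed by a letter \<open>z\<close> that does
  not prolong it. Knuth relations insert \<open>z\<close> into \<open>xs\<close> and bring the bumped letter \<open>y > z\<close> to the
  front of the window. Now begin the window one position later, so that \<open>y\<close> becomes its last
  letter: the increasing part has kept its length, and the sum of its letters has dropped.\<close>

theorem reach_sorted:
  assumes "periodic n f"
  shows "\<exists>g p. reach n f g \<and> sorted (window n p g)"
proof -
  have "\<exists>g p. reach n f g \<and> sorted (window n p g)"
    if "periodic n f" "window n p f = xs @ zs" "sorted xs" for f p xs zs
    using that
  proof (induction "(length zs, sum_list xs)" arbitrary: f p xs zs
      rule: wf_induct_rule[OF wf_lex_prod[OF wf_less_than wf_less_than]])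
    case 1
    show ?case
    proof (cases zs)
      case Nil
      then have "reach n f f \<and> sorted (window n p f)" using 1 by simp
      then show ?thesis by blast
    next
      case (Cons z zs')
      show ?thesis
      proof (cases "sorted (xs @ [z])")
        case True
        show ?thesis
          using 1(1)[OF _ 1(2) _ True, of zs' p] Cons 1(3) by simp
      next
        case False
        then obtain y0 where y0: "y0 \<in> set xs" "z < y0"
          using 1(4) by (auto simp: sorted_append not_le)
        obtain y xs' where ins: "insert_row z xs = (xs', Some y)" "sorted xs'" "bump (mset xs) z y (mset xs')"
          using insert_row_bump[OF 1(4) y0] by metis
        have "xs @ [z] \<approx> y # xs'" using insert_row_plactic[OF 1(4), of z] ins(1) by simp
        then have "window n p f \<approx> (y # xs') @ zs'"
          using plactic_append2[of "xs @ [z]" "y # xs'" zs'] 1(3) Cons by simp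
        then obtain g where g: "reach n f g" "window n p g = y # xs' @ zs'"
          using reach_if_plactic[OF 1(2)] by fastforce
        have per: "periodic n g" using periodic_reach[OF 1(2) g(1)] .
        have "window n (p + 1) g = xs' @ (zs' @ [y])" using window_rotate[OF per g(2)] by simp
        moreover have "sum_list xs' + y = sum_list xs + z"
          using arg_cong[OF bump_add_mset[OF ins(3)], of sum_mset] by (simp add: sum_mset_sum_list)
        then have "((length (zs' @ [y]), sum_list xs'), (length zs, sum_list xs)) \<in> less_than <*lex*> less_than"
          using Cons bump_gt[OF ins(3)] by simp
        ultimately obtain h q where "reach n g h" "sorted (window n q h)"
          using 1(1)[OF _ per _ ins(2)] by blast
        then show ?thesis using g(1) reach_trans by blast
      qed
    qed
  qed
  then show ?thesis using assms by (metis append_Nil sorted_simps(1))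
qed

section \<open>The reflection operators on cyclic words\<close>

definition weight :: "nat \<Rightarrow> nat \<Rightarrow> int" where
  "weight i a = (if a = Suc i then 1 else if a = i then - 1 else 0)"

text \<open>Read \<open>i + 1\<close> as a left and \<open>i\<close> as a right parenthesis. A right parenthesis is cyclically unmatched
  if in each segment that ends with it, of any length, the right parentheses are in the majority;
  dually for left ones. Only these letters are changed. In a periodic word they are all of one
  kind: in one period, read linearly, both kinds may be left over, but these match each other
  across the seam.\<close>

definition reflect :: "nat \<Rightarrow> (int \<Rightarrow> nat) \<Rightarrow> int \<Rightarrow> nat" where
  "reflect i f k =
    (if f k = i \<and> (\<forall>q \<le> k. (\<Sum>j = q..k. weight i (f j)) < 0) then Suc i
     else if f k = Suc i \<and> (\<forall>q \<ge> k. 0 < (\<Sum>j = k..q. weight i (f j))) then i else f k)"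

text \<open>With a primitive \<open>h\<close> of the weights, sums over segments become differences, and a parenthesis is
  unmatched if it leads to a new low of \<open>h\<close>, or away from a level that is never reached again.\<close>

definition height :: "nat \<Rightarrow> (int \<Rightarrow> nat) \<Rightarrow> (int \<Rightarrow> int) \<Rightarrow> bool" where
  "height i f h \<longleftrightarrow> (\<forall>k. h (k + 1) = h k + weight i (f k))"

lemma heightD: "height i f h \<Longrightarrow> h (k + 1) = h k + weight i (f k)"
  by (simp add: height_def)

lemma heightD': "height i f h \<Longrightarrow> h k = h (k - 1) + weight i (f (k - 1))"
  using heightD[of i f h "k - 1"] by simp

lemma ex_height: "\<exists>h. height i f h \<and> h 0 = 0"
proof -
  define h where "h k = (\<Sum>j = 0..k - 1. weight i (f j)) - (\<Sum>j = k..- 1. weight i (f j))" for k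
  have "h (k + 1) = h k + weight i (f k)" for k
  proof (cases "0 \<le> k")
    case True
    then have "{0..k} = insert k {0..k - 1}" by auto
    then show ?thesis using True by (simp add: h_def)
  next
    case False
    then have "{k..- 1} = insert k {k + 1..- 1}" by auto
    then show ?thesis using False by (simp add: h_def)
  qed
  moreover have "h 0 = 0" by (simp add: h_def)
  ultimately show ?thesis unfolding height_def by blast
qed

lemma height_sum:
  assumes "height i f h" "a \<le> b + 1"
  shows "(\<Sum>j = a..b. weight i (f j)) = h (b + 1) - h a"
proof -
  have "a - 1 \<le> b" using assms(2) by simp
  then show ?thesis
  proof (induction b rule: int_ge_induct)
    case (step b)
    then have "{a..b + 1} = insert (b + 1) {a..b}" by auto
    then show ?case using step heightD[OF assms(1), of "b + 1"] by simp
  qed simp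
qed

lemma reflect_height:
  assumes "height i f h"
  shows "reflect i f k =
    (if f k = i \<and> (\<forall>q \<le> k. h (k + 1) < h q) then Suc i
     else if f k = Suc i \<and> (\<forall>q > k. h k < h q) then i else f k)"
proof -
  have "(\<forall>q \<le> k. (\<Sum>j = q..k. weight i (f j)) < 0) \<longleftrightarrow> (\<forall>q \<le> k. h (k + 1) < h q)"
    using height_sum[OF assms] by auto
  moreover have "(\<forall>q \<ge> k. 0 < (\<Sum>j = k..q. weight i (f j))) \<longleftrightarrow> (\<forall>q > k. h k < h q)"
  proof -
    have "(\<forall>q \<ge> k. 0 < (\<Sum>j = k..q. weight i (f j))) \<longleftrightarrow> (\<forall>q \<ge> k. h k < h (q + 1))"
      using height_sum[OF assms] by auto
    also have "\<dots> \<longleftrightarrow> (\<forall>q > k. h k < h q)"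
    proof (intro iffI allI impI)
      fix q assume "\<forall>q \<ge> k. h k < h (q + 1)" "k < q"
      then show "h k < h q" by (auto dest: spec[of _ "q - 1"])
    qed auto
    finally show ?thesis .
  qed
  ultimately show ?thesis unfolding reflect_def by simp
qed

lemma height_unique:
  assumes "height i f h" "height i f h'" shows "h' k - h k = h' 0 - h 0"
proof (induction k rule: int_induct[where k = 0])
  case (step1 k)
  then show ?case using heightD[OF assms(1), of k] heightD[OF assms(2), of k] by simp
next
  case (step2 k)
  then show ?case using heightD'[OF assms(1), of k] heightD'[OF assms(2), of k] by simp
qed simp

lemma height_periodic:
  assumes "periodic n f" "height i f h"
  shows "h (k + int n) = h k + (h (int n) - h 0)"
proof -
  have "height i f (\<lambda>k. h (k + int n))"
    unfolding height_def using heightD[OF assms(2)] periodicD[OF assms(1)]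
    by (metis add.assoc add.commute)
  from height_unique[OF assms(2) this, of k] show ?thesis by simp
qed

lemma reflect_shift: "reflect i (\<lambda>k. f (k + m)) = (\<lambda>k. reflect i f (k + m))"
proof
  fix k
  obtain h where h: "height i f h" using ex_height by blast
  then have h': "height i (\<lambda>k. f (k + m)) (\<lambda>k. h (k + m))"
    unfolding height_def by (metis add.assoc add.commute)
  have left: "(\<forall>q \<le> k. P (q + m)) \<longleftrightarrow> (\<forall>q \<le> k + m. P q)" for P
    by (metis add_le_cancel_right diff_add_cancel)
  have right: "(\<forall>q > k. P (q + m)) \<longleftrightarrow> (\<forall>q > k + m. P q)" for P
    by (metis add_less_cancel_right diff_add_cancel)
  have e: "k + 1 + m = k + m + 1" by simp
  show "reflect i (\<lambda>k. f (k + m)) k = reflect i f (k + m)"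
    unfolding reflect_height[OF h'] reflect_height[OF h] e left[of "\<lambda>q. h (k + m + 1) < h q", symmetric]
      right[of "\<lambda>q. h (k + m) < h q", symmetric] by simp
qed

lemma periodic_reflect: "periodic n f \<Longrightarrow> periodic n (reflect i f)"
  using fun_cong[OF reflect_shift[of i f "int n"]] by (simp add: periodic_def)

text \<open>Neighbours \<open>i + 1\<close>, \<open>i\<close> match each other. Among neighbours \<open>i\<close>, \<open>i\<close>, the right one is unmatched if
  the left one is; among \<open>i + 1\<close>, \<open>i + 1\<close>, it is the other way round. Of neighbours \<open>i\<close>, \<open>i + 1\<close>
  at most one is unmatched, since the word is periodic.\<close>

lemma descent_reflect:
  assumes "periodic n f" "0 < n"
  shows "descent (reflect i f) k \<longleftrightarrow> descent f k"
proof -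
  obtain h where h: "height i f h" using ex_height by blast
  note hp = height_periodic[OF assms(1) h]
  note h1 = heightD[OF h, of k] and h2 = heightD[OF h, of "k + 1"]
  have not_both: False if up: "\<forall>q \<le> k. h (k + 1) < h q" and down: "\<forall>q > k + 1. h (k + 1) < h q"
  proof -
    have "h (k + 1) < h (k + 1 - int n)" "h (k + 1) < h (k + 1 + int n)" using up down assms(2) by auto
    then show False using hp[of "k + 1 - int n"] hp[of "k + 1"] by simp
  qed
  consider "f k = Suc i" "f (k + 1) = i" | "f k = i" "f (k + 1) = i" | "f k = Suc i" "f (k + 1) = Suc i"
    | "f k = i" "f (k + 1) = Suc i" | "f k \<noteq> i" "f k \<noteq> Suc i" | "f (k + 1) \<noteq> i" "f (k + 1) \<noteq> Suc i"
    by blast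
  then show ?thesis
  proof cases
    case 1
    then have eq: "h (k + 1 + 1) = h k" using h1 h2 by (simp add: weight_def)
    have "\<not> (\<forall>q > k. h k < h q)" using eq by (auto intro!: exI[of _ "k + 1 + 1"])
    moreover have "\<not> (\<forall>q \<le> k + 1. h (k + 1 + 1) < h q)" using eq by (auto intro!: exI[of _ k])
    ultimately show ?thesis using 1 by (simp add: descent_def reflect_height[OF h])
  next
    case 2
    have "\<forall>q \<le> k + 1. h (k + 1 + 1) < h q" if *: "\<forall>q \<le> k. h (k + 1) < h q"
    proof (intro allI impI)
      fix q assume "q \<le> k + 1"
      then have "q \<le> k \<or> q = k + 1" by auto
      then show "h (k + 1 + 1) < h q" using * h2 2 by (auto simp: weight_def dest: spec[of _ q])
    qed
    then show ?thesis using 2 by (auto simp: descent_def reflect_height[OF h])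
  next
    case 3
    have "\<forall>q > k. h k < h q" if *: "\<forall>q > k + 1. h (k + 1) < h q"
    proof (intro allI impI)
      fix q assume "k < q"
      then have "k + 1 < q \<or> q = k + 1" by auto
      then show "h k < h q" using * h1 3 by (auto simp: weight_def dest: spec[of _ q])
    qed
    then show ?thesis using 3 by (auto simp: descent_def reflect_height[OF h])
  next
    case 4
    then show ?thesis using not_both by (auto simp: descent_def reflect_height[OF h])
  next
    case 5
    then show ?thesis by (auto simp: descent_def reflect_def)
  next
    case 6
    then show ?thesis by (auto simp: descent_def reflect_def)
  qed
qed

lemma dvd_shift:
  assumes "2 \<le> n" "int n dvd k - j"
  shows "\<not> int n dvd k - j - 1" "\<not> int n dvd k - j + 1"
proof -
  have "\<not> int n dvd 1" using assms(1) by (auto dest!: zdvd_imp_le)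
  then show "\<not> int n dvd k - j - 1" "\<not> int n dvd k - j + 1"
    using assms(2) dvd_diff_right_iff[of "int n" "k - j" 1] dvd_add_right_iff[of "int n" "k - j" 1] by auto
qed

lemma height_swap_at:
  assumes n: "2 \<le> n" and h: "height i f h"
  shows "height i (swap_at n j f)
    (\<lambda>k. if int n dvd k - j - 1 then h (k - 1) + weight i (f k) else h k)"
  unfolding height_def
proof
  fix k
  have a: "h (k + 1) = h k + weight i (f k)" "h k = h (k - 1) + weight i (f (k - 1))"
    using heightD[OF h, of k] heightD'[OF h, of k] by auto
  have e: "k + 1 - j - 1 = k - j" "k - j - 1 + 1 = k - j" by simp_all
  show "(if int n dvd k + 1 - j - 1 then h (k + 1 - 1) + weight i (f (k + 1)) else h (k + 1)) =
    (if int n dvd k - j - 1 then h (k - 1) + weight i (f k) else h k) + weight i (swap_at n j f k)"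
  proof (cases "int n dvd k - j")
    case True
    then show ?thesis unfolding e swap_at_def using dvd_shift(1)[OF n True] by simp
  next
    case False
    then show ?thesis unfolding e swap_at_def using a by simp
  qed
qed

text \<open>A letter of weight \<open>0\<close> that passes its neighbour changes the height at one position per period
  only, and the old and the new height at this position are the heights at its two neighbours. So
  no minimum of the height is affected.\<close>

lemma reflect_swap_at_inert:
  assumes n: "2 \<le> n" and per: "periodic n f" and inert: "weight i (f j) = 0"
  shows "reflect i (swap_at n j f) = swap_at n j (reflect i f)"
proof
  fix p
  let ?g = "swap_at n j f"
  obtain h where h: "height i f h" using ex_height by blast
  define h' where "h' k = (if int n dvd k - j - 1 then h (k - 1) + weight i (f k) else h k)" for k
  have h': "height i ?g h'" unfolding h'_def by (rule height_swap_at[OF n h])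
  have inert': "weight i (f k) = 0" if "int n dvd k - j" for k
    using periodic_dvd[OF per that] inert by simp
  have changed: "h q = h (q - 1)" "h' q = h (q + 1)" if "int n dvd q - j - 1" for q
  proof -
    have "weight i (f (q - 1)) = 0" using inert'[of "q - 1"] that by (simp add: algebra_simps)
    then show "h q = h (q - 1)" using heightD'[OF h, of q] by simp
    then show "h' q = h (q + 1)" using heightD[OF h, of q] that by (simp add: h'_def)
  qed
  have same: "h' q = h q" if "\<not> int n dvd q - j - 1" for q using that by (simp add: h'_def)
  have around: "h' (q - 1) = h (q - 1)" "h' (q + 1) = h (q + 1)" if "int n dvd q - j - 1" for q
  proof -
    have e: "q - 1 - j - 1 = q - j - 1 - 1" "q + 1 - j - 1 = q - j - 1 + 1" by simp_all
    show "h' (q - 1) = h (q - 1)" "h' (q + 1) = h (q + 1)"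
      using dvd_shift[OF n, of q "j + 1"] that by (auto intro!: same simp: e diff_diff_eq[symmetric])
  qed
  have right: "(\<forall>q > p. c < h' q) \<longleftrightarrow> (\<forall>q > p. c < h q)" if p: "\<not> int n dvd p - j" for p c
  proof (intro iffI allI impI)
    fix q assume *: "\<forall>q > p. c < h' q" "p < q"
    show "c < h q"
    proof (cases "int n dvd q - j - 1")
      case True
      have e: "q - 1 - j = q - j - 1" by simp
      have "q - 1 \<noteq> p" using p True unfolding e[symmetric] by blast
      then have "c < h' (q - 1)" using * by simp
      then show ?thesis using changed(1)[OF True] around(1)[OF True] by simp
    next
      case False
      then show ?thesis using spec[OF *(1), of q] *(2) same[OF False] by simp
    qed
  next
    fix q assume *: "\<forall>q > p. c < h q" "p < q"
    show "c < h' q"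
    proof (cases "int n dvd q - j - 1")
      case True
      then show ?thesis using spec[OF *(1), of "q + 1"] *(2) changed(2)[OF True] by simp
    next
      case False
      then show ?thesis using spec[OF *(1), of q] *(2) same[OF False] by simp
    qed
  qed
  have left: "(\<forall>q \<le> p. c < h' q) \<longleftrightarrow> (\<forall>q \<le> p. c < h q)" if p: "\<not> int n dvd p - j - 1" for p c
  proof (intro iffI allI impI)
    fix q assume *: "\<forall>q \<le> p. c < h' q" "q \<le> p"
    show "c < h q"
    proof (cases "int n dvd q - j - 1")
      case True
      then show ?thesis using spec[OF *(1), of "q - 1"] *(2) changed(1)[OF True] around(1)[OF True] by simp
    next
      case False
      then show ?thesis using spec[OF *(1), of q] *(2) same[OF False] by simp
    qed
  next
    fix q assume *: "\<forall>q \<le> p. c < h q" "q \<le> p"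
    show "c < h' q"
    proof (cases "int n dvd q - j - 1")
      case True
      then have "q \<noteq> p" using p by blast
      then show ?thesis using spec[OF *(1), of "q + 1"] *(2) changed(2)[OF True] by simp
    next
      case False
      then show ?thesis using spec[OF *(1), of q] *(2) same[OF False] by simp
    qed
  qed
  note r = reflect_height[OF h'] reflect_height[OF h]
  have at_j: "reflect i ?g p = reflect i f (p + 1) \<and> reflect i ?g (p + 1) = reflect i f p"
    if p: "int n dvd p - j" for p
  proof -
    have p1: "int n dvd p + 1 - j - 1" using p by simp
    have g: "?g p = f (p + 1)" "?g (p + 1) = f p"
      using p dvd_shift[OF n p] by (auto simp: swap_at_def algebra_simps)
    have hs: "h (p + 1) = h p" "h' (p + 1) = h (p + 2)" "h' p = h p" "h' (p + 2) = h (p + 2)"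
      using changed[OF p1] around[OF p1] by (simp_all add: add.assoc)
    have p2: "\<not> int n dvd p + 1 - j" using dvd_shift(2)[OF n p] by (simp add: algebra_simps)
    have np: "\<not> int n dvd p - j - 1" using dvd_shift(1)[OF n p] .
    have "(\<forall>q \<le> p + 1. h (p + 2) < h q) \<longleftrightarrow> (\<forall>q \<le> p. h (p + 2) < h q)"
    proof (intro iffI allI impI)
      fix q assume *: "\<forall>q \<le> p. h (p + 2) < h q" "q \<le> p + 1"
      show "h (p + 2) < h q"
        using spec[OF *(1), of q] spec[OF *(1), of p] *(2) hs(1) by (cases "q = p + 1") simp_all
    qed simp
    then have up: "(\<forall>q \<le> p. h (p + 2) < h' q) \<longleftrightarrow> (\<forall>q \<le> p + 1. h (p + 2) < h q)"
      unfolding left[OF np] ..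
    have "(\<forall>q > p. h p < h' q) \<longleftrightarrow> h p < h' (p + 1) \<and> (\<forall>q > p + 1. h p < h' q)"
    proof (intro iffI allI impI)
      fix q assume *: "h p < h' (p + 1) \<and> (\<forall>q > p + 1. h p < h' q)" "p < q"
      show "h p < h' q" using * by (cases "q = p + 1") simp_all
    qed simp
    also have "\<dots> \<longleftrightarrow> h p < h (p + 2) \<and> (\<forall>q > p + 1. h p < h q)"
      unfolding right[OF p2] hs ..
    also have "\<dots> \<longleftrightarrow> (\<forall>q > p + 1. h p < h q)"
      by (auto dest: spec[of _ "p + 2"])
    finally have down: "(\<forall>q > p. h p < h' q) \<longleftrightarrow> (\<forall>q > p + 1. h p < h q)" .
    have e2: "p + 1 + 1 = p + 2" by simp
    have "reflect i ?g p = reflect i f (p + 1)"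
      unfolding r g e2 hs up down ..
    moreover have "reflect i ?g (p + 1) = reflect i f p"
      using inert'[OF p] g by (auto simp: reflect_def weight_def split: if_splits)
    ultimately show ?thesis ..
  qed
  show "reflect i ?g p = swap_at n j (reflect i f) p"
  proof -
    consider "int n dvd p - j" | "int n dvd p - j - 1" | "\<not> int n dvd p - j" "\<not> int n dvd p - j - 1" by blast
    then show ?thesis
    proof cases
      case 1
      then show ?thesis using at_j[OF 1] by (simp add: swap_at_def)
    next
      case 2
      have e: "p - 1 - j = p - j - 1" by simp
      have "\<not> int n dvd p - j" using dvd_shift(2)[OF n, of p "j + 1"] 2 by (simp add: diff_diff_eq[symmetric])
      moreover have "reflect i ?g (p - 1 + 1) = reflect i f (p - 1)" using at_j[of "p - 1"] 2 e by simp
      ultimately show ?thesis using 2 by (simp add: swap_at_def)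
    next
      case 3
      have e: "p + 1 - j - 1 = p - j" by simp
      have "?g p = f p" using 3 by (simp add: swap_at_def)
      moreover have "h' p = h p" using same[OF 3(2)] .
      moreover have "h' (p + 1) = h (p + 1)" using same[of "p + 1"] 3(1) unfolding e by simp
      ultimately have "reflect i ?g p = reflect i f p"
        unfolding r using left[OF 3(2)] right[OF 3(1)] by simp
      then show ?thesis using 3 by (simp add: swap_at_def)
    qed
  qed
qed

lemma reflect_swap_at_inert':
  assumes n: "2 \<le> n" and per: "periodic n f" and inert: "weight i (f (j + 1)) = 0"
  shows "reflect i (swap_at n j f) = swap_at n j (reflect i f)"
proof -
  have "swap_at n j f j = f (j + 1)" by (simp add: swap_at_def)
  then have "reflect i (swap_at n j (swap_at n j f)) = swap_at n j (reflect i (swap_at n j f))"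
    using reflect_swap_at_inert[OF n periodic_swap_at[OF per], of i j j] inert by simp
  then show ?thesis using swap_at_swap_at[OF n] by metis
qed


lemma near_dvd:
  assumes "3 \<le> n"
  shows "\<not> int n dvd 1" "\<not> int n dvd 2" "\<not> int n dvd - 1" "\<not> int n dvd - 2"
proof -
  show "\<not> int n dvd 1" "\<not> int n dvd 2" using assms by (auto dest!: zdvd_imp_le)
  then show "\<not> int n dvd - 1" "\<not> int n dvd - 2" by simp_all
qed

lemma not_dvd_minus_2:
  assumes "3 \<le> n" "int n dvd p - k" shows "\<not> int n dvd p - 2 - k"
  using dvd_add_right_iff[OF assms(2), of "- 2"] near_dvd[OF assms(1)] by (simp add: algebra_simps)

lemma swap_at_eqI:
  assumes n: "3 \<le> n" and f: "periodic n f" and g: "periodic n g"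
    and k: "g k = f (k + 1)" "g (k + 1) = f k" "g (k + 2) = f (k + 2)"
    and other: "\<And>p. \<not> int n dvd p - k \<Longrightarrow> \<not> int n dvd p - (k + 1) \<Longrightarrow> \<not> int n dvd p - (k + 2) \<Longrightarrow> g p = f p"
  shows "g = swap_at n k f"
proof
  fix p
  have s: "periodic n (swap_at n k f)" using periodic_swap_at[OF f] .
  note v = swap_at_values[OF n, of k f]
  consider "int n dvd p - k" | "int n dvd p - (k + 1)" | "int n dvd p - (k + 2)"
    | "\<not> int n dvd p - k" "\<not> int n dvd p - (k + 1)" "\<not> int n dvd p - (k + 2)" by blast
  then show "g p = swap_at n k f p"
  proof cases
    case 4
    have "p - (k + 1) = p - k - 1" by simp
    then show ?thesis using other[OF 4] 4 by (simp only: swap_at_def if_False)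
  qed (use k v periodic_dvd[OF g] periodic_dvd[OF s] in simp_all)
qed

lemma swap_at_Suc_eqI:
  assumes n: "3 \<le> n" and f: "periodic n f" and g: "periodic n g"
    and k: "g k = f k" "g (k + 1) = f (k + 2)" "g (k + 2) = f (k + 1)"
    and other: "\<And>p. \<not> int n dvd p - k \<Longrightarrow> \<not> int n dvd p - (k + 1) \<Longrightarrow> \<not> int n dvd p - (k + 2) \<Longrightarrow> g p = f p"
  shows "g = swap_at n (k + 1) f"
proof
  fix p
  have s: "periodic n (swap_at n (k + 1) f)" using periodic_swap_at[OF f] .
  note v = swap_at_Suc_values[OF n, of k f]
  consider "int n dvd p - k" | "int n dvd p - (k + 1)" | "int n dvd p - (k + 2)"
    | "\<not> int n dvd p - k" "\<not> int n dvd p - (k + 1)" "\<not> int n dvd p - (k + 2)" by blast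
  then show "g p = swap_at n (k + 1) f p"
  proof cases
    case 4
    have "p - (k + 2) = p - (k + 1) - 1" by simp
    then show ?thesis using other[OF 4] 4 by (simp only: swap_at_def if_False)
  qed (use k v periodic_dvd[OF g] periodic_dvd[OF s] in simp_all)
qed

text \<open>The exchange turns the parentheses \<open>( ) (\<close> into \<open>( ( )\<close>. In both words two of them match each
  other, and the third one has the same surroundings, but another place. If it is unmatched, the
  reflected words differ by an exchange at \<open>k\<close>, and otherwise by an exchange at \<open>k + 1\<close>.\<close>

lemma reflect_down_up_down:
  assumes n: "3 \<le> n" and per: "periodic n f" and f: "f k = Suc i" "f (k + 1) = i" "f (k + 2) = Suc i"
  shows "\<exists>j. reflect i (swap_at n (k + 1) f) = swap_at n j (reflect i f)"
proof -
  let ?g = "swap_at n (k + 1) f"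
  have n2: "2 \<le> n" using n by simp
  note g = swap_at_Suc_values[OF n, of k f]
  obtain h where h: "height i f h" using ex_height by blast
  define h' where "h' p = (if int n dvd p - (k + 1) - 1 then h (p - 1) + weight i (f p) else h p)" for p
  have h': "height i ?g h'" unfolding h'_def by (rule height_swap_at[OF n2 h])
  have e: "p - (k + 1) - 1 = p - (k + 2)" for p by simp
  have same: "h' p = h p" if "\<not> int n dvd p - (k + 2)" for p
    using that by (simp only: h'_def e if_False)
  have changed: "h q = h (q - 2)" "h q < h' q" "h' (q - 2) = h (q - 2)" if q: "int n dvd q - (k + 2)" for q
  proof -
    have "f q = Suc i" "f (q - 1) = i" "f (q - 2) = Suc i"
      using f periodic_dvd[OF per, of q "k + 2"] periodic_dvd[OF per, of "q - 1" "k + 1"]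
        periodic_dvd[OF per, of "q - 2" k] q by (simp_all add: algebra_simps)
    moreover have "h' q = h (q - 1) + weight i (f q)" using q by (simp only: h'_def e if_True)
    ultimately show "h q = h (q - 2)" "h q < h' q"
      using heightD'[OF h, of q] heightD'[OF h, of "q - 1"] by (simp_all add: weight_def)
    show "h' (q - 2) = h (q - 2)" using not_dvd_minus_2[OF n q] by (simp add: same)
  qed
  have le: "h q \<le> h' q" for q using changed(2)[of q] same[of q] by (cases "int n dvd q - (k + 2)") auto
  have left: "(\<forall>q \<le> p. c < h' q) \<longleftrightarrow> (\<forall>q \<le> p. c < h q)" for p c
  proof (intro iffI allI impI)
    fix q assume *: "\<forall>q \<le> p. c < h' q" "q \<le> p"
    show "c < h q"
    proof (cases "int n dvd q - (k + 2)")
      case True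
      then show ?thesis using spec[OF *(1), of "q - 2"] *(2) changed[OF True] by simp
    next
      case False
      then show ?thesis using spec[OF *(1), of q] *(2) same[OF False] by simp
    qed
  next
    fix q assume "\<forall>q \<le> p. c < h q" "q \<le> p"
    then show "c < h' q" using le[of q] by (auto dest: spec[of _ q])
  qed
  have right: "(\<forall>q > p. c < h' q) \<longleftrightarrow> (\<forall>q > p. c < h q)"
    if p: "\<not> int n dvd p - k" "\<not> int n dvd p - (k + 1)" for p c
  proof (intro iffI allI impI)
    fix q assume *: "\<forall>q > p. c < h' q" "p < q"
    show "c < h q"
    proof (cases "int n dvd q - (k + 2)")
      case True
      have e': "q - 1 - (k + 1) = q - (k + 2)" "q - 2 - k = q - (k + 2)" by simp_all
      then have "q - 1 \<noteq> p" "q - 2 \<noteq> p" using p True by metis+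
      then show ?thesis using spec[OF *(1), of "q - 2"] *(2) changed[OF True] by simp
    next
      case False
      then show ?thesis using spec[OF *(1), of q] *(2) same[OF False] by simp
    qed
  next
    fix q assume "\<forall>q > p. c < h q" "p < q"
    then show "c < h' q" using le[of q] by (auto dest: spec[of _ q])
  qed
  note r = reflect_height[OF h'] reflect_height[OF h]
  have hk: "h (k + 1) = h k + 1" "h (k + 2) = h k" "h (k + 3) = h k + 1"
    using heightD[OF h, of k] heightD[OF h, of "k + 1"] heightD[OF h, of "k + 2"] f
    by (simp_all add: weight_def add.assoc)
  have k2: "int n dvd (k + 2) - (k + 2)" by simp
  have hk': "h' k = h k" "h' (k + 1) = h k + 1" "h' (k + 2) = h k + 2" "h' (k + 3) = h k + 1"
  proof -
    show "h' k = h k" "h' (k + 1) = h k + 1" "h' (k + 3) = h k + 1"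
      using near_dvd[OF n] hk by (simp_all add: h'_def)
    have "k + 2 - 1 = k + 1" by simp
    then have "h' (k + 2) = h (k + 1) + weight i (f (k + 2))" unfolding h'_def by (simp add: add.commute)
    then show "h' (k + 2) = h k + 2" using hk f by (simp add: weight_def)
  qed
  let ?D = "\<forall>q > k + 2. h k < h q"
  have D': "(\<forall>q > k. h k < h' q) \<longleftrightarrow> ?D"
  proof -
    have "(\<forall>q > k. h k < h' q) \<longleftrightarrow> (\<forall>q > k + 2. h k < h' q)"
    proof (intro iffI allI impI)
      fix q assume *: "\<forall>q > k + 2. h k < h' q" "k < q"
      then consider "q = k + 1" | "q = k + 2" | "q > k + 2" by linarith
      then show "h k < h' q" using * hk' by cases simp_all
    qed simp
    also have "\<dots> \<longleftrightarrow> ?D"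
      using near_dvd[OF n] by (intro right) (simp_all add: algebra_simps)
    finally show ?thesis .
  qed
  have rf: "reflect i f k = Suc i" "reflect i f (k + 1) = i" "reflect i f (k + 2) = (if ?D then i else Suc i)"
  proof -
    have "\<not> (\<forall>q > k. h k < h q)" using hk by (auto intro!: exI[of _ "k + 2"])
    then show "reflect i f k = Suc i" using f by (simp add: r)
    have "\<not> (\<forall>q \<le> k + 1. h (k + 1 + 1) < h q)" using hk by (auto intro!: exI[of _ k] simp: add.assoc)
    then show "reflect i f (k + 1) = i" using f by (simp add: r)
    show "reflect i f (k + 2) = (if ?D then i else Suc i)" using f hk by (simp add: r)
  qed
  have rg: "reflect i ?g k = (if ?D then i else Suc i)" "reflect i ?g (k + 1) = Suc i" "reflect i ?g (k + 2) = i"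
  proof -
    show "reflect i ?g k = (if ?D then i else Suc i)" using f g hk' D' by (simp add: r)
    have "\<not> (\<forall>q > k + 1. h' (k + 1) < h' q)" using hk' by (auto intro!: exI[of _ "k + 3"])
    then show "reflect i ?g (k + 1) = Suc i" using f g by (simp add: r)
    have "\<not> (\<forall>q \<le> k + 2. h' (k + 2 + 1) < h' q)" using hk' by (auto intro!: exI[of _ "k + 1"] simp: add.assoc)
    then show "reflect i ?g (k + 2) = i" using f g by (simp add: r)
  qed
  have other: "reflect i ?g p = reflect i f p"
    if p: "\<not> int n dvd p - k" "\<not> int n dvd p - (k + 1)" "\<not> int n dvd p - (k + 2)" for p
  proof -
    have e': "p - (k + 1) - 1 = p - (k + 2)" "p + 1 - (k + 2) = p - (k + 1)" by simp_all
    have "?g p = f p" using p unfolding swap_at_def e' by simp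
    moreover have "h' p = h p" "h' (p + 1) = h (p + 1)" using p same[of p] same[of "p + 1"] e' by simp_all
    ultimately show ?thesis using left right[OF p(1,2)] by (simp add: r)
  qed
  note per' = periodic_reflect[OF per] periodic_reflect[OF periodic_swap_at[OF per]]
  show ?thesis
  proof (cases ?D)
    case True
    then have "reflect i ?g = swap_at n k (reflect i f)"
      using rf rg by (intro swap_at_eqI[OF n per' _ _ _ other]) simp_all
    then show ?thesis by blast
  next
    case False
    then have "reflect i ?g = swap_at n (k + 1) (reflect i f)"
      using rf rg by (intro swap_at_Suc_eqI[OF n per' _ _ _ other]) simp_all
    then show ?thesis by blast
  qed
qed

text \<open>Reversing the word and exchanging the two kinds of parentheses preserves matching. It turns the
  pattern \<open>) ( )\<close> into \<open>( ) (\<close>.\<close>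

definition mirror :: "nat \<Rightarrow> (int \<Rightarrow> nat) \<Rightarrow> int \<Rightarrow> nat" where
  "mirror i f k = transpose i (Suc i) (f (- k))"

lemma mirror_mirror: "mirror i (mirror i f) = f"
  by (simp add: mirror_def fun_eq_iff)

lemma mirror_swap_at:
  assumes n: "2 \<le> n" shows "mirror i (swap_at n j f) = swap_at n (- j - 1) (mirror i f)"
proof
  fix k
  have dvds: "int n dvd - k - j \<longleftrightarrow> int n dvd k - (- j - 1) - 1" "int n dvd - k - j - 1 \<longleftrightarrow> int n dvd k - (- j - 1)"
    using dvd_minus_iff[of "int n" "- k - j"] dvd_minus_iff[of "int n" "- k - j - 1"] by (simp_all add: algebra_simps)
  have "\<not> (int n dvd - k - j \<and> int n dvd - k - j - 1)" using dvd_shift(1)[OF n, of "- k" j] by blast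
  moreover have e: "- (k + 1) = - k - 1" "- (k - 1) = - k + 1" by simp_all
  ultimately show "mirror i (swap_at n j f) k = swap_at n (- j - 1) (mirror i f) k"
    unfolding mirror_def swap_at_def dvds e by simp
qed

lemma reflect_mirror: "reflect i (mirror i f) = mirror i (reflect i f)"
proof
  fix k
  obtain h where h: "height i f h" using ex_height by blast
  have h': "height i (mirror i f) (\<lambda>k. h (1 - k))"
    unfolding height_def
  proof
    fix k
    have "h (1 - k) = h (- k) + weight i (f (- k))" using heightD[OF h, of "- k"] by (simp add: add.commute)
    moreover have "weight i (mirror i f k) = - weight i (f (- k))"
      by (auto simp: mirror_def weight_def transpose_def)
    ultimately show "h (1 - (k + 1)) = h (1 - k) + weight i (mirror i f k)" by simp
  qed
  have left: "(\<forall>q \<le> k. P (1 - q)) \<longleftrightarrow> (\<forall>q > - k. P q)" for P :: "int \<Rightarrow> bool"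
  proof (intro iffI allI impI)
    fix q assume *: "\<forall>q \<le> k. P (1 - q)" "- k < q"
    show "P q" using spec[OF *(1), of "1 - q"] *(2) by simp
  qed simp
  have right: "(\<forall>q > k. P (1 - q)) \<longleftrightarrow> (\<forall>q \<le> - k. P q)" for P :: "int \<Rightarrow> bool"
  proof (intro iffI allI impI)
    fix q assume *: "\<forall>q > k. P (1 - q)" "q \<le> - k"
    show "P q" using spec[OF *(1), of "1 - q"] *(2) by simp
  qed simp
  have e: "1 - (k + 1) = - k" "1 - k = - k + 1" by simp_all
  have "mirror i f k = i \<longleftrightarrow> f (- k) = Suc i" "mirror i f k = Suc i \<longleftrightarrow> f (- k) = i"
    by (auto simp: mirror_def transpose_def)
  then show "reflect i (mirror i f) k = mirror i (reflect i f) k"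
    unfolding mirror_def[of i "reflect i f"] reflect_height[OF h'] reflect_height[OF h] e
    unfolding left[of "\<lambda>q. h (- k) < h q"] right[of "\<lambda>q. h (- k + 1) < h q"]
    by (auto simp: mirror_def)
qed

lemma reflect_up_down_up:
  assumes n: "3 \<le> n" and per: "periodic n f" and f: "f k = i" "f (k + 1) = Suc i" "f (k + 2) = i"
  shows "\<exists>j. reflect i (swap_at n k f) = swap_at n j (reflect i f)"
proof -
  let ?m = "mirror i f" and ?K = "- k - 2"
  have n2: "2 \<le> n" using n by simp
  have "periodic n ?m"
    unfolding periodic_def
  proof
    fix q
    show "?m (q + int n) = ?m q" using periodicD[OF per, of "- q - int n"] by (simp add: mirror_def)
  qed
  moreover have "?m ?K = Suc i" "?m (?K + 1) = i" "?m (?K + 2) = Suc i"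
    using f by (simp_all add: mirror_def add.commute)
  ultimately obtain j where "reflect i (swap_at n (?K + 1) ?m) = swap_at n j (reflect i ?m)"
    using reflect_down_up_down[OF n] by blast
  moreover have "?K + 1 = - k - 1" by simp
  ultimately have "mirror i (reflect i (swap_at n k f)) = swap_at n j (mirror i (reflect i f))"
    by (simp add: mirror_swap_at[OF n2, of i k f, symmetric] reflect_mirror)
  then have "reflect i (swap_at n k f) = mirror i (swap_at n j (mirror i (reflect i f)))"
    by (metis mirror_mirror)
  then show ?thesis using mirror_swap_at[OF n2, of i j] by (auto simp: mirror_mirror)
qed

lemma swap_at_involutive_ex:
  assumes "2 \<le> n" "\<exists>j. f = swap_at n j g" shows "\<exists>j. g = swap_at n j f"
  using assms swap_at_swap_at by metis

text \<open>If \<open>i\<close> and \<open>i + 1\<close> are exchanged, the third letter of the Knuth move lies between them in value,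
  and therefore is one of them; this leaves the patterns of the preceding lemmas. For \<open>n = 2\<close> an
  exchange is a rotation.\<close>

lemma reflect_swap_at:
  assumes n: "2 \<le> n" and per: "periodic n f" and move: "kmove n k f g"
  shows "\<exists>j. reflect i g = swap_at n j (reflect i f)"
proof -
  obtain j0 where j0: "g = swap_at n j0 f" using move by (auto simp: kmove_def)
  show ?thesis
  proof (cases "n = 2")
    case True
    have "periodic 2 f" "periodic 2 (reflect i f)" using per periodic_reflect[OF per] True by simp_all
    then have "reflect i g = swap_at n 0 (reflect i f)"
      using j0 True swap_at_2 reflect_shift[of i f 1] by simp
    then show ?thesis by blast
  next
    case False
    then have n3: "3 \<le> n" using n by simp
    have per': "periodic n g" using periodic_kmove[OF per move] .
    show ?thesis
      using kmove_cases[OF n3 per move]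
    proof
      assume g: "g = swap_at n k f"
      note v = swap_at_values[OF n3, of k f]
      show ?thesis
      proof (cases "weight i (f k) = 0 \<or> weight i (f (k + 1)) = 0")
        case True
        then show ?thesis unfolding g
          using reflect_swap_at_inert[OF n per, of i k] reflect_swap_at_inert'[OF n per, of i k] by blast
      next
        case False
        then have "f k \<in> {i, Suc i}" "f (k + 1) \<in> {i, Suc i}" by (auto simp: weight_def split: if_splits)
        moreover have "f (k + 1) \<le> f (k + 2) \<and> f (k + 2) < f k \<or> f k \<le> f (k + 2) \<and> f (k + 2) < f (k + 1)"
          using move v unfolding g kmove_def descent_Suc unfolding descent_def by auto
        ultimately consider "f k = i" "f (k + 1) = Suc i" "f (k + 2) = i"
          | "g k = i" "g (k + 1) = Suc i" "g (k + 2) = i" using v g by force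
        then show ?thesis
        proof cases
          case 1
          then show ?thesis unfolding g by (rule reflect_up_down_up[OF n3 per])
        next
          case 2
          have "swap_at n k g = f" unfolding g using swap_at_swap_at[OF n] .
          then show ?thesis
            using reflect_up_down_up[OF n3 per' 2] swap_at_involutive_ex[OF n] by metis
        qed
      qed
    next
      assume g: "g = swap_at n (k + 1) f"
      note v = swap_at_Suc_values[OF n3, of k f]
      show ?thesis
      proof (cases "weight i (f (k + 1)) = 0 \<or> weight i (f (k + 2)) = 0")
        case True
        then show ?thesis unfolding g
          using reflect_swap_at_inert[OF n per, of i "k + 1"] reflect_swap_at_inert'[OF n per, of i "k + 1"]
          by (auto simp: add.assoc)
      next
        case False
        then have "f (k + 1) \<in> {i, Suc i}" "f (k + 2) \<in> {i, Suc i}" by (auto simp: weight_def split: if_splits)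
        moreover have "f (k + 1) < f k \<and> f k \<le> f (k + 2) \<or> f (k + 2) < f k \<and> f k \<le> f (k + 1)"
          using move v unfolding g kmove_def descent_Suc unfolding descent_def by auto
        ultimately consider "f k = Suc i" "f (k + 1) = i" "f (k + 2) = Suc i"
          | "g k = Suc i" "g (k + 1) = i" "g (k + 2) = Suc i" using v g by force
        then show ?thesis
        proof cases
          case 1
          then show ?thesis unfolding g by (rule reflect_down_up_down[OF n3 per])
        next
          case 2
          have "swap_at n (k + 1) g = f" unfolding g using swap_at_swap_at[OF n] .
          then show ?thesis
            using reflect_down_up_down[OF n3 per' 2] swap_at_involutive_ex[OF n] by metis
        qed
      qed
    qed
  qed
qed

theorem kmove_reflect:
  assumes "2 \<le> n" "periodic n f" "kmove n k f g"
  shows "kmove n k (reflect i f) (reflect i g)"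
proof -
  have "periodic n g" "0 < n" using periodic_kmove assms by auto
  then show ?thesis
    using reflect_swap_at[OF assms] assms(2,3) descent_reflect unfolding kmove_def by simp
qed

section \<open>The reflection of a linear word\<close>

definition cyc :: "nat list \<Rightarrow> int \<Rightarrow> nat" where
  "cyc v k = v ! nat (k mod int (length v))"

definition level :: "nat \<Rightarrow> nat list \<Rightarrow> nat \<Rightarrow> int" where
  "level i v m = (\<Sum>p<m. weight i (v ! p))"

text \<open>After \<open>m\<close> letters have been read, the unmatched right parentheses are those that lead to a new low
  of the level, and the open left ones are those from which the level has not returned.\<close>

definition free_right :: "nat \<Rightarrow> nat list \<Rightarrow> nat \<Rightarrow> nat list" where
  "free_right i v m = filter (\<lambda>p. v ! p = i \<and> (\<forall>q \<le> p. level i v (Suc p) < level i v q)) [0..<m]"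

definition free_left :: "nat \<Rightarrow> nat list \<Rightarrow> nat \<Rightarrow> nat list" where
  "free_left i v m =
     filter (\<lambda>p. v ! p = Suc i \<and> (\<forall>q. p < q \<and> q \<le> m \<longrightarrow> level i v p < level i v q)) [0..<m]"

lemma level_0 [simp]: "level i v 0 = 0"
  by (simp add: level_def)

lemma level_Suc: "level i v (Suc m) = level i v m + weight i (v ! m)"
  by (simp add: level_def)

lemma free_right_Suc: "free_right i v (Suc m) = free_right i v m @
    (if v ! m = i \<and> (\<forall>q \<le> m. level i v (Suc m) < level i v q) then [m] else [])"
  by (simp add: free_right_def)

lemma free_left_Suc: "free_left i v (Suc m) =
    filter (\<lambda>p. level i v p < level i v (Suc m)) (free_left i v m) @ (if v ! m = Suc i then [m] else [])"
proof -
  let ?H = "level i v"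
  have "(\<forall>q. p < q \<and> q \<le> Suc m \<longrightarrow> ?H p < ?H q) \<longleftrightarrow>
      (\<forall>q. p < q \<and> q \<le> m \<longrightarrow> ?H p < ?H q) \<and> ?H p < ?H (Suc m)" if "p < m" for p
    using that by (auto simp: le_Suc_eq)
  then have "filter (\<lambda>p. v ! p = Suc i \<and> (\<forall>q. p < q \<and> q \<le> Suc m \<longrightarrow> ?H p < ?H q)) [0..<m] =
      filter (\<lambda>p. ?H p < ?H (Suc m)) (free_left i v m)"
    unfolding free_left_def filter_filter by (intro filter_cong) auto
  moreover have "v ! m = Suc i \<and> (\<forall>q. m < q \<and> q \<le> Suc m \<longrightarrow> ?H m < ?H q) \<longleftrightarrow> v ! m = Suc i"
    by (auto simp: le_Suc_eq level_Suc weight_def)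
  ultimately show ?thesis by (simp add: free_left_def)
qed

lemma sorted_free: "sorted_wrt (<) (free_right i v m)" "sorted_wrt (<) (free_left i v m)"
  by (simp_all add: free_right_def free_left_def sorted_wrt_filter)

text \<open>If the level was lower before, then the last step up to the present level is an open left
  parenthesis, and it is the last one.\<close>

lemma last_free_left:
  assumes "\<exists>q \<le> m. level i v q < level i v m"
  shows "free_left i v m \<noteq> []" "level i v (last (free_left i v m)) = level i v m - 1"
proof -
  let ?H = "level i v"
  define S where "S = {q. q \<le> m \<and> ?H q < ?H m}"
  define q where "q = Max S"
  have S: "finite S" "S \<noteq> {}" using assms by (auto simp: S_def)
  have q: "q \<le> m" "?H q < ?H m" using Max_in[OF S] by (auto simp: S_def q_def)
  have after: "?H m \<le> ?H r" if "q < r" "r \<le> m" for r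
    using Max_ge[OF S(1), of r] that by (auto simp: S_def q_def not_less[symmetric])
  have "q < m" using q by (cases "q = m") auto
  then have "?H m \<le> ?H (Suc q)" using after by simp
  then have "v ! q = Suc i" "?H q = ?H m - 1"
    using q(2) by (auto simp: level_Suc weight_def split: if_splits)
  moreover have "\<forall>r. q < r \<and> r \<le> m \<longrightarrow> ?H q < ?H r" using after q(2) by force
  ultimately have q_mem: "q \<in> set (free_left i v m)" using \<open>q < m\<close> by (simp add: free_left_def)
  then show ne: "free_left i v m \<noteq> []" by auto
  define l where "l = last (free_left i v m)"
  have l: "l \<in> set (free_left i v m)" using ne by (simp add: l_def)
  have "q \<le> l"
  proof -
    have "free_left i v m = butlast (free_left i v m) @ [l]" using ne by (simp add: l_def)
    then have "\<forall>p \<in> set (butlast (free_left i v m)). p < l"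
      using sorted_free(2)[of i v m] by (metis sorted_wrt_append list.set_intros(1))
    moreover have "q \<in> set (butlast (free_left i v m) @ [l])"
      using q_mem \<open>free_left i v m = butlast (free_left i v m) @ [l]\<close> by simp
    ultimately show ?thesis by auto
  qed
  moreover have "\<not> q < l" using l after[of l] by (auto simp: free_left_def)
  ultimately have "l = q" by simp
  then show "?H (last (free_left i v m)) = ?H m - 1" using \<open>?H q = ?H m - 1\<close> by (simp add: l_def)
qed

lemma free_left_pop:
  assumes m: "v ! m = i" and ne: "free_left i v m \<noteq> []"
  shows "free_left i v (Suc m) = butlast (free_left i v m)"
    "level i v (last (free_left i v m)) = level i v (Suc m)"
proof -
  let ?H = "level i v" and ?L = "free_left i v m"
  define l L where "l = last ?L" and "L = butlast ?L"
  have L: "?L = L @ [l]" using ne by (simp add: l_def L_def)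
  have l: "l \<in> set ?L" using L by simp
  then have "l < m" "?H l < ?H m" by (auto simp: free_left_def)
  then have "\<exists>q \<le> m. ?H q < ?H m" by (intro exI[of _ l]) simp
  then have "?H l = ?H m - 1" using last_free_left(2)[of m i v] by (simp add: l_def)
  then have hl: "?H l = ?H (Suc m)" using m by (simp add: level_Suc weight_def)
  then show "?H (last ?L) = ?H (Suc m)" by (simp add: l_def)
  have "?H p < ?H l" if "p \<in> set L" for p
  proof -
    have "p < l" using sorted_free(2)[of i v m] L that by (simp add: sorted_wrt_append)
    moreover have "p \<in> set ?L" using that L by simp
    ultimately show ?thesis using \<open>l < m\<close> by (simp add: free_left_def)
  qed
  then show "free_left i v (Suc m) = butlast ?L"
    using m hl L by (simp add: free_left_Suc filter_id_conv)
qed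

text \<open>Reading one letter changes the lists \<open>free_right\<close> and \<open>free_left\<close> exactly as it changes the stack.\<close>

lemma unmatched_eq: "unmatched i v = free_right i v (length v) @ free_left i v (length v)"
proof -
  let ?H = "level i v"
  define step where "step = (\<lambda>st p. case st of [] \<Rightarrow> [p]
      | q # st' \<Rightarrow> (if v ! q = i + 1 \<and> v ! p = i then st' else p # st))"
  define P where "P = (\<lambda>p. v ! p = i \<or> v ! p = i + 1)"
  have letters: "v ! p = i" if "p \<in> set (free_right i v m)" for p m
    using that by (simp add: free_right_def)
  have letters': "v ! p = Suc i" if "p \<in> set (free_left i v m)" for p m
    using that by (simp add: free_left_def)
  have "foldl step [] (filter P [0..<m]) = rev (free_right i v m @ free_left i v m)" for m
  proof (induction m)
    case 0
    show ?case by (simp add: free_right_def free_left_def)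
  next
    case (Suc m)
    let ?R = "free_right i v m" and ?L = "free_left i v m"
    have keep: "filter (\<lambda>p. ?H p < ?H (Suc m)) ?L = ?L" if "?H m \<le> ?H (Suc m)"
    proof -
      have "?H p < ?H m" if "p \<in> set ?L" for p using that by (simp add: free_left_def)
      then show ?thesis using that by (fastforce simp: filter_id_conv)
    qed
    consider "v ! m \<noteq> i" "v ! m \<noteq> Suc i" | "v ! m = Suc i"
      | "v ! m = i" "?L = []" | "v ! m = i" "?L \<noteq> []" by blast
    then show ?case
    proof cases
      case 1
      then show ?thesis using Suc keep
        by (simp add: P_def free_right_Suc free_left_Suc level_Suc weight_def)
    next
      case 2
      have "foldl step [] (filter P [0..<Suc m]) = step (rev (?R @ ?L)) m"
        using Suc 2 by (simp add: P_def)
      also have "\<dots> = m # rev (?R @ ?L)" using 2 by (simp add: step_def split: list.split)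
      also have "\<dots> = rev (free_right i v (Suc m) @ free_left i v (Suc m))"
        using 2 keep by (simp add: free_right_Suc free_left_Suc level_Suc weight_def)
      finally show ?thesis .
    next
      case 3
      have low: "?H m \<le> ?H q" if "q \<le> m" for q
        using last_free_left(1)[of m i v] 3(2) that by (meson not_le)
      have "foldl step [] (filter P [0..<Suc m]) = step (rev ?R) m"
        using Suc 3 by (simp add: P_def)
      also have "\<dots> = m # rev ?R"
      proof (cases ?R rule: rev_cases)
        case (snoc ys y)
        then have "v ! y = i" using letters[of y m] by simp
        then show ?thesis using snoc by (simp add: step_def)
      qed (simp add: step_def)
      also have "\<dots> = rev (free_right i v (Suc m) @ free_left i v (Suc m))"
        using 3 low by (fastforce simp: free_right_Suc free_left_Suc level_Suc weight_def)
      finally show ?thesis .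
    next
      case 4
      define l L where "l = last ?L" and "L = butlast ?L"
      have L: "?L = L @ [l]" using 4 by (simp add: l_def L_def)
      have l: "l \<in> set ?L" using L by simp
      then have "l < m" by (auto simp: free_left_def)
      have "foldl step [] (filter P [0..<Suc m]) = step (rev (?R @ L @ [l])) m"
        using Suc 4 L by (simp add: P_def)
      also have "\<dots> = rev (?R @ L)" using 4 letters'[OF l] by (simp add: step_def)
      also have "?R = free_right i v (Suc m)"
        using 4 free_left_pop(2)[OF 4] \<open>l < m\<close> by (auto simp: free_right_Suc l_def intro!: exI[of _ l])
      also have "L = free_left i v (Suc m)" using free_left_pop(1)[OF 4] by (simp add: L_def)
      finally show ?thesis .
    qed
  qed
  then show ?thesis by (simp add: unmatched_def step_def P_def)
qed

lemma foldl_update: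
  assumes "distinct ps" "length xs = length ps" "\<forall>p \<in> set ps. p < length v"
  defines "u \<equiv> foldl (\<lambda>v (p, x). v[p := x]) v (zip ps xs)"
  shows "length u = length v" "\<And>k. k < length ps \<Longrightarrow> u ! (ps ! k) = xs ! k"
    "\<And>p. p \<notin> set ps \<Longrightarrow> u ! p = v ! p" "mset u + mset (map ((!) v) ps) = mset v + mset xs"
proof -
  have "length u = length v \<and> (\<forall>k < length ps. u ! (ps ! k) = xs ! k) \<and> (\<forall>p. p \<notin> set ps \<longrightarrow> u ! p = v ! p) \<and>
    mset u + mset (map ((!) v) ps) = mset v + mset xs"
    using assms(1-3) unfolding u_def
  proof (induction ps arbitrary: xs v)
    case (Cons p ps)
    obtain x xs' where xs: "xs = x # xs'" "length xs' = length ps" using Cons.prems(2) by (cases xs) auto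
    let ?u = "foldl (\<lambda>v (p, x). v[p := x]) (v[p := x]) (zip ps xs')"
    have IH: "length ?u = length v" "\<forall>k < length ps. ?u ! (ps ! k) = xs' ! k"
      "\<forall>q. q \<notin> set ps \<longrightarrow> ?u ! q = v[p := x] ! q"
      "mset ?u + mset (map ((!) (v[p := x])) ps) = mset (v[p := x]) + mset xs'"
      using Cons.IH[of xs' "v[p := x]"] Cons.prems xs by auto
    have keep: "map ((!) (v[p := x])) ps = map ((!) v) ps"
      using Cons.prems(1) by (intro map_cong refl nth_list_update_neq) auto
    have upd: "add_mset (v ! p) (mset (v[p := x])) = add_mset x (mset v)"
      using Cons.prems(3) by (simp add: mset_update)
    have "mset ?u + mset (map ((!) v) (p # ps)) = add_mset (v ! p) (mset ?u + mset (map ((!) v) ps))"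
      by simp
    also have "\<dots> = add_mset (v ! p) (mset (v[p := x])) + mset xs'" using IH(4) keep by simp
    also have "\<dots> = mset v + mset xs" unfolding upd xs(1) by simp
    finally have "mset ?u + mset (map ((!) v) (p # ps)) = mset v + mset xs" .
    moreover have "\<forall>k < length (p # ps). ?u ! ((p # ps) ! k) = xs ! k"
      using IH(2,3) Cons.prems(1,3) xs by (auto simp: nth_Cons')
    moreover have "\<forall>q. q \<notin> set (p # ps) \<longrightarrow> ?u ! q = v ! q" using IH(3) by auto
    ultimately show ?case using IH(1) xs by simp
  qed simp
  then show "length u = length v" "\<And>k. k < length ps \<Longrightarrow> u ! (ps ! k) = xs ! k"
    "\<And>p. p \<notin> set ps \<Longrightarrow> u ! p = v ! p" "mset u + mset (map ((!) v) ps) = mset v + mset xs" by blast+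
qed

lemma s_word_facts:
  fixes i v
  defines "R \<equiv> free_right i v (length v)" and "L \<equiv> free_left i v (length v)"
  shows length_s_word: "length (s_word i v) = length v"
    and "\<And>k. k < length R \<Longrightarrow> s_word i v ! (R ! k) = (if k < length L then i else Suc i)"
    and "\<And>k. k < length L \<Longrightarrow> s_word i v ! (L ! k) = (if length R + k < length L then i else Suc i)"
    and "\<And>p. p \<notin> set R \<union> set L \<Longrightarrow> s_word i v ! p = v ! p"
    and "mset (s_word i v) + replicate_mset (length R) i + replicate_mset (length L) (Suc i)
       = mset v + replicate_mset (length L) i + replicate_mset (length R) (Suc i)"
proof -
  have R: "\<forall>p \<in> set R. v ! p = i \<and> p < length v" by (auto simp: R_def free_right_def)
  have L: "\<forall>p \<in> set L. v ! p = Suc i \<and> p < length v" by (auto simp: L_def free_left_def)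
  have filters: "filter (\<lambda>p. v ! p = i) R = R" "filter (\<lambda>p. v ! p = i) L = []"
    "filter (\<lambda>p. v ! p = Suc i) R = []" "filter (\<lambda>p. v ! p = Suc i) L = L"
    using R L by (auto simp: filter_id_conv filter_empty_conv)
  have "sorted_wrt (<) R" "sorted_wrt (<) L" using sorted_free by (auto simp: R_def L_def)
  then have "distinct R" "distinct L" by (auto simp: strict_sorted_iff)
  moreover have "set R \<inter> set L = {}" using R L by fastforce
  ultimately have dist: "distinct (R @ L)" by simp
  let ?xs = "replicate (length L) i @ replicate (length R) (Suc i)"
  have s: "s_word i v = foldl (\<lambda>v (p, x). v[p := x]) v (zip (R @ L) ?xs)"
    by (simp add: s_word_def unmatched_eq Let_def R_def[symmetric] L_def[symmetric] filters)
  have len: "length ?xs = length (R @ L)" by simp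
  have "\<forall>p \<in> set (R @ L). p < length v" using R L by auto
  note u = foldl_update[OF dist len this, folded s]
  show "length (s_word i v) = length v" by (rule u(1))
  show "s_word i v ! (R ! k) = (if k < length L then i else Suc i)" if "k < length R" for k
    using u(2)[of k] that by (simp add: nth_append split: if_splits)
  show "s_word i v ! (L ! k) = (if length R + k < length L then i else Suc i)" if "k < length L" for k
    using u(2)[of "length R + k"] that by (simp add: nth_append split: if_splits)
  show "s_word i v ! p = v ! p" if "p \<notin> set R \<union> set L" for p using u(3)[of p] that by simp
  have "map ((!) v) (R @ L) = replicate (length R) i @ replicate (length L) (Suc i)"
    using R L by (simp add: map_replicate_const[symmetric] cong: map_cong)
  then show "mset (s_word i v) + replicate_mset (length R) i + replicate_mset (length L) (Suc i)
       = mset v + replicate_mset (length L) i + replicate_mset (length R) (Suc i)"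
    using u(4) by (simp add: add.assoc)
qed

text \<open>Each unmatched right parenthesis lowers the minimum by one.\<close>

lemma level_minimum:
  "(\<forall>q \<le> m. - int (length (free_right i v m)) \<le> level i v q) \<and>
   (\<exists>q \<le> m. level i v q = - int (length (free_right i v m)))"
proof (induction m)
  case 0
  show ?case by (simp add: free_right_def)
next
  case (Suc m)
  let ?H = "level i v"
  show ?case
  proof (cases "v ! m = i \<and> (\<forall>q \<le> m. ?H (Suc m) < ?H q)")
    case True
    then have len: "length (free_right i v (Suc m)) = Suc (length (free_right i v m))"
      by (simp add: free_right_Suc)
    have "?H (Suc m) = ?H m - 1" using True by (simp add: level_Suc weight_def)
    moreover obtain q where "q \<le> m" "?H q = - int (length (free_right i v m))" using Suc by blast
    moreover have "?H (Suc m) < ?H q" using True calculation by blast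
    moreover have "- int (length (free_right i v m)) \<le> ?H m" using Suc by blast
    ultimately have "?H (Suc m) = - int (length (free_right i v (Suc m)))" using len by simp
    then show ?thesis using True len by (force simp: le_Suc_eq)
  next
    case False
    then have len: "length (free_right i v (Suc m)) = length (free_right i v m)"
      by (simp add: free_right_Suc)
    have "- int (length (free_right i v m)) \<le> ?H (Suc m)"
    proof (cases "v ! m = i")
      case True
      then obtain q where "q \<le> m" "?H q \<le> ?H (Suc m)" using False by (auto simp: not_less)
      then show ?thesis using Suc by force
    next
      case False
      then have "?H m \<le> ?H (Suc m)" by (simp add: level_Suc weight_def)
      then show ?thesis using Suc by force
    qed
    then show ?thesis using Suc len by (auto simp: le_Suc_eq)
  qed
qed

text \<open>The same count from the other end: passing an unmatched left parenthesis raises the minimum of the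
  levels that are still to come by one.\<close>

lemma level_minimum_right:
  fixes i v
  defines "n \<equiv> length v"
  defines "K m \<equiv> length (filter (\<lambda>p. p \<in> set (free_left i v n)) [0..<m])"
    and "a \<equiv> length (free_right i v n)"
  shows "m \<le> n \<Longrightarrow> (\<forall>q. m \<le> q \<and> q \<le> n \<longrightarrow> int (K m) - int a \<le> level i v q) \<and>
   (\<exists>q. m \<le> q \<and> q \<le> n \<and> level i v q = int (K m) - int a)"
proof (induction m)
  case 0
  show ?case using level_minimum[of n i v] by (simp add: K_def a_def)
next
  case (Suc m)
  let ?H = "level i v"
  have mn: "m \<le> n" "m < n" using Suc.prems by auto
  note IH = Suc.IH[OF mn(1)]
  show ?case
  proof (cases "m \<in> set (free_left i v n)")
    case True
    then have K: "K (Suc m) = Suc (K m)" by (simp add: K_def)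
    have m: "v ! m = Suc i" "\<forall>q. m < q \<and> q \<le> n \<longrightarrow> ?H m < ?H q" using True by (auto simp: free_left_def)
    obtain q where q: "m \<le> q" "q \<le> n" "?H q = int (K m) - int a" using IH by blast
    have "int (K m) - int a \<le> ?H m" using IH mn by blast
    moreover have "q = m"
    proof (rule ccontr)
      assume "q \<noteq> m"
      then have "?H m < ?H q" using m(2)[rule_format, of q] q by simp
      then show False using q(3) calculation by simp
    qed
    ultimately have "?H m = int (K m) - int a" using q by simp
    moreover have "?H (Suc m) = ?H m + 1" using m(1) by (simp add: level_Suc weight_def)
    moreover have "?H m < ?H r" if "Suc m \<le> r" "r \<le> n" for r using m(2) that by simp
    ultimately show ?thesis using K Suc.prems by (force intro!: exI[of _ "Suc m"])
  next
    case False
    then have K: "K (Suc m) = K m" by (simp add: K_def)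
    have "\<exists>r. m < r \<and> r \<le> n \<and> ?H r \<le> ?H m"
    proof (cases "v ! m = Suc i")
      case True
      then show ?thesis using False mn by (auto simp: free_left_def not_less)
    next
      case False
      then have "?H (Suc m) \<le> ?H m" by (simp add: level_Suc weight_def)
      then show ?thesis using mn by (intro exI[of _ "Suc m"]) simp
    qed
    then obtain r where r: "m < r" "r \<le> n" "?H r \<le> ?H m" by blast
    obtain q where q: "m \<le> q" "q \<le> n" "?H q = int (K m) - int a" using IH by blast
    have "\<exists>q. Suc m \<le> q \<and> q \<le> n \<and> ?H q = int (K m) - int a"
    proof (cases "q = m")
      case True
      have "int (K m) - int a \<le> ?H r" using IH r by simp
      then have "?H r = int (K m) - int a" using r(3) q(3) True by simp
      then show ?thesis using r by (intro exI[of _ r]) simp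
    next
      case False
      then show ?thesis using q by (intro exI[of _ q]) simp
    qed
    then show ?thesis using K IH by auto
  qed
qed

lemma nth_filter_upt:
  assumes "p < n" "P p"
  shows "filter P [0..<n] ! length (filter P [0..<p]) = p" "length (filter P [0..<p]) < length (filter P [0..<n])"
proof -
  have "[0..<n] = [0..<p] @ p # [Suc p..<n]" using assms(1)
    by (metis less_imp_le_nat upt_add_eq_append upt_conv_Cons le_add_diff_inverse zero_le)
  then have "filter P [0..<n] = filter P [0..<p] @ p # filter P [Suc p..<n]" using assms(2) by simp
  then show "filter P [0..<n] ! length (filter P [0..<p]) = p"
    "length (filter P [0..<p]) < length (filter P [0..<n])" by simp_all
qed

lemma level_total:
  fixes i v
  defines "n \<equiv> length v"
  shows "level i v n = int (length (free_left i v n)) - int (length (free_right i v n))"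
proof -
  have "filter (\<lambda>p. p \<in> set (free_left i v n)) [0..<n] = free_left i v n"
    unfolding free_left_def by (rule filter_cong) auto
  then show ?thesis using level_minimum_right[of "length v" v i] by (auto simp: n_def)
qed

lemma periodic_cyc [simp]: "periodic (length v) (cyc v)"
  by (simp add: periodic_def cyc_def)

lemma cyc_nth [simp]: "p < length v \<Longrightarrow> cyc v (int p) = v ! p"
  by (simp add: cyc_def)

lemma level_height:
  assumes "height i (cyc v) h" "h 0 = 0" "m \<le> length v"
  shows "h (int m) = level i v m"
  using assms(3)
proof (induction m)
  case (Suc m)
  then show ?case using heightD[OF assms(1), of "int m"] by (simp add: level_Suc add.commute)
qed (simp add: assms(2))

lemma height_div_mod:
  assumes "height i (cyc v) h" "h 0 = 0" "v \<noteq> []"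
  shows "h q = level i v (nat (q mod int (length v))) + (q div int (length v)) * level i v (length v)"
proof -
  let ?n = "int (length v)"
  have shift: "h (k + ?n * t) = h k + t * level i v (length v)" for k t
  proof (induction t rule: int_induct[where k = 0])
    case (step1 t)
    then show ?case using height_periodic[OF periodic_cyc assms(1), of "k + ?n * t"]
        level_height[OF assms(1,2), of "length v"] assms(2) by (simp add: algebra_simps)
  next
    case (step2 t)
    then show ?case using height_periodic[OF periodic_cyc assms(1), of "k + ?n * (t - 1)"]
        level_height[OF assms(1,2), of "length v"] assms(2) by (simp add: algebra_simps)
  qed simp
  have "h q = h (q mod ?n + ?n * (q div ?n))" by simp
  also have "\<dots> = h (q mod ?n) + (q div ?n) * level i v (length v)" by (rule shift)
  also have "h (q mod ?n) = level i v (nat (q mod ?n))"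
    using level_height[OF assms(1,2), of "nat (q mod ?n)"] assms(3)
    by (simp add: less_imp_le nat_le_iff)
  finally show ?thesis .
qed

text \<open>Let there be \<open>R\<close> unmatched right and \<open>L\<close> unmatched left parentheses, so that one turn around the
  circle adds \<open>L - R\<close> to the height. The unmatched right parenthesis with index \<open>k\<close> (from \<open>0\<close>)
  leads to height \<open>- k - 1\<close>. The minimum \<open>- R\<close> of the height occurs as \<open>- L\<close> one turn earlier, so
  that the parenthesis remains unmatched cyclically iff \<open>k \<ge> L\<close>; and this is also the
  condition for \<open>s_word\<close> to change it. Left parentheses are analogous.\<close>

theorem reflect_cyc:
  assumes p: "p < length v"
  shows "reflect i (cyc v) (int p) = s_word i v ! p"
proof -
  let ?n = "length v" and ?H = "level i v"
  define R L where "R = free_right i v ?n" and "L = free_left i v ?n"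
  have v: "v \<noteq> []" using p by auto
  obtain h where h: "height i (cyc v) h" "h 0 = 0" using ex_height by blast
  have hH: "h (int q) = ?H q" if "q \<le> ?n" for q using level_height[OF h that] .
  have total: "?H ?n = int (length L) - int (length R)" unfolding L_def R_def by (rule level_total)
  have shift: "h (q + int ?n) = h q + (int (length L) - int (length R))" for q
    using height_periodic[OF periodic_cyc h(1), of q] hH[of ?n] h(2) total by simp
  obtain q0 where q0: "q0 \<le> ?n" "?H q0 = - int (length R)" using level_minimum[of ?n i v] R_def by blast
  have low: "- int (length R) \<le> ?H q" if "q \<le> ?n" for q using level_minimum[of ?n i v] that R_def by blast
  have hSuc: "h (int p + 1) = ?H (Suc p)" using hH[of "Suc p"] p by (simp add: add.commute)
  have hq: "h q = ?H (nat (q mod int ?n)) + (q div int ?n) * (int (length L) - int (length R))" for q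
    using height_div_mod[OF h v, of q] total by simp
  have mod: "nat (q mod int ?n) \<le> ?n" for q
  proof -
    have "q mod int ?n < int ?n" using v by (intro pos_mod_bound) simp
    then show ?thesis by (simp add: nat_le_iff)
  qed
  note r = reflect_height[OF h(1), of "int p"]
  note sR = s_word_facts(2)[of _ i v, folded R_def L_def]
  note sL = s_word_facts(3)[of _ i v, folded R_def L_def]
  note s0 = s_word_facts(4)[of _ i v, folded R_def L_def]
  consider "p \<in> set R" | "p \<in> set L" | "p \<notin> set R \<union> set L" by blast
  then show ?thesis
  proof cases
    case 1
    define k where "k = length (free_right i v p)"
    have pi: "v ! p = i" "\<forall>q \<le> p. ?H (Suc p) < ?H q" using 1 by (auto simp: R_def free_right_def)
    have k: "R ! k = p" "k < length R"
      using nth_filter_upt[of p ?n "\<lambda>p. v ! p = i \<and> (\<forall>q \<le> p. ?H (Suc p) < ?H q)"] p pi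
      by (simp_all add: R_def k_def free_right_def)
    have Hp: "?H (Suc p) = - int k - 1"
    proof -
      obtain q where "q \<le> p" "?H q = - int k" using level_minimum[of p i v] k_def by blast
      moreover have "- int k \<le> ?H p" using level_minimum[of p i v] k_def by blast
      moreover have "?H (Suc p) = ?H p - 1" using pi by (simp add: level_Suc weight_def)
      ultimately show ?thesis using pi(2) by force
    qed
    have "(\<forall>q \<le> int p. h (int p + 1) < h q) \<longleftrightarrow> length L \<le> k"
    proof
      assume *: "\<forall>q \<le> int p. h (int p + 1) < h q"
      have "h (int p + 1) < h (int q0 - int ?n)" using * q0(1) by simp
      then show "length L \<le> k" using shift[of "int q0 - int ?n"] hH[OF q0(1)] q0(2) hSuc Hp by simp
    next
      assume kL: "length L \<le> k"
      show "\<forall>q \<le> int p. h (int p + 1) < h q"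
      proof (intro allI impI)
        fix q assume q: "q \<le> int p"
        show "h (int p + 1) < h q"
        proof (cases "0 \<le> q")
          case True
          then obtain q' where q': "q = int q'" using nonneg_int_cases by blast
          then show ?thesis using pi(2) hH[of q'] hSuc q p by simp
        next
          case False
          then have "q div int ?n < 0" using v by (simp add: pos_imp_zdiv_neg_iff)
          then have "q div int ?n \<le> - 1" by simp
          then have "(- 1) * (int (length L) - int (length R)) \<le> (q div int ?n) * (int (length L) - int (length R))"
            using kL k(2) by (intro mult_right_mono_neg) auto
          then show ?thesis using hq[of q] low[OF mod[of q]] hSuc Hp kL by simp
        qed
      qed
    qed
    then show ?thesis using sR[OF k(2)] k(1) pi(1) p by (auto simp: r)
  next
    case 2
    define P where "P = (\<lambda>p. p \<in> set L)"
    define k where "k = length (filter P [0..<p])"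
    have pi: "v ! p = Suc i" "\<forall>q. p < q \<and> q \<le> ?n \<longrightarrow> ?H p < ?H q" using 2 by (auto simp: L_def free_left_def)
    have "filter P [0..<?n] = L"
      unfolding P_def L_def free_left_def by (rule filter_cong) auto
    then have k: "L ! k = p" "k < length L"
      using nth_filter_upt[of p ?n P] p 2 by (simp_all add: P_def k_def)
    have "(\<forall>q. p \<le> q \<and> q \<le> ?n \<longrightarrow> int k - int (length R) \<le> ?H q) \<and>
        (\<exists>q. p \<le> q \<and> q \<le> ?n \<and> ?H q = int k - int (length R))"
      using level_minimum_right[of p v i] p by (simp add: k_def P_def L_def R_def)
    then obtain q1 where q1: "p \<le> q1" "q1 \<le> ?n" "?H q1 = int k - int (length R)"
      and ge: "int k - int (length R) \<le> ?H p" using p by auto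
    have Hp: "?H p = int k - int (length R)"
    proof (cases "q1 = p")
      case False
      then have "?H p < ?H q1" using pi(2)[rule_format, of q1] q1 by simp
      then show ?thesis using q1(3) ge by simp
    qed (use q1 in simp)
    have hp: "h (int p) = ?H p" using hH p by simp
    have "(\<forall>q > int p. h (int p) < h q) \<longleftrightarrow> length R + k < length L"
    proof
      assume *: "\<forall>q > int p. h (int p) < h q"
      have "h (int p) < h (int q0 + int ?n)" using * p by simp
      then show "length R + k < length L" using shift[of "int q0"] hH[OF q0(1)] q0(2) hp Hp by simp
    next
      assume kL: "length R + k < length L"
      show "\<forall>q > int p. h (int p) < h q"
      proof (intro allI impI)
        fix q assume q: "int p < q"
        show "h (int p) < h q"
        proof (cases "q \<le> int ?n")
          case True
          then obtain q' where q': "q = int q'" using q nonneg_int_cases[of q] by force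
          then show ?thesis using pi(2) hH[of q'] hp q True by simp
        next
          case False
          then have "0 < q div int ?n" using v by (simp add: pos_imp_zdiv_pos_iff)
          then have "1 \<le> q div int ?n" by simp
          then have "1 * (int (length L) - int (length R)) \<le> (q div int ?n) * (int (length L) - int (length R))"
            using kL by (intro mult_right_mono) auto
          moreover define y z where "y = ?H (nat (q mod int ?n))"
            and "z = (q div int ?n) * (int (length L) - int (length R))"
          ultimately have "int (length L) - int (length R) \<le> z" "h q = y + z" "- int (length R) \<le> y"
            using hq[of q] low[OF mod[of q]] by simp_all
          then show ?thesis using kL hp Hp by simp
        qed
      qed
    qed
    then show ?thesis using sL[OF k(2)] k(1) pi(1) p by (auto simp: r)
  next
    case 3
    have "\<not> (\<forall>q \<le> int p. h (int p + 1) < h q)" if vp: "v ! p = i"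
    proof -
      obtain q where "q \<le> p" "\<not> ?H (Suc p) < ?H q"
        using 3 vp p by (auto simp: R_def free_right_def)
      then show ?thesis using hH[of q] hSuc p by (auto intro!: exI[of _ "int q"])
    qed
    moreover have "\<not> (\<forall>q > int p. h (int p) < h q)" if vp: "v ! p = Suc i"
    proof -
      obtain q where "p < q" "q \<le> ?n" "\<not> ?H p < ?H q"
        using 3 vp p by (auto simp: L_def free_left_def)
      then show ?thesis using hH[of q] hH[of p] p by (auto intro!: exI[of _ "int q"])
    qed
    ultimately show ?thesis using s0[OF 3] p by (simp add: r)
  qed
qed

lemma cyc_window:
  assumes "periodic n f" "0 < n" shows "cyc (window n 0 f) = f"
proof (rule window_inject[OF _ assms(1,2), of _ 0])
  show "periodic n (cyc (window n 0 f))" using periodic_cyc[of "window n 0 f"] by simp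
  have "cyc (window n 0 f) (int i) = f (int i)" if "i < n" for i
    using cyc_nth[of i "window n 0 f"] that by simp
  then show "window n 0 (cyc (window n 0 f)) = window n 0 f"
    by (simp add: window_def)
qed

theorem window_reflect:
  assumes "periodic n f" "0 < n"
  shows "window n 0 (reflect i f) = s_word i (window n 0 f)"
proof (rule nth_equalityI)
  show "length (window n 0 (reflect i f)) = length (s_word i (window n 0 f))"
    by (simp add: length_s_word)
  fix p assume "p < length (window n 0 (reflect i f))"
  then show "window n 0 (reflect i f) ! p = s_word i (window n 0 f) ! p"
    using reflect_cyc[of p "window n 0 f" i] cyc_window[OF assms] by simp
qed

lemma level_count: "level i v (length v) = int (count_list v (Suc i)) - int (count_list v i)"
proof -
  have "level i v (length v) = sum_list (map (weight i) v)"
    by (simp add: level_def sum_list_sum_nth atLeast0LessThan)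
  also have "\<dots> = int (count_list v (Suc i)) - int (count_list v i)"
    by (induction v) (auto simp: weight_def)
  finally show ?thesis .
qed

text \<open>The excess of the unmatched letters \<open>i + 1\<close> over the unmatched letters \<open>i\<close> is the excess among all
  letters.\<close>

theorem count_s_word: "count_list (s_word i v) a = count_list v (transpose i (Suc i) a)"
proof -
  define R L where "R = length (free_right i v (length v))" and "L = length (free_left i v (length v))"
  have "int L - int R = int (count_list v (Suc i)) - int (count_list v i)"
    using level_total[of i v] level_count[of i v] by (simp add: R_def L_def)
  moreover have "count (mset (s_word i v) + replicate_mset R i + replicate_mset L (Suc i)) a
    = count (mset v + replicate_mset L i + replicate_mset R (Suc i)) a"
    using s_word_facts(5)[of i v] by (simp add: R_def L_def)
  ultimately show ?thesis
    by (cases "a = i"; cases "a = Suc i") (auto simp: count_mset transpose_def)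
qed

section \<open>Reflections and the plactic relation\<close>

lemma window_cyc: "window (length v) 0 (cyc v) = v"
  by (rule nth_equalityI) auto

lemma s_word_eq_window: "v \<noteq> [] \<Longrightarrow> s_word i v = window (length v) 0 (reflect i (cyc v))"
  using window_reflect[of "length v" "cyc v" i] by (simp add: window_cyc)

text \<open>Elementary Knuth transformations are Knuth moves away from the seam.\<close>

lemma plactic_s_word:
  assumes "v \<approx> w" shows "s_word i v \<approx> s_word i w"
proof (rule plactic_map[where f = "s_word i", OF _ assms])
  fix v w :: "nat list" assume "knuth v w"
  then obtain A B t t' where *: "knuth_triple t t'" "v = A @ t @ B" "w = A @ t' @ B"
    by (auto simp: knuth_iff_triple)
  let ?n = "length v"
  have "length t = 3" using *(1) by (auto simp: knuth_triple_def)
  then have n: "length A + 2 < ?n" using *(2) by simp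
  have "window ?n 0 (cyc v) = A @ t @ B" using *(2) window_cyc[of v] by simp
  then obtain g where g: "kmove ?n (0 + int (length A)) (cyc v) g" "window ?n 0 g = w"
    using kmove_if_knuth[OF periodic_cyc *(1)] *(3) by blast
  have per: "periodic ?n g" using periodic_kmove[OF periodic_cyc g(1)] .
  have "2 \<le> ?n" "0 < ?n" using n by linarith+
  have "kmove ?n (0 + int (length A)) (reflect i (cyc v)) (reflect i g)"
    using kmove_reflect[OF \<open>2 \<le> ?n\<close> periodic_cyc g(1)] .
  from knuth_if_kmove[OF periodic_reflect[OF periodic_cyc] this n]
  have "knuth (s_word i v) (s_word i w) \<or> knuth (s_word i w) (s_word i v)"
    using window_reflect[OF per \<open>0 < ?n\<close>, of i] g(2) s_word_eq_window[of v i] \<open>0 < ?n\<close> by auto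
  then show "s_word i v \<approx> s_word i w" using plactic_if_knuth plactic_sym by blast
qed

section \<open>Reflections of tableaux\<close>

lemma s_word_le:
  assumes "Suc p < length v" "v ! p \<le> v ! Suc p"
  shows "s_word i v ! p \<le> s_word i v ! Suc p"
proof -
  have v: "v \<noteq> []" using assms by auto
  have "cyc v (int p) = v ! p" "cyc v (int p + 1) = v ! Suc p"
    using assms(1) cyc_nth[of "Suc p" v] by (simp_all add: add.commute)
  then have "\<not> descent (cyc v) (int p)" using assms(2) by (simp add: descent_def)
  then have "\<not> descent (reflect i (cyc v)) (int p)" using descent_reflect[OF periodic_cyc] v by simp
  then show ?thesis
    using assms(1) reflect_cyc[of p v i] reflect_cyc[of "Suc p" v i] by (simp add: descent_def add.commute)
qed

lemma sorted_s_word_segment: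
  assumes "v = A @ R @ B" "s_word i v = A' @ R' @ B'" "length A' = length A" "length R' = length R"
    "sorted R"
  shows "sorted R'"
  unfolding sorted_iff_nth_Suc
proof (intro allI impI)
  fix k assume k: "Suc k < length R'"
  have "R ! k \<le> R ! Suc k" using assms(5) k assms(4) by (simp add: sorted_iff_nth_Suc)
  then have "v ! (length A + k) \<le> v ! Suc (length A + k)" using assms(1,4) k by (simp add: nth_append)
  then have "s_word i v ! (length A + k) \<le> s_word i v ! Suc (length A + k)"
    using s_word_le[of "length A + k" v i] assms(1,4) k by simp
  then show "R' ! k \<le> R' ! Suc k" using k unfolding assms(2) assms(3)[symmetric] by (simp add: nth_append)
qed

lemma level_take: "m \<le> length v \<Longrightarrow> level i v m = sum_list (map (weight i) (take m v))"
  by (simp add: level_def sum_list_sum_nth atLeast0LessThan)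

lemma sorted_split_block:
  assumes "sorted (S :: nat list)"
  obtains lo m hi where "S = lo @ replicate m x @ hi" "\<forall>y \<in> set lo. y < x" "\<forall>y \<in> set hi. x < y"
proof -
  have "\<exists>lo m hi. S = lo @ replicate m x @ hi \<and> (\<forall>y \<in> set lo. y < x) \<and> (\<forall>y \<in> set hi. x < y)"
    using assms
  proof (induction S)
    case (Cons s S)
    then obtain lo m hi where IH: "S = lo @ replicate m x @ hi" "\<forall>y \<in> set lo. y < x" "\<forall>y \<in> set hi. x < y"
      by auto
    have s: "\<forall>y \<in> set S. s \<le> y" using Cons.prems by simp
    consider "s < x" | "s = x" | "x < s" by linarith
    then show ?case
    proof cases
      case 1
      then show ?thesis using IH by (intro exI[of _ "s # lo"] exI[of _ m] exI[of _ hi]) simp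
    next
      case 2
      then have "lo = []" using IH s by (cases lo) auto
      then show ?thesis using IH 2 by (intro exI[of _ "[]"] exI[of _ "Suc m"] exI[of _ hi]) simp
    next
      case 3
      then have "lo = []" "m = 0" using IH s by (cases lo; cases m; auto)+
      then show ?thesis using IH 3 by (intro exI[of _ "[]"] exI[of _ "0"] exI[of _ "s # hi"]) simp
    qed
  qed simp
  then show thesis using that by blast
qed

lemma nth_block:
  assumes S: "S = lo @ replicate m x @ hi" and "\<forall>y \<in> set lo. y < x" "\<forall>y \<in> set hi. x < (y :: nat)"
    and j: "j < length S"
  shows "(S ! j < x \<longleftrightarrow> j < length lo) \<and> (S ! j = x \<longleftrightarrow> length lo \<le> j \<and> j < length lo + m)"
proof -
  consider "j < length lo" | "length lo \<le> j" "j < length lo + m" | "length lo + m \<le> j" by linarith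
  then show ?thesis
  proof cases
    case 1
    then have "S ! j \<in> set lo" by (simp add: S nth_append)
    then show ?thesis using assms(2) 1 by auto
  next
    case 2
    then have "j - length lo < m" by linarith
    then have "S ! j = x" using 2 by (simp add: S nth_append)
    then show ?thesis using 2 by simp
  next
    case 3
    then have "\<not> j - length lo < m" by linarith
    then have "S ! j = hi ! (j - length lo - m)" using 3 by (simp add: S nth_append)
    then have "S ! j \<in> set hi" using j 3 by (simp add: S)
    then show ?thesis using assms(3) 3 by auto
  qed
qed

lemma weight_sum_0: "\<forall>y \<in> set w. y \<noteq> i \<and> y \<noteq> Suc i \<Longrightarrow> sum_list (map (weight i) w) = 0"
  by (induction w) (auto simp: weight_def)

text \<open>The letters \<open>i + 1\<close> form a block of columns in \<open>S\<close>, and the letters \<open>i\<close> one in \<open>R\<close>. As columns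
  increase strictly and the blocks share column \<open>c\<close>, the block of \<open>S\<close> begins and ends no later
  than that of \<open>R\<close>. In the reading word only letters other than \<open>i\<close> and \<open>i + 1\<close> lie between the
  blocks, so that the end of the first matches the beginning of the second, and this includes the
  two letters in column \<open>c\<close>.\<close>

lemma matched_in_adjacent_rows:
  assumes v: "v = A @ S @ R @ B" and rows: "above R S" "sorted S" "sorted R"
    and c: "c < length S" "S ! c = Suc i" "R ! c = i"
  shows "length A + c \<notin> set (free_left i v (length v))"
    and "length A + length S + c \<notin> set (free_right i v (length v))"
proof -
  obtain S1 m S2 where S: "S = S1 @ replicate m (Suc i) @ S2" "\<forall>y \<in> set S1. y < Suc i" "\<forall>y \<in> set S2. Suc i < y"
    using sorted_split_block[OF rows(2)] by blast
  obtain R1 k R2 where R: "R = R1 @ replicate k i @ R2" "\<forall>y \<in> set R1. y < i" "\<forall>y \<in> set R2. i < y"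
    using sorted_split_block[OF rows(3)] by blast
  define a b where "a = length S1" and "b = length R1"
  have len: "length S \<le> length R" and lt: "\<And>j. j < length S \<Longrightarrow> R ! j < S ! j"
    using rows(1) by (auto simp: above_def)
  have Sn: "S ! j < Suc i \<longleftrightarrow> j < a" "S ! j = Suc i \<longleftrightarrow> a \<le> j \<and> j < a + m" if "j < length S" for j
    using nth_block[OF S that] by (simp_all add: a_def)
  have Rn: "R ! j < i \<longleftrightarrow> j < b" "R ! j = i \<longleftrightarrow> b \<le> j \<and> j < b + k" if "j < length R" for j
    using nth_block[OF R that] by (simp_all add: b_def)
  have cR: "c < length R" using c len by simp
  have ac: "a \<le> c" "c < a + m" and bc: "b \<le> c" "c < b + k" using Sn[OF c(1)] Rn[OF cR] c by auto
  have ab: "a \<le> b"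
  proof (rule ccontr)
    assume "\<not> a \<le> b"
    then have b: "b < length S" using ac c by simp
    then have "R ! b = i" using Rn[of b] len bc by simp
    then show False using lt[OF b] Sn[OF b] \<open>\<not> a \<le> b\<close> by simp
  qed
  have am: "a + m \<le> b + k"
  proof (rule ccontr)
    assume *: "\<not> a + m \<le> b + k"
    then have j: "b + k < length S" using S(1) by (simp add: a_def)
    then have "S ! (b + k) = Suc i" using Sn(2)[OF j] * ac bc by simp
    moreover have "b + k < length R" using j len by simp
    ultimately show False using lt[OF j] Rn[of "b + k"] by auto
  qed
  define l where "l = sum_list (map (weight i) (A @ S1))"
  have low: "level i v (length A + a + t) = l + int t" if "t \<le> m" for t
  proof -
    have "take (length A + a + t) v = A @ S1 @ replicate t (Suc i)"
      using that by (simp add: v S(1) a_def)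
    moreover have "length A + a + t \<le> length v" using that by (simp add: v S(1) a_def)
    ultimately show ?thesis by (simp add: level_take l_def weight_def sum_list_replicate)
  qed
  have high: "level i v (length A + length S + b + t) = l + int m - int t" if "t \<le> k" for t
  proof -
    have "take (length A + length S + b + t) v = A @ S @ R1 @ replicate t i"
      using that by (simp add: v R(1) b_def)
    moreover have "length A + length S + b + t \<le> length v" using that by (simp add: v R(1) b_def)
    moreover have "sum_list (map (weight i) S2) = 0" "sum_list (map (weight i) R1) = 0"
      using S(3) R(2) by (force intro!: weight_sum_0)+
    ultimately show ?thesis by (simp add: level_take l_def weight_def sum_list_replicate S(1))
  qed
  let ?r = "length A + length S + b + (m - (c - a))"
  have r1: "level i v ?r = level i v (length A + c)"
    using low[of "c - a"] high[of "m - (c - a)"] ac bc ab am by simp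
  have r2: "length A + c < ?r" using c by simp
  have r3: "?r \<le> length v" using ac bc ab am by (simp add: v R(1) b_def)
  show "length A + c \<notin> set (free_left i v (length v))"
  proof
    assume "length A + c \<in> set (free_left i v (length v))"
    then have "level i v (length A + c) < level i v ?r" using r2 r3 unfolding free_left_def by simp
    then show False using r1 by simp
  qed
  let ?q = "length A + a + (m - (c - b) - 1)"
  have cb: "c - b < m" using ac bc ab by linarith
  have eq: "Suc (length A + length S + c) = length A + length S + b + (c - b + 1)" using bc by simp
  have "level i v (Suc (length A + length S + c)) = l + int m - int (c - b + 1)"
    unfolding eq by (rule high) (use bc in simp)
  moreover have "level i v ?q = l + int (m - (c - b) - 1)" by (rule low) simp
  moreover have "int (m - (c - b) - 1) = int m - int (c - b + 1)" using cb by simp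
  ultimately have q1: "level i v (Suc (length A + length S + c)) = level i v ?q" by simp
  have q2: "?q \<le> length A + length S + c" using ac bc ab by (simp add: S(1) a_def)
  show "length A + length S + c \<notin> set (free_right i v (length v))"
  proof
    assume "length A + length S + c \<in> set (free_right i v (length v))"
    then have "level i v (Suc (length A + length S + c)) < level i v ?q"
      using q2 unfolding free_right_def by simp
    then show False using q1 by simp
  qed
qed

lemma above_s_word_segments:
  assumes v: "v = A @ S @ R @ B" and u: "s_word i v = A' @ S' @ R' @ B'"
    and len: "length A' = length A" "length S' = length S" "length R' = length R"
    and rows: "above R S" "sorted S" "sorted R"
  shows "above R' S'"
  unfolding above_def
proof (intro conjI allI impI)
  show "length S' \<le> length R'" using rows(1) len by (simp add: above_def)
  fix c assume "c < length S'"
  then have c: "c < length S" "c < length R" using rows(1) len by (auto simp: above_def)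
  define p q where "p = length A + c" and "q = length A + length S + c"
  have pq: "v ! p = S ! c" "v ! q = R ! c" "s_word i v ! p = S' ! c" "s_word i v ! q = R' ! c"
    "p < length v" "q < length v"
    using c len v u by (simp_all add: p_def q_def nth_append)
  have lt: "R ! c < S ! c" using rows(1) c by (simp add: above_def)
  have flip: "s_word i v ! r = v ! r \<or> v ! r = i \<and> s_word i v ! r = Suc i \<or> v ! r = Suc i \<and> s_word i v ! r = i"
    if "r < length v" for r
    unfolding reflect_cyc[OF that, symmetric] using that by (simp add: reflect_def)
  show "R' ! c < S' ! c"
  proof (cases "R ! c = i \<and> S ! c = Suc i")
    case True
    have "p \<notin> set (free_left i v (length v))" "q \<notin> set (free_right i v (length v))"
      using matched_in_adjacent_rows[OF v rows c(1)] True by (auto simp: p_def q_def)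
    moreover have "p \<notin> set (free_right i v (length v))" "q \<notin> set (free_left i v (length v))"
      using True pq by (auto simp: free_right_def free_left_def)
    ultimately have "s_word i v ! p = v ! p" "s_word i v ! q = v ! q"
      using s_word_facts(4)[of p i v] s_word_facts(4)[of q i v] by auto
    then show ?thesis using pq lt by simp
  next
    case False
    then show ?thesis using flip[OF pq(5)] flip[OF pq(6)] pq lt by auto
  qed
qed

text \<open>The rows that lie higher up come later in the reading word; in the induction on the rows they are
  collected in \<open>B\<close>.\<close>

lemma semistandard_s_word:
  assumes "semistandard U" "map length U' = map length U"
    "s_word i (reading_word U @ B) = reading_word U' @ B'"
  shows "semistandard U'"
  using assms
proof (induction U arbitrary: U' B B')
  case (Cons R U)
  obtain R' U1 where U': "U' = R' # U1" "length R' = length R" "map length U1 = map length U"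
    using Cons.prems(2) by (cases U') auto
  have len: "length (reading_word V') = length (reading_word V)" if "map length V' = map length V" for V V' :: tableau
    using that by (simp add: reading_word_def length_concat rev_map[symmetric])
  have U1: "semistandard U1"
    using Cons.IH[OF _ U'(3), of "R @ B" "R' @ B'"] Cons.prems(1,3) U'(1) by simp
  have sorted: "sorted R'"
    using sorted_s_word_segment[of "reading_word (R # U) @ B" "reading_word U" R B i "reading_word U1" R' B']
      Cons.prems(1,3) U' len[OF U'(3)] by simp
  have "above R' (hd U1)" if ne: "U1 \<noteq> []"
  proof -
    obtain S' V' where V': "U1 = S' # V'" using ne by (cases U1) auto
    then obtain S V where V: "U = S # V" "length S' = length S" "map length V' = map length V"
      using U'(3) by (cases U) auto
    show ?thesis
      using above_s_word_segments[of "reading_word (R # U) @ B" "reading_word V" S R B i "reading_word V'" S' R' B']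
        Cons.prems(1,3) U' V V' len[OF V(3)] by simp
  qed
  moreover have "R' \<noteq> []" using U'(2) Cons.prems(1) by auto
  ultimately show ?case using U' U1 sorted by simp
qed simp

lemma cut_concat: "concat (cut ls w) = take (sum_list ls) w"
  by (induction ls arbitrary: w) (auto simp: take_add)

lemma map_length_cut: "sum_list ls \<le> length w \<Longrightarrow> map length (cut ls w) = ls"
  by (induction ls arbitrary: w) auto

lemma reading_word_s_tableau: "reading_word (s_tableau i U) = s_word i (reading_word U)"
  and map_length_s_tableau: "map length (s_tableau i U) = map length U"
proof -
  have "sum_list (map length (rev U)) = length (reading_word U)"
    by (simp add: reading_word_def length_concat)
  then have "sum_list (map length (rev U)) = length (s_word i (reading_word U))" by (simp add: length_s_word)
  then show "reading_word (s_tableau i U) = s_word i (reading_word U)"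
    "map length (s_tableau i U) = map length U"
    using map_length_cut[of "map length (rev U)" "s_word i (reading_word U)"]
    by (simp_all add: s_tableau_def reading_word_def cut_concat rev_map[symmetric])
qed

text \<open>A word can be replaced by the reading word of its insertion tableau, because \<open>s_word\<close> respects the
  plactic relation; and for reading words the claim holds by definition of \<open>s_tableau\<close>, once the
  result is known to be semistandard.\<close>

theorem s_tableau_insertion_tableau: "s_tableau i (insertion_tableau v) = insertion_tableau (s_word i v)"
proof -
  let ?U = "insertion_tableau v"
  have "semistandard (s_tableau i ?U)"
    by (rule semistandard_s_word[OF semistandard_insertion_tableau map_length_s_tableau,
          where B = "[]" and B' = "[]" and i = i]) (simp add: reading_word_s_tableau)
  then have "s_tableau i ?U = insertion_tableau (s_word i (reading_word ?U))"
    using insertion_tableau_reading_word reading_word_s_tableau by metis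
  also have "\<dots> = insertion_tableau (s_word i v)"
    by (intro insertion_tableau_plactic plactic_s_word reading_word_insertion_tableau)
  finally show ?thesis .
qed

section \<open>Reverse complement\<close>

definition reverse_complement :: "nat \<Rightarrow> nat list \<Rightarrow> nat list" where
  "reverse_complement d w = map (\<lambda>x. d + 1 - x) (rev w)"

lemma reverse_complement_append:
  "reverse_complement d (v @ w) = reverse_complement d w @ reverse_complement d v"
  by (simp add: reverse_complement_def)

text \<open>Reverse complementation interchanges the two kinds of Knuth relations.\<close>

lemma knuth_reverse_complement:
  assumes "knuth v w" "\<forall>x \<in> set v. x \<le> d"
  shows "knuth (reverse_complement d v) (reverse_complement d w)"
  using assms
proof (induction rule: knuth.induct)
  case (knuth_yxz x y z A B)
  then have "d + 1 - z \<le> d + 1 - y" "d + 1 - y < d + 1 - x" by auto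
  from knuth_xzy[OF this, of "reverse_complement d B" "reverse_complement d A"]
  show ?case by (simp add: reverse_complement_def)
next
  case (knuth_xzy x y z A B)
  then have "d + 1 - z < d + 1 - y" "d + 1 - y \<le> d + 1 - x" by auto
  from knuth_yxz[OF this, of "reverse_complement d B" "reverse_complement d A"]
  show ?case by (simp add: reverse_complement_def)
qed

lemma plactic_reverse_complement:
  assumes "v \<approx> w" "\<forall>x \<in> set v. x \<le> d"
  shows "reverse_complement d v \<approx> reverse_complement d w"
  using assms(1)
proof (induction rule: equivclp_induct)
  case (step u w)
  have "set u = set v" using mset_plactic[OF step.hyps(1)] by (metis set_mset_mset)
  then have "\<forall>x \<in> set u. x \<le> d" "knuth w u \<Longrightarrow> \<forall>x \<in> set w. x \<le> d"
    using assms(2) mset_knuth[of w u] by (auto dest: mset_eq_setD)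
  then have "reverse_complement d u \<approx> reverse_complement d w"
    using step.hyps(2) knuth_reverse_complement plactic_if_knuth plactic_sym by metis
  then show ?case using step.IH plactic_trans by blast
qed simp

theorem evac_insertion_tableau:
  assumes "\<forall>x \<in> set w. x \<le> d"
  shows "evac d (insertion_tableau w) = insertion_tableau (reverse_complement d w)"
proof -
  have "w \<approx> reading_word (insertion_tableau w)"
    by (rule plactic_sym[OF reading_word_insertion_tableau])
  from insertion_tableau_plactic[OF plactic_reverse_complement[OF this assms]]
  show ?thesis by (simp add: evac_def reverse_complement_def)
qed


section \<open>The positions of the letters\<close>

definition positions :: "nat \<Rightarrow> nat list \<Rightarrow> nat list" where
  "positions a v = filter (\<lambda>x. v ! (x - 1) = a) [1..<Suc (length v)]"

definition columns :: "nat set \<Rightarrow> nat list \<Rightarrow> nat \<Rightarrow> (nat \<times> nat) list" where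
  "columns S v m = map (\<lambda>x. (x, v ! (x - 1))) (filter (\<lambda>x. v ! (x - 1) \<in> S) [1..<Suc m])"

lemma columns_Suc: "columns S v (Suc m) = columns S v m @ (if v ! m \<in> S then [(Suc m, v ! m)] else [])"
  by (simp add: columns_def)

lemma rsk_positions:
  assumes "sorted_wrt (<) as"
  shows "rsk (concat (map (\<lambda>a. map (Pair a) (positions a v)) as))
    = prod.swap (rsk (columns (set as) v (length v)))"
proof (rule rsk_symmetry)
  let ?L = "concat (map (\<lambda>a. map (Pair a) (positions a v)) as)"
  have pos: "sorted_wrt (<) (positions a v)" for a
    by (simp add: positions_def sorted_wrt_filter del: upt_Suc)
  show L: "sorted_wrt array_less ?L"
    using assms
  proof (induction as)
    case (Cons a as)
    have "sorted_wrt array_less (map (Pair a) (positions a v))"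
      using pos[of a] by (simp add: sorted_wrt_map array_less_def)
    moreover have "\<forall>c \<in> set (map (Pair a) (positions a v)).
        \<forall>c' \<in> set (concat (map (\<lambda>a. map (Pair a) (positions a v)) as)). array_less c c'"
      using Cons.prems by (auto simp: array_less_def)
    ultimately show ?case using Cons by (simp add: sorted_wrt_append)
  qed simp
  show "sorted_wrt (<) (map fst (columns (set as) v (length v)))"
    by (simp add: columns_def comp_def sorted_wrt_filter del: upt_Suc)
  have "distinct xs" if "sorted_wrt array_less xs" for xs
    using that by (induction xs) (auto simp: array_less_def)
  then have "distinct ?L" using L by blast
  then have "distinct (map prod.swap ?L)" by (simp add: distinct_map)
  moreover have "distinct (columns (set as) v (length v))"
    by (auto simp: columns_def distinct_map inj_on_def)
  moreover have "set (map prod.swap ?L) = set (columns (set as) v (length v))"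
    by (auto simp: columns_def positions_def image_iff simp del: upt_Suc)
  ultimately show "mset (map prod.swap ?L) = mset (columns (set as) v (length v))"
    by (simp only: set_eq_iff_mset_eq_distinct)
qed

text \<open>The insertion tableau of a word in the letters \<open>i\<close> and \<open>i + 1\<close>, with \<open>x\<close> letters \<open>i\<close> and \<open>y\<close>
  letters \<open>i + 1\<close> in the first row, and \<open>z\<close> letters \<open>i + 1\<close> in the second one.\<close>

definition two_rows :: "nat \<Rightarrow> nat \<Rightarrow> nat \<Rightarrow> nat \<Rightarrow> tableau" where
  "two_rows i x y z = (if x + y = 0 then []
     else (replicate x i @ replicate y (Suc i)) # (if z = 0 then [] else [replicate z (Suc i)]))"

lemma row_insert_two_rows:
  assumes "x = 0 \<Longrightarrow> z = 0"
  shows "row_insert (Suc i) (two_rows i x y z) = (two_rows i x (Suc y) z, 0)"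
    and "row_insert i (two_rows i x y z) =
      (if y = 0 then (two_rows i (Suc x) 0 z, 0) else (two_rows i (Suc x) (y - 1) (Suc z), 1))"
proof -
  have max: "insert_row (Suc i) (replicate x i @ replicate y (Suc i)) = (replicate x i @ replicate (Suc y) (Suc i), None)"
    for x y by (subst insert_row_max) (auto simp: replicate_append_same)
  have max0: "insert_row i (replicate x i) = (replicate (Suc x) i, None)"
    for x by (subst insert_row_max) (auto simp: replicate_append_same)
  have bump: "insert_row i (replicate x i @ replicate (Suc y) (Suc i)) = (replicate (Suc x) i @ replicate y (Suc i), Some (Suc i))"
    for x y by (subst insert_row_prefix) (auto simp: replicate_app_Cons_same)
  show "row_insert (Suc i) (two_rows i x y z) = (two_rows i x (Suc y) z, 0)"
    using assms max[of x y] by (auto simp: two_rows_def)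
  show "row_insert i (two_rows i x y z) =
      (if y = 0 then (two_rows i (Suc x) 0 z, 0) else (two_rows i (Suc x) (y - 1) (Suc z), 1))"
  proof (cases y)
    case 0
    then show ?thesis using assms max0[of x] by (auto simp: two_rows_def)
  next
    case (Suc y')
    then show ?thesis using assms bump[of x y'] max[of 0 z] by (auto simp: two_rows_def)
  qed
qed

definition matched :: "nat \<Rightarrow> nat list \<Rightarrow> nat \<Rightarrow> bool" where
  "matched i v m \<longleftrightarrow> v ! m = i \<and> free_left i v m \<noteq> []"

text \<open>The letters \<open>i + 1\<close> in the first row of the insertion tableau correspond to the open left
  parentheses. So a letter \<open>i\<close> leads to a new box in the second row iff it closes one of these.\<close>

lemma rsk_two_letters:
  fixes i v
  defines "A m \<equiv> columns {i, Suc i} v m"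
  shows "snd (rsk (A (Suc m))) = (if v ! m = i \<or> v ! m = Suc i
    then append_to_row (if matched i v m then 1 else 0) (Suc m) (snd (rsk (A m))) else snd (rsk (A m)))"
proof -
  have inv: "\<exists>x z. fst (rsk (A m)) = two_rows i x (length (free_left i v m)) z \<and> (x = 0 \<longrightarrow> z = 0)" for m
  proof (induction m)
    case 0
    show ?case by (intro exI[of _ 0]) (simp add: A_def columns_def two_rows_def free_left_def)
  next
    case (Suc m)
    then obtain x z where IH: "fst (rsk (A m)) = two_rows i x (length (free_left i v m)) z" "x = 0 \<longrightarrow> z = 0"
      by blast
    have xz: "x = 0 \<Longrightarrow> z = 0" using IH(2) by simp
    note ins = row_insert_two_rows[OF xz, where i = i and y = "length (free_left i v m)"]
    have keep: "free_left i v (Suc m) = free_left i v m @ (if v ! m = Suc i then [m] else [])" if "v ! m \<noteq> i"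
    proof -
      have "level i v m \<le> level i v (Suc m)" using that by (simp add: level_Suc weight_def)
      then have "\<forall>p \<in> set (free_left i v m). level i v p < level i v (Suc m)"
        by (fastforce simp: free_left_def)
      then show ?thesis by (simp add: free_left_Suc filter_id_conv)
    qed
    consider "v ! m = i" "free_left i v m = []" | "v ! m = i" "free_left i v m \<noteq> []"
      | "v ! m = Suc i" | "v ! m \<noteq> i" "v ! m \<noteq> Suc i" by blast
    then show ?case
    proof cases
      case 1
      then have "free_left i v (Suc m) = []" by (simp add: free_left_Suc)
      moreover have "fst (rsk (A (Suc m))) = two_rows i (Suc x) 0 z"
        using 1 IH ins by (simp add: A_def columns_Suc rsk_snoc)
      ultimately show ?thesis by (intro exI[of _ "Suc x"] exI[of _ z]) simp
    next
      case 2
      have "fst (rsk (A (Suc m))) = two_rows i (Suc x) (length (free_left i v m) - 1) (Suc z)"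
        using 2 IH ins by (simp add: A_def columns_Suc rsk_snoc)
      then show ?thesis using free_left_pop(1)[OF 2] by (intro exI[of _ "Suc x"] exI[of _ "Suc z"]) simp
    next
      case 3
      have "fst (rsk (A (Suc m))) = two_rows i x (Suc (length (free_left i v m))) z"
        using 3 IH ins by (simp add: A_def columns_Suc rsk_snoc)
      then show ?thesis using keep 3 IH(2) by (intro exI[of _ x] exI[of _ z]) simp
    next
      case 4
      then show ?thesis using IH keep by (intro exI[of _ x] exI[of _ z]) (simp add: A_def columns_Suc)
    qed
  qed
  obtain x z where IH: "fst (rsk (A m)) = two_rows i x (length (free_left i v m)) z" "x = 0 \<longrightarrow> z = 0"
    using inv by blast
  have xz: "x = 0 \<Longrightarrow> z = 0" using IH(2) by simp
  show ?thesis
    using IH(1) row_insert_two_rows[OF xz, where i = i and y = "length (free_left i v m)"]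
    by (auto simp: A_def columns_Suc rsk_snoc matched_def)
qed

lemma matched_iff: "matched i v m \<longleftrightarrow> v ! m = i \<and> m \<notin> set (free_right i v (Suc m))"
proof -
  have "free_left i v m \<noteq> [] \<longleftrightarrow> \<not> (\<forall>q \<le> m. level i v (Suc m) < level i v q)" if m: "v ! m = i"
  proof
    assume ne: "free_left i v m \<noteq> []"
    have "last (free_left i v m) \<in> set (free_left i v m)" using ne by simp
    then have "last (free_left i v m) \<le> m" by (simp add: free_left_def)
    then show "\<not> (\<forall>q \<le> m. level i v (Suc m) < level i v q)"
      using free_left_pop(2)[OF m ne] by (metis less_irrefl)
  next
    assume "\<not> (\<forall>q \<le> m. level i v (Suc m) < level i v q)"
    then obtain q where "q \<le> m" "level i v q \<le> level i v (Suc m)" by (auto simp: not_less)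
    moreover have "level i v (Suc m) < level i v m" using m by (simp add: level_Suc weight_def)
    ultimately have "\<exists>q \<le> m. level i v q < level i v m" by force
    then show "free_left i v m \<noteq> []" by (rule last_free_left(1))
  qed
  then show ?thesis by (auto simp: matched_def free_right_def simp del: upt_Suc)
qed


text \<open>Between consecutive unmatched letters the word is balanced, and \<open>s_word\<close> does not change these
  balanced parts. So the level of \<open>s_word i v\<close> arises from the level of \<open>v\<close> by changing the level
  at which each balanced part is based. In the proof, \<open>base c k\<close> is that level after \<open>k\<close> unmatched
  letters if the first \<open>c\<close> of all unmatched letters are right parentheses; \<open>c\<close> is \<open>a\<close> for \<open>v\<close>, and
  \<open>b\<close> for \<open>s_word i v\<close>.\<close>

lemma matched_s_word:
  assumes m: "m < length v"
  shows "matched i (s_word i v) m \<longleftrightarrow> matched i v m"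
proof -
  let ?n = "length v" and ?H = "level i v" and ?G = "level i (s_word i v)"
  define R L where "R = free_right i v ?n" and "L = free_left i v ?n"
  define a b where "a = length R" and "b = length L"
  define kR where "kR m = length (filter (\<lambda>p. p \<in> set R) [0..<m])" for m
  define kL where "kL m = length (filter (\<lambda>p. p \<in> set L) [0..<m])" for m
  define base where "base c k = (if k \<le> c then - int k else int k - 2 * int c)" for c k :: nat
  have Rp: "v ! p = i" "p < ?n" "\<And>q. q \<le> p \<Longrightarrow> ?H (Suc p) < ?H q" if "p \<in> set R" for p
    using that by (auto simp: R_def free_right_def)
  have Lp: "v ! p = Suc i" "p < ?n" "\<And>q. p < q \<Longrightarrow> q \<le> ?n \<Longrightarrow> ?H p < ?H q" if "p \<in> set L" for p
    using that by (auto simp: L_def free_left_def)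
  have RL: "p < q" if "p \<in> set R" "q \<in> set L" for p q
  proof (rule ccontr)
    assume "\<not> p < q"
    then have "?H (Suc p) < ?H q" "?H q < ?H (Suc p)" using Rp[OF that(1)] Lp[OF that(2)] by auto
    then show False by simp
  qed
  have kR_eq: "kR m = length (free_right i v m)" if "m \<le> ?n" for m
  proof -
    have "filter (\<lambda>p. p \<in> set R) [0..<m] = free_right i v m"
      unfolding free_right_def R_def using that by (intro filter_cong) auto
    then show ?thesis by (simp add: kR_def)
  qed
  have all: "filter (\<lambda>p. p \<in> set R) [0..<?n] = R" "filter (\<lambda>p. p \<in> set L) [0..<?n] = L"
    unfolding R_def L_def free_right_def free_left_def by (intro filter_cong; auto)+
  have kR_full: "kR m = a" if "q \<in> set L" "q \<le> m" "m \<le> ?n" for q m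
  proof -
    have "filter (\<lambda>p. p \<in> set R) [m..<?n] = []"
      using RL[OF _ that(1)] that(2) by (fastforce simp: filter_empty_conv)
    moreover have "[0..<?n] = [0..<m] @ [m..<?n]" using that(3) by (metis upt_add_eq_append zero_le le_add_diff_inverse)
    ultimately show ?thesis using arg_cong[OF all(1), of length] by (simp add: kR_def a_def)
  qed
  have kL_0: "kL m = 0" if "m \<in> set R" for m
    using RL[OF that] by (fastforce simp: kL_def filter_empty_conv)
  have kR_le: "kR m \<le> a" if "m \<le> ?n" for m
  proof -
    have "[0..<?n] = [0..<m] @ [m..<?n]" using that by (metis upt_add_eq_append zero_le le_add_diff_inverse)
    then show ?thesis using arg_cong[OF all(1), of length] by (simp add: kR_def a_def)
  qed
  have ge: "base a (kR m + kL m) \<le> ?H m" if m: "m \<le> ?n" for m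
  proof (cases "kL m = 0")
    case True
    have "- int (length (free_right i v m)) \<le> ?H m" using level_minimum[of m i v] by blast
    then show ?thesis using True kR_eq[OF m] kR_le[OF m] by (simp add: base_def)
  next
    case False
    then obtain q where "q \<in> set L" "q < m" by (auto simp: kL_def filter_empty_conv)
    then have "kR m = a" using kR_full m by simp
    moreover have "int (kL m) - int a \<le> ?H m"
      using level_minimum_right[OF m, of i] m by (auto simp: kL_def L_def a_def R_def)
    ultimately show ?thesis by (simp add: base_def)
  qed
  have at_R: "kR m < a" "s_word i v ! m = (if kR m < b then i else Suc i)" if "m \<in> set R" for m
  proof -
    have "R ! kR m = m" "kR m < a"
      using nth_filter_upt[of m ?n "\<lambda>p. p \<in> set R"] that Rp(2)[OF that] all(1)
      by (simp_all add: kR_def a_def)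
    then show "kR m < a" "s_word i v ! m = (if kR m < b then i else Suc i)"
      using s_word_facts(2)[of "kR m" i v] by (simp_all add: R_def L_def a_def b_def)
  qed
  have at_L: "kR m = a" "s_word i v ! m = (if a + kL m < b then i else Suc i)" if "m \<in> set L" for m
  proof -
    show "kR m = a" using kR_full[OF that] Lp(2)[OF that] by simp
    have "L ! kL m = m" "kL m < b"
      using nth_filter_upt[of m ?n "\<lambda>p. p \<in> set L"] that Lp(2)[OF that] all(2)
      by (simp_all add: kL_def b_def)
    then show "s_word i v ! m = (if a + kL m < b then i else Suc i)"
      using s_word_facts(3)[of "kL m" i v] by (simp add: R_def L_def a_def b_def)
  qed
  have off: "s_word i v ! m = v ! m" if "m \<notin> set R" "m \<notin> set L" for m
    using s_word_facts(4)[of m i v] that by (simp add: R_def L_def)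
  have k_Suc: "kR (Suc m) = kR m + (if m \<in> set R then 1 else 0)" "kL (Suc m) = kL m + (if m \<in> set L then 1 else 0)" for m
    by (simp_all add: kR_def kL_def)
  \<comment> \<open>the levels of the two words above their bases agree\<close>
  have diff: "?G m - base b (kR m + kL m) = ?H m - base a (kR m + kL m)" if "m \<le> ?n" for m
    using that
  proof (induction m)
    case 0
    show ?case by (simp add: kR_def kL_def base_def)
  next
    case (Suc m)
    consider "m \<in> set R" | "m \<in> set L" "m \<notin> set R" | "m \<notin> set R" "m \<notin> set L" by blast
    then show ?case
    proof cases
      case 1
      then have "m \<notin> set L" using RL by blast
      then show ?thesis using Suc 1 at_R[OF 1] kL_0[OF 1] Rp(1)[OF 1]
        by (simp add: k_Suc level_Suc weight_def base_def split: if_splits)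
    next
      case 2
      then show ?thesis using Suc at_L[OF 2(1)] Lp(1)[OF 2(1)]
        by (simp add: k_Suc level_Suc weight_def base_def split: if_splits)
    next
      case 3
      then show ?thesis using Suc off[OF 3] by (simp add: k_Suc level_Suc)
    qed
  qed
  have k_mono: "kR q + kL q \<le> kR m + kL m" if "q \<le> m" for q m
  proof -
    have "[0..<m] = [0..<q] @ [q..<m]" using that by (metis upt_add_eq_append zero_le le_add_diff_inverse)
    then show ?thesis by (simp add: kR_def kL_def)
  qed
  have free_u: "m \<in> set (free_right i (s_word i v) (Suc m))"
    if "m \<in> set R \<union> set L" "s_word i v ! m = i"
  proof -
    have k: "kR m + kL m < b"
      using that at_R[of m] at_L[of m] kL_0[of m] by (auto split: if_splits)
    have "?H m = base a (kR m + kL m)"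
    proof (cases "m \<in> set R")
      case True
      obtain q where q: "q \<le> m" "?H q = - int (kR m)"
        using level_minimum[of m i v] kR_eq[of m] m by auto
      have "?H m - 1 < ?H q" using Rp(1,3)[OF True] q(1) by (simp add: level_Suc weight_def)
      then show ?thesis using q(2) ge[of m] m kL_0[OF True] at_R(1)[OF True] by (simp add: base_def)
    next
      case False
      then have mL: "m \<in> set L" using that by blast
      obtain q where q: "m \<le> q" "q \<le> ?n" "?H q = int (kL m) - int a"
        using level_minimum_right[of m v i] m by (auto simp: kL_def L_def a_def R_def)
      have "?H m \<le> ?H q" using Lp(3)[OF mL, of q] q(1,2) by (cases "q = m") auto
      then show ?thesis using q(3) ge[of m] m at_L(1)[OF mL] by (simp add: base_def split: if_splits)
    qed
    then have "?G m = - int (kR m + kL m)" using diff[of m] m k by (simp add: base_def)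
    then have "?G (Suc m) = - int (kR m + kL m) - 1" using that(2) by (simp add: level_Suc weight_def)
    moreover have "- int (kR m + kL m) \<le> ?G q" if "q \<le> m" for q
    proof -
      have "- int (kR q + kL q) \<le> base b (kR q + kL q)" by (simp add: base_def)
      also have "\<dots> \<le> ?G q" using diff[of q] ge[of q] that m by simp
      finally show ?thesis using k_mono[OF that] by simp
    qed
    ultimately show ?thesis using that(2) by (force simp: free_right_def simp del: upt_Suc)
  qed
  have free_v: "\<not> matched i v m" if "m \<in> set R \<union> set L"
    using that Lp(1)[of m] Rp(1,3)[of m] by (auto simp: matched_iff free_right_def simp del: upt_Suc)
  have matched_u: "matched i (s_word i v) m" if off_m: "m \<notin> set R" "m \<notin> set L" and vm: "v ! m = i"
  proof -
    \<comment> \<open>\<open>q\<close> is the position of the left parenthesis that matches \<open>m\<close>; no unmatched letter lies in between\<close>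
    define S where "S = {q. q \<le> m \<and> ?H q \<le> ?H (Suc m)}"
    define q where "q = Max S"
    have "S \<noteq> {}" using off_m(1) vm m by (auto simp: S_def R_def free_right_def not_less)
    moreover have "finite S" by (simp add: S_def)
    ultimately have q: "q \<le> m" "?H q \<le> ?H (Suc m)" and max: "\<And>r. r \<in> S \<Longrightarrow> r \<le> q"
      using Max_in[of S] by (auto simp: q_def S_def)
    have none: "p \<notin> set R \<and> p \<notin> set L" if "q \<le> p" "p < Suc m" for p
    proof (rule ccontr)
      assume p: "\<not> ?thesis"
      then have "p < m" using off_m that(2) by (metis less_SucE)
      have "?H (Suc p) \<le> ?H (Suc m)"
      proof (cases "p \<in> set R")
        case True
        then show ?thesis using Rp(3)[OF True that(1)] q(2) by simp
      next
        case False
        then have pL: "p \<in> set L" using p by blast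
        then show ?thesis using Lp(1)[OF pL] Lp(3)[OF pL, of "Suc m"] \<open>p < m\<close> m
          by (simp add: level_Suc[of i v p] weight_def)
      qed
      then have "Suc p \<in> S" using \<open>p < m\<close> by (simp add: S_def)
      then show False using max[of "Suc p"] that(1) by simp
    qed
    have "[0..<Suc m] = [0..<q] @ [q..<Suc m]"
      using q(1) by (metis upt_add_eq_append zero_le le_add_diff_inverse le_SucI)
    moreover have "filter (\<lambda>p. p \<in> set R) [q..<Suc m] = []" "filter (\<lambda>p. p \<in> set L) [q..<Suc m] = []"
      using none by (auto simp: filter_empty_conv simp del: upt_Suc)
    ultimately have "kR (Suc m) = kR q" "kL (Suc m) = kL q" by (simp_all add: kR_def kL_def del: upt_Suc)
    then have "?G q \<le> ?G (Suc m)" using diff[of q] diff[of "Suc m"] q m by simp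
    then have "m \<notin> set (free_right i (s_word i v) (Suc m))"
      using q(1) by (auto simp: free_right_def simp del: upt_Suc)
    then show ?thesis using off[OF off_m] vm by (simp add: matched_iff)
  qed
  show ?thesis
  proof (cases "m \<in> set R \<union> set L")
    case True
    then show ?thesis using free_v free_u by (auto simp: matched_iff)
  next
    case False
    show ?thesis
    proof (cases "v ! m = i")
      case True
      then have "matched i v m" using False m
        by (auto simp: matched_iff R_def free_right_def simp del: upt_Suc)
      then show ?thesis using matched_u True False by blast
    next
      case vm: False
      then show ?thesis using off[of m] False by (simp add: matched_def)
    qed
  qed
qed

lemma s_word_flip:
  assumes "p < length v"
  shows "s_word i v ! p = v ! p \<or> v ! p \<in> {i, Suc i} \<and> s_word i v ! p \<in> {i, Suc i}"
  unfolding reflect_cyc[OF assms, symmetric] using assms by (simp add: reflect_def)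

lemma rsk_columns_s_word:
  "m \<le> length v \<Longrightarrow> snd (rsk (columns {i, Suc i} (s_word i v) m)) = snd (rsk (columns {i, Suc i} v m))"
proof (induction m)
  case 0
  show ?case by (simp add: columns_def)
next
  case (Suc m)
  then have m: "m < length v" by simp
  show ?case using Suc.IH m matched_s_word[OF m, of i] s_word_flip[OF m, of i]
    unfolding rsk_two_letters by auto
qed

definition position_word :: "nat \<Rightarrow> nat list \<Rightarrow> nat list" where
  "position_word d v = concat (map (\<lambda>a. positions a v) [1..<Suc d])"

text \<open>Only the segments for \<open>i\<close> and \<open>i + 1\<close> change. By symmetry, their insertion tableau is the
  recording tableau of the subword in \<open>i\<close> and \<open>i + 1\<close>, which only depends on which letters are
  matched.\<close>

theorem position_word_s_word:
  assumes "1 \<le> i" "i < d"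
  shows "position_word d (s_word i v) \<approx> position_word d v"
proof -
  have split: "[1..<Suc d] = [1..<i] @ [i, Suc i] @ [Suc (Suc i)..<Suc d]"
  proof -
    have "[1..<Suc d] = [1..<i] @ [i..<Suc d]" using assms upt_add_eq_append[of 1 i "Suc d - i"] by simp
    also have "[i..<Suc d] = [i, Suc i] @ [Suc (Suc i)..<Suc d]"
      using assms by (simp add: upt_conv_Cons del: upt_Suc)
    finally show ?thesis .
  qed
  have two: "insertion_tableau (positions i w @ positions (Suc i) w) = snd (rsk (columns {i, Suc i} w (length w)))" for w
    using arg_cong[OF rsk_positions[of "[i, Suc i]" w], of fst] by (simp add: fst_rsk comp_def)
  have pair: "positions i (s_word i v) @ positions (Suc i) (s_word i v) \<approx> positions i v @ positions (Suc i) v"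
    unfolding plactic_iff_insertion_tableau two by (simp add: length_s_word rsk_columns_s_word)
  have "positions a (s_word i v) = positions a v" if "a \<noteq> i" "a \<noteq> Suc i" for a
  proof -
    have "s_word i v ! (x - 1) = a \<longleftrightarrow> v ! (x - 1) = a" if "x \<in> set [1..<Suc (length v)]" for x
    proof -
      have "x - 1 < length v" using that by auto
      from s_word_flip[OF this, of i] show ?thesis using \<open>a \<noteq> i\<close> \<open>a \<noteq> Suc i\<close> by auto
    qed
    then show ?thesis unfolding positions_def length_s_word by (intro filter_cong) auto
  qed
  then have maps: "map (\<lambda>a. positions a (s_word i v)) [1..<i] = map (\<lambda>a. positions a v) [1..<i]"
    "map (\<lambda>a. positions a (s_word i v)) [Suc (Suc i)..<Suc d] = map (\<lambda>a. positions a v) [Suc (Suc i)..<Suc d]"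
    by auto
  show ?thesis
    using plactic_append[OF pair, of "concat (map (\<lambda>a. positions a v) [1..<i])"
        "concat (map (\<lambda>a. positions a v) [Suc (Suc i)..<Suc d])"]
    unfolding position_word_def split map_append concat_append maps by (simp del: upt_Suc)
qed

section \<open>Content\<close>

definition has_content :: "nat \<Rightarrow> (nat \<Rightarrow> nat) \<Rightarrow> (int \<Rightarrow> nat) \<Rightarrow> bool" where
  "has_content n c f \<longleftrightarrow> periodic n f \<and> (\<forall>a. count_list (window n 0 f) a = c a)"

lemma mset_window:
  assumes "periodic n f" shows "mset (window n p f) = mset (window n 0 f)"
proof -
  have step: "mset (window n (p + 1) f) = mset (window n p f)" for p
  proof (cases "window n p f")
    case Nil
    then have "n = 0" using length_window[of n p f] by simp
    then show ?thesis by (simp add: window_def)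
  next
    case (Cons a w)
    then show ?thesis using window_rotate[OF assms Cons] by simp
  qed
  show ?thesis
  proof (induction p rule: int_induct[where k = 0])
    case (step2 i)
    then show ?case using step[of "i - 1"] by simp
  qed (simp_all add: step)
qed

lemma has_content_window:
  assumes "has_content n c f" shows "count_list (window n p f) a = c a"
  using assms mset_window[of n f p] by (metis count_mset has_content_def)

lemma has_content_kmove:
  assumes "0 < n" "has_content n c f" "kmove n k f g" shows "has_content n c g"
proof -
  have per: "periodic n f" "periodic n g" using assms periodic_kmove by (auto simp: has_content_def)
  obtain j where g: "g = swap_at n j f" using assms(3) by (auto simp: kmove_def)
  have "n \<noteq> 1" using not_kmove_1 per(1) assms(3) by blast
  then have n: "Suc 0 < n" using assms(1) by simp
  have "mset (window n j g) = mset (window n j f)"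
  proof -
    have "window n j g = (window n j f)[0 := window n j f ! Suc 0, Suc 0 := window n j f ! 0]"
      using window_swap_at[OF n, of j f] by (simp add: g del: nth_window)
    then show ?thesis using n by (simp only: mset_swap length_window)
  qed
  then show ?thesis using assms(2) per mset_window by (metis count_mset has_content_def)
qed

lemma sorted_unique:
  assumes "0 < n" "has_content n c f" "has_content n c g" "sorted (window n p f)" "sorted (window n p g)"
  shows "f = g"
proof -
  have "mset (window n p f) = mset (window n p g)"
    by (rule multiset_eqI) (simp add: count_mset has_content_window[OF assms(2)] has_content_window[OF assms(3)])
  then have "window n p f = window n p g" using assms(4,5) by (metis properties_for_sort)
  then show ?thesis using window_inject assms(1-3) unfolding has_content_def by blast
qed

lemma window_add_period: "periodic n f \<Longrightarrow> window n (p + int n) f = window n p f"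
  using periodicD[of n f] by (intro nth_equalityI) (simp_all, metis add.assoc add.commute)

text \<open>Follow a path of Knuth moves from a word that is sorted in a window back to \<open>f\<close>: at each step, the
  type determines the image under \<open>F\<close> and \<open>G\<close>.\<close>

theorem equivariant_unique:
  assumes n: "0 < n"
    and per: "\<And>f. has_content n c f \<Longrightarrow> periodic n (F f)" "\<And>f. has_content n c f \<Longrightarrow> periodic n (G f)"
    and F: "\<And>f g k. has_content n c f \<Longrightarrow> kmove n k f g \<Longrightarrow> kmove n (s k) (F f) (F g)"
    and G: "\<And>f g k. has_content n c f \<Longrightarrow> kmove n k f g \<Longrightarrow> kmove n (s k) (G f) (G g)"
    and agree: "\<And>f p. has_content n c f \<Longrightarrow> sorted (window n p f) \<Longrightarrow> F f = G f"
    and f: "has_content n c f"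
  shows "F f = G f"
proof -
  have pf: "periodic n f" using f by (simp add: has_content_def)
  obtain g p where g: "reach n f g" "sorted (window n p g)" using reach_sorted[OF pf] by blast
  show ?thesis
    using g(1) f g(2) unfolding reach_def
  proof (induction rule: converse_rtranclp_induct)
    case base
    then show ?case using agree by blast
  next
    case (step f f')
    obtain k where k: "kmove n k f f'" using step.hyps(1) by blast
    have "periodic n f" using step.prems(1) by (simp add: has_content_def)
    then have "n \<noteq> 1" using not_kmove_1 k by blast
    then have n2: "2 \<le> n" using n by simp
    have f': "has_content n c f'" using has_content_kmove[OF n step.prems(1) k] .
    have "F f' = G f'" using step.IH[OF f' step.prems(2)] .
    then have "kmove n (s k) (F f') (F f)" "kmove n (s k) (F f') (G f)"
      using kmove_sym[OF n2 F[OF step.prems(1) k]] kmove_sym[OF n2 G[OF step.prems(1) k]] by simp_all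
    then show ?case using kmove_unique[OF n2 per(1)[OF f']] by blast
  qed
qed

section \<open>Sequences of reflections\<close>

lemma sorted_window_iff: "sorted (window n p f) \<longleftrightarrow> (\<forall>i. Suc i < n \<longrightarrow> \<not> descent f (p + int i))"
  by (auto simp: sorted_iff_nth_Suc descent_def not_less algebra_simps)

lemma sorted_window_reflect:
  "periodic n f \<Longrightarrow> 0 < n \<Longrightarrow> sorted (window n p (reflect i f)) \<longleftrightarrow> sorted (window n p f)"
  by (simp add: sorted_window_iff descent_reflect)

lemma reflections:
  assumes n: "0 < n" and f: "periodic n f"
  shows "periodic n (foldr reflect is f)"
    and "window n 0 (foldr reflect is f) = foldr s_word is (window n 0 f)"
    and "sorted (window n p f) \<Longrightarrow> sorted (window n p (foldr reflect is f))"
    and "kmove n k f g \<Longrightarrow> kmove n k (foldr reflect is f) (foldr reflect is g)"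
    and "has_content n c f \<Longrightarrow> count_list (window n 0 (foldr reflect is f)) (simple_product is a) = c a"
proof -
  have per: "periodic n (foldr reflect is f)" if "periodic n f" for f "is"
    using that by (induction "is") (auto simp: periodic_reflect)
  show "periodic n (foldr reflect is f)" by (rule per[OF f])
  show "window n 0 (foldr reflect is f) = foldr s_word is (window n 0 f)"
  proof (induction "is")
    case (Cons i "is")
    then show ?case using window_reflect[OF per[OF f] n, of i "is"] by simp
  qed simp
  show "sorted (window n p (foldr reflect is f))" if "sorted (window n p f)"
    using that by (induction "is") (auto simp: sorted_window_reflect[OF per[OF f] n])
  show "kmove n k (foldr reflect is f) (foldr reflect is g)" if k: "kmove n k f g"
  proof (induction "is")
    case (Cons i "is")
    have "n \<noteq> 1" using not_kmove_1 f k by blast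
    then show ?case using kmove_reflect[OF _ per[OF f] Cons, of i] n by simp
  qed (simp add: k)
  show "count_list (window n 0 (foldr reflect is f)) (simple_product is a) = c a" if c: "has_content n c f"
  proof (induction "is")
    case Nil
    show ?case using c by (simp add: has_content_def simple_product_def)
  next
    case (Cons i "is")
    have "count_list (window n 0 (foldr reflect (i # is) f)) (simple_product (i # is) a)
      = count_list (window n 0 (foldr reflect is f)) (simple_product is a)"
      by (simp add: window_reflect[OF per[OF f] n] count_s_word simple_product_def)
    then show ?case using Cons by simp
  qed
qed

lemma simple_product_append: "simple_product (v @ w) = simple_product v \<circ> simple_product w"
  by (induction v) (simp_all add: simple_product_def comp_assoc)

lemma bij_simple_product: "bij (simple_product is)"
proof (induction "is")
  case (Cons i "is")
  have eq: "simple_product (i # is) = transpose i (Suc i) \<circ> simple_product is"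
    by (simp add: simple_product_def)
  show ?case unfolding eq by (rule bij_comp[OF Cons bij_transpose])
next
  case Nil
  have eq: "simple_product [] = id" by (simp add: simple_product_def fun_eq_iff)
  show ?case unfolding eq by (rule bij_id)
qed

lemma simple_product_upt:
  "0 < d \<Longrightarrow> simple_product [1..<d] x = (if 1 \<le> x \<and> x < d then Suc x else if x = d then 1 else x)"
proof (induction d arbitrary: x rule: nat_induct_non_zero)
  case 1
  show ?case by (simp add: simple_product_def)
next
  case (Suc d)
  have "simple_product [1..<Suc d] x = simple_product [1..<d] (transpose d (Suc d) x)"
    using Suc by (simp add: simple_product_append) (simp add: simple_product_def)
  then show ?case using Suc by (auto simp: transpose_def)
qed

text \<open>The longest permutation of \<open>d + 1\<close> letters is that of \<open>d\<close> letters, followed by the cycle of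
  \<open>simple_product_upt\<close>.\<close>

lemma longest_perm_product:
  obtains "is" where "set is \<subseteq> {1..<d}" "simple_product is = longest_perm d"
proof -
  have "\<exists>is. set is \<subseteq> {1..<d} \<and> simple_product is = longest_perm d"
  proof (induction d)
    case 0
    have "simple_product [] = longest_perm 0" by (auto simp: simple_product_def longest_perm_def)
    then show ?case by (intro exI[of _ "[]"]) simp
  next
    case (Suc d)
    then obtain "is" where "is": "set is \<subseteq> {1..<d}" "simple_product is = longest_perm d" by blast
    have "simple_product ([1..<Suc d] @ is) x = longest_perm (Suc d) x" for x
    proof -
      have "simple_product ([1..<Suc d] @ is) x = simple_product [1..<Suc d] (longest_perm d x)"
        using "is"(2) by (simp add: simple_product_append del: upt_Suc)
      also have "\<dots> = longest_perm (Suc d) x"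
        by (subst simple_product_upt) (auto simp: longest_perm_def)
      finally show ?thesis .
    qed
    then show ?case using "is"(1) by (intro exI[of _ "[1..<Suc d] @ is"]) (auto simp del: upt_Suc)
  qed
  then show thesis using that by blast
qed

text \<open>A word that is sorted in a window is determined by its content, and the content of the image only
  depends on the permutation. This takes the place of the braid relations.\<close>

lemma reflections_unique:
  assumes n: "0 < n" and f: "periodic n f" and eq: "simple_product is = simple_product js"
  shows "foldr reflect is f = foldr reflect js f"
proof -
  define c where "c = count_list (window n 0 f)"
  show ?thesis
  proof (rule equivariant_unique[OF n, where c = c and s = "\<lambda>k. k"
        and F = "foldr reflect is" and G = "foldr reflect js"])
    show "has_content n c f" using f by (simp add: has_content_def c_def)
    fix g p assume g: "has_content n c g" "sorted (window n p g)"
    have pg: "periodic n g" using g(1) by (simp add: has_content_def)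
    define c' where "c' a = c (inv (simple_product is) a)" for a
    have "has_content n c' (foldr reflect ks g)" if "simple_product ks = simple_product is" for ks
      unfolding has_content_def
    proof (intro conjI allI)
      fix a
      have "simple_product ks (inv (simple_product is) a) = a"
        using that bij_simple_product by (simp add: bij_is_surj surj_f_inv_f)
      then show "count_list (window n 0 (foldr reflect ks g)) a = c' a"
        using reflections(5)[OF n pg g(1), of ks "inv (simple_product is) a"] by (simp add: c'_def)
    qed (rule reflections(1)[OF n pg])
    then show "foldr reflect is g = foldr reflect js g"
      using sorted_unique[OF n] reflections(3)[OF n pg g(2)] eq by metis
  qed (auto simp: has_content_def reflections(1)[OF n] reflections(4)[OF n])
qed

lemma foldr_s_tableau:
  "foldr s_tableau is (insertion_tableau v) = insertion_tableau (foldr s_word is v)"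
  by (induction "is") (simp_all add: s_tableau_insertion_tableau)

theorem perm_action_insertion_tableau:
  assumes "set is \<subseteq> {1..<d}"
  shows "perm_action d (simple_product is) (insertion_tableau v) = insertion_tableau (foldr s_word is v)"
  unfolding perm_action_def
proof (rule the_equality)
  show "\<exists>js. set js \<subseteq> {1..<d} \<and> simple_product js = simple_product is
      \<and> insertion_tableau (foldr s_word is v) = foldr s_tableau js (insertion_tableau v)"
    using assms by (intro exI[of _ "is"]) (simp add: foldr_s_tableau)
  fix V assume "\<exists>js. set js \<subseteq> {1..<d} \<and> simple_product js = simple_product is
      \<and> V = foldr s_tableau js (insertion_tableau v)"
  then obtain js where js: "simple_product js = simple_product is" "V = insertion_tableau (foldr s_word js v)"
    by (auto simp: foldr_s_tableau)
  show "V = insertion_tableau (foldr s_word is v)"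
  proof (cases "v = []")
    case True
    have "s_word i [] = []" for i using length_s_word[of i "[]"] by simp
    then have "foldr s_word ks [] = []" for ks by (induction ks) simp_all
    then show ?thesis using js True by simp
  next
    case False
    then have n: "0 < length v" by simp
    show ?thesis
      using reflections(2)[OF n periodic_cyc, of js] reflections(2)[OF n periodic_cyc, of "is"]
        reflections_unique[OF n periodic_cyc js(1)] js(2) by (simp add: window_cyc)
  qed
qed

section \<open>Reverse complement of cyclic words\<close>

definition cyclic_rc :: "nat \<Rightarrow> nat \<Rightarrow> (int \<Rightarrow> nat) \<Rightarrow> int \<Rightarrow> nat" where
  "cyclic_rc d n f k = d + 1 - f (int n - 1 - k)"

lemma periodic_cyclic_rc: "periodic n f \<Longrightarrow> periodic n (cyclic_rc d n f)"
  unfolding periodic_def[of _ "cyclic_rc d n f"]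
proof
  fix k assume f: "periodic n f"
  have "f (int n - 1 - k) = f (int n - 1 - (k + int n))"
  proof -
    have e: "int n - 1 - (k + int n) + int n = int n - 1 - k" by simp
    show ?thesis using periodicD[OF f, of "int n - 1 - (k + int n)"] unfolding e .
  qed
  then show "cyclic_rc d n f (k + int n) = cyclic_rc d n f k" by (simp only: cyclic_rc_def)
qed

lemma window_cyclic_rc: "window n (- p) (cyclic_rc d n f) = reverse_complement d (window n p f)"
proof (rule nth_equalityI)
  fix i assume "i < length (window n (- p) (cyclic_rc d n f))"
  then have i: "i < n" by simp
  have e: "int n - 1 - (- p + int i) = p + int (n - Suc i)" using i by simp
  have "window n (- p) (cyclic_rc d n f) ! i = d + 1 - f (p + int (n - Suc i))"
    unfolding nth_window[OF i] cyclic_rc_def e ..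
  also have "f (p + int (n - Suc i)) = window n p f ! (n - Suc i)" using i by (subst nth_window) simp_all
  also have "d + 1 - window n p f ! (n - Suc i) = reverse_complement d (window n p f) ! i"
    using i by (simp add: reverse_complement_def rev_nth del: nth_window)
  finally show "window n (- p) (cyclic_rc d n f) ! i = reverse_complement d (window n p f) ! i" .
qed (simp add: reverse_complement_def)

lemma sorted_reverse_complement: "sorted w \<Longrightarrow> sorted (reverse_complement d w)"
  by (auto simp: reverse_complement_def sorted_map sorted_wrt_rev intro: sorted_wrt_mono_rel[rotated])

lemma cyclic_rc_swap_at:
  assumes n: "n \<noteq> 1"
  shows "cyclic_rc d n (swap_at n j f) = swap_at n (int n - 2 - j) (cyclic_rc d n f)"
proof
  fix k
  have "int n dvd int n - 1 - k - j \<longleftrightarrow> int n dvd k - (int n - 2 - j) - 1"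
    "int n dvd int n - 1 - k - j - 1 \<longleftrightarrow> int n dvd k - (int n - 2 - j)"
    using dvd_minus_iff[of "int n" "int n - 1 - k - j"] dvd_minus_iff[of "int n" "int n - 1 - k - j - 1"]
    by (simp_all add: algebra_simps)
  moreover have "int n - 1 - k + 1 = int n - 1 - (k - 1)" "int n - 1 - k - 1 = int n - 1 - (k + 1)" by simp_all
  moreover have "\<not> (int n dvd k - (int n - 2 - j) \<and> int n dvd k - (int n - 2 - j) - 1)"
  proof
    assume "int n dvd k - (int n - 2 - j) \<and> int n dvd k - (int n - 2 - j) - 1"
    then have "int n dvd 1" using dvd_diff[of "int n" "k - (int n - 2 - j)" "k - (int n - 2 - j) - 1"] by simp
    then show False using n by simp
  qed
  ultimately show "cyclic_rc d n (swap_at n j f) k = swap_at n (int n - 2 - j) (cyclic_rc d n f) k"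
    unfolding cyclic_rc_def swap_at_def by auto
qed

lemma descent_cyclic_rc:
  assumes "\<forall>k. f k \<le> d"
  shows "descent (cyclic_rc d n f) k \<longleftrightarrow> descent f (int n - 2 - k)"
proof -
  have e: "int n - 1 - (k + 1) = int n - 2 - k" "int n - 1 - k = int n - 2 - k + 1" by simp_all
  have "d + 1 - x < d + 1 - y \<longleftrightarrow> y < x" if "x \<le> d" "y \<le> d" for x y :: nat using that by auto
  then show ?thesis unfolding descent_def cyclic_rc_def e using assms by blast
qed

lemma kmove_cyclic_rc:
  assumes "\<forall>k. f k \<le> d" "\<forall>k. g k \<le> d" "kmove n k f g" "n \<noteq> 1"
  shows "kmove n (int n - 3 - k) (cyclic_rc d n f) (cyclic_rc d n g)"
proof -
  have "int n - 2 - (int n - 3 - k) = k + 1" "int n - 2 - (int n - 3 - k + 1) = k" by simp_all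
  moreover have "\<exists>j. cyclic_rc d n g = swap_at n j (cyclic_rc d n f)"
    using assms(3) cyclic_rc_swap_at[OF assms(4)] unfolding kmove_def by metis
  ultimately show ?thesis using assms(3) unfolding kmove_def descent_cyclic_rc[OF assms(1)] descent_cyclic_rc[OF assms(2)]
    by metis
qed


section \<open>Positions and recording tableaux\<close>

lemma positions_reverse_complement:
  assumes "1 \<le> a" "a \<le> d" "\<forall>x \<in> set v. x \<in> {1..d}"
  shows "positions a (reverse_complement d v) = reverse_complement (length v) (positions (d + 1 - a) v)"
proof (rule sorted_distinct_set_unique)
  let ?n = "length v"
  have length_rc: "length (reverse_complement d v) = ?n" by (simp add: reverse_complement_def)
  have mem: "set (positions b w) = {x \<in> {1..length w}. w ! (x - 1) = b}" for b w
    by (auto simp: positions_def simp del: upt_Suc)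
  have sp: "sorted (positions b w)" "distinct (positions b w)" for b w
    by (simp_all add: positions_def sorted_wrt_filter del: upt_Suc)
  show "sorted (positions a (reverse_complement d v))" "distinct (positions a (reverse_complement d v))"
    by (rule sp)+
  show "sorted (reverse_complement ?n (positions (d + 1 - a) v))"
    by (rule sorted_reverse_complement[OF sp(1)])
  have "inj_on (\<lambda>x. ?n + 1 - x) (set (positions (d + 1 - a) v))"
    by (auto simp: mem inj_on_def)
  then show "distinct (reverse_complement ?n (positions (d + 1 - a) v))"
    using sp(2) by (simp add: reverse_complement_def distinct_map)
  have nth: "reverse_complement d v ! (x - 1) = d + 1 - v ! (?n - x)" if "x \<in> {1..?n}" for x
  proof -
    have x: "x - 1 < ?n" "?n - Suc (x - 1) = ?n - x" using that by auto
    have "reverse_complement d v ! (x - 1) = d + 1 - v ! (?n - Suc (x - 1))"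
      using x(1) by (simp add: reverse_complement_def rev_nth)
    then show ?thesis unfolding x(2) .
  qed
  have eq: "d + 1 - v ! (?n - x) = a \<longleftrightarrow> v ! (?n - x) = d + 1 - a" if "x \<in> {1..?n}" for x
  proof -
    have "v ! (?n - x) \<in> {1..d}" using that assms(3) by auto
    then show ?thesis using assms(1,2) by auto
  qed
  show "set (positions a (reverse_complement d v)) = set (reverse_complement ?n (positions (d + 1 - a) v))"
    (is "?A = ?B")
  proof
    show "?A \<subseteq> ?B"
    proof
      fix x assume "x \<in> ?A"
      then have x1: "x \<in> {1..?n}" and xa: "reverse_complement d v ! (x - 1) = a"
        unfolding mem by (simp_all add: length_rc)
      then have x: "x \<in> {1..?n}" "v ! (?n - x) = d + 1 - a" using nth[OF x1] eq[OF x1] by simp_all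
      then have "?n + 1 - x \<in> set (positions (d + 1 - a) v)" by (auto simp: mem)
      moreover have "x = ?n + 1 - (?n + 1 - x)" using x by auto
      ultimately show "x \<in> ?B" by (auto simp: reverse_complement_def)
    qed
    show "?B \<subseteq> ?A"
    proof
      fix x assume "x \<in> ?B"
      then obtain y where y: "y \<in> {1..?n}" "v ! (y - 1) = d + 1 - a" "x = ?n + 1 - y"
        by (auto simp: reverse_complement_def mem)
      then have x: "x \<in> {1..?n}" "?n - x = y - 1" by auto
      then have "reverse_complement d v ! (x - 1) = a" using nth[OF x(1)] eq[OF x(1)] y(2) by simp
      then show "x \<in> ?A" using x(1) unfolding mem by (simp add: length_rc)
    qed
  qed
qed

lemma position_word_reverse_complement:
  assumes "\<forall>x \<in> set v. x \<in> {1..d}"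
  shows "position_word d (reverse_complement d v) = reverse_complement (length v) (position_word d v)"
proof -
  let ?n = "length v"
  have "map (\<lambda>a. positions a (reverse_complement d v)) [1..<Suc d]
      = map (\<lambda>a. reverse_complement ?n (positions (d + 1 - a) v)) [1..<Suc d]"
    using positions_reverse_complement[OF _ _ assms] by (intro map_cong refl) auto
  also have "\<dots> = rev (map (\<lambda>a. reverse_complement ?n (positions a v)) [1..<Suc d])"
    by (rule nth_equalityI) (auto simp: rev_nth nth_append Suc_diff_Suc simp del: upt_Suc)
  finally have *: "map (\<lambda>a. positions a (reverse_complement d v)) [1..<Suc d]
      = rev (map (\<lambda>a. reverse_complement ?n (positions a v)) [1..<Suc d])" .
  have "reverse_complement ?n (concat xs) = concat (rev (map (reverse_complement ?n) xs))" for xs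
    by (induction xs) (simp_all add: reverse_complement_append reverse_complement_def)
  then show ?thesis unfolding position_word_def * by (simp add: comp_def del: upt_Suc)
qed

section \<open>Tabloids as cyclic words\<close>

lemma residue_range: "0 < n \<Longrightarrow> residue n k \<in> {1..n}"
  unfolding residue_def by (auto simp: nat_le_iff Suc_le_eq zless_nat_eq_int_zless add_strict_mono)
    (metis add.commute add1_zle_eq of_nat_0_less_iff pos_mod_bound)

lemma residue_nat [simp]: "x \<in> {1..n} \<Longrightarrow> residue n (int x) = x"
  by (auto simp: residue_def)

lemma residue_eq_iff: "0 < n \<Longrightarrow> residue n k = residue n l \<longleftrightarrow> int n dvd k - l"
  using dvd_diff_commute[of "int n" k l] by (simp add: residue_def nat_eq_iff2 mod_eq_dvd_iff)

lemma int_residue: "0 < n \<Longrightarrow> int n dvd int (residue n k) - k"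
  using residue_eq_iff[of n "int (residue n k)" k] residue_nat[OF residue_range[of n k]] by simp

lemma next_class_residue: "0 < n \<Longrightarrow> next_class n (residue n k) = residue n (k + 1)"
  unfolding next_class_def using int_residue[of n k] by (subst residue_eq_iff) simp_all

text \<open>The entry \<open>x\<close> of the tabloid is found at index \<open>x - 1\<close>, so that \<open>window n 0\<close> covers the entries
  \<open>1, \<dots>, n\<close>. Rows are counted from the bottom, as in the top row of \<open>tabloid_array\<close>.\<close>

definition label :: "nat \<Rightarrow> tabloid \<Rightarrow> int \<Rightarrow> nat" where
  "label n T k = length T - row_of T (residue n (k + 1))"

definition tabloid_of :: "nat \<Rightarrow> nat \<Rightarrow> (int \<Rightarrow> nat) \<Rightarrow> tabloid" where
  "tabloid_of n d f = map (\<lambda>r. {x \<in> {1..n}. f (int x - 1) = d - r}) [0..<d]"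

definition content :: "nat list \<Rightarrow> nat \<Rightarrow> nat" where
  "content \<mu> a = (if 1 \<le> a \<and> a \<le> length \<mu> then \<mu> ! (length \<mu> - a) else 0)"

definition longest_word :: "nat \<Rightarrow> nat list" where
  "longest_word d = (SOME is. set is \<subseteq> {1..<d} \<and> simple_product is = longest_perm d)"

lemma longest_word: "set (longest_word d) \<subseteq> {1..<d}" "simple_product (longest_word d) = longest_perm d"
proof -
  have "\<exists>is. set is \<subseteq> {1..<d} \<and> simple_product is = longest_perm d"
    using longest_perm_product by metis
  from someI_ex[OF this]
  show "set (longest_word d) \<subseteq> {1..<d}" "simple_product (longest_word d) = longest_perm d"
    by (simp_all add: longest_word_def)
qed

text \<open>The reverse complement reverses the content, and the reflections for the longest permutation
  restore it.\<close>

definition evac_word :: "nat \<Rightarrow> nat \<Rightarrow> (int \<Rightarrow> nat) \<Rightarrow> int \<Rightarrow> nat" where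
  "evac_word d n f = foldr reflect (longest_word d) (cyclic_rc d n f)"

lemma count_reverse_complement:
  assumes "\<forall>x \<in> set w. x \<in> {1..d}"
  shows "count_list (reverse_complement d w) a = (if a \<in> {1..d} then count_list w (d + 1 - a) else 0)"
  using assms
proof (induction w)
  case (Cons x w)
  have "reverse_complement d (x # w) = reverse_complement d w @ [d + 1 - x]"
    by (simp add: reverse_complement_def)
  then show ?case using Cons by auto
qed (simp add: reverse_complement_def)

lemma length_rrss_rows: "length (rrss_rows n ms k) = length ms"
  by (induction ms arbitrary: k) auto

lemma nth_rrss_rows:
  "r < length ms \<Longrightarrow> rrss_rows n ms k ! r =
    residue n ` {k - int (sum_list (take (Suc r) ms)) + 1..k - int (sum_list (take r ms))}"
proof (induction ms arbitrary: k r)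
  case (Cons m ms)
  then show ?case
  proof (cases r)
    case (Suc r')
    then show ?thesis using Cons.IH[of r' "k - int m"] Cons.prems by (simp add: diff_diff_eq)
  qed simp
qed simp

lemma sum_list_take_mono: "i \<le> j \<Longrightarrow> sum_list (take i ms) \<le> sum_list (take j (ms :: nat list))"
proof (induction ms arbitrary: i j)
  case (Cons m ms)
  then show ?case by (cases i; cases j) auto
qed simp

lemma row_containing:
  "s < sum_list ms \<Longrightarrow> \<exists>r < length ms. sum_list (take r ms) \<le> s \<and> s < sum_list (take (Suc r) (ms :: nat list))"
proof (induction ms arbitrary: s)
  case (Cons m ms)
  show ?case
  proof (cases "s < m")
    case True
    then show ?thesis by (intro exI[of _ 0]) simp
  next
    case False
    then have "s - m < sum_list ms" using Cons.prems by simp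
    then obtain r where "r < length ms" "sum_list (take r ms) \<le> s - m" "s - m < sum_list (take (Suc r) ms)"
      using Cons.IH[of "s - m"] by blast
    then show ?thesis using False by (intro exI[of _ "Suc r"]) auto
  qed
qed simp

context
  fixes \<mu> :: "nat list" and n d :: nat
  assumes n_def: "n = sum_list \<mu>" and d_def: "d = length \<mu>" and n: "0 < n"
begin

lemma row_of_tabloid:
  assumes T: "T \<in> tabloids \<mu>" and x: "x \<in> {1..n}"
  shows "row_of T x < d" "r < d \<Longrightarrow> row_of T x = r \<longleftrightarrow> x \<in> T ! r"
proof -
  have len: "length T = d" and disj: "\<And>r s. r < d \<Longrightarrow> s < d \<Longrightarrow> r \<noteq> s \<Longrightarrow> T ! r \<inter> T ! s = {}"
    and un: "\<Union> (set T) = {1..n}" using T by (auto simp: tabloids_def n_def d_def)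
  have "x \<in> \<Union> (set T)" using x un by simp
  then obtain r0 where r0: "r0 < d" "x \<in> T ! r0" using len by (auto simp: in_set_conv_nth)
  have "row_of T x = r0"
    unfolding row_of_def using r0 len disj by (intro the_equality) auto
  then show "row_of T x < d" "r < d \<Longrightarrow> row_of T x = r \<longleftrightarrow> x \<in> T ! r" using r0 disj by auto
qed

lemma length_tabloid: "T \<in> tabloids \<mu> \<Longrightarrow> length T = d"
  by (simp add: tabloids_def d_def)

lemma label_nat: "T \<in> tabloids \<mu> \<Longrightarrow> x \<in> {1..n} \<Longrightarrow> label n T (int x - 1) = d - row_of T x"
  by (simp add: label_def length_tabloid)

lemma label_eq_iff:
  assumes "T \<in> tabloids \<mu>" "x \<in> {1..n}" "r < d"
  shows "label n T (int x - 1) = d - r \<longleftrightarrow> x \<in> T ! r"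
proof -
  have "d - row_of T x = d - r \<longleftrightarrow> row_of T x = r"
    using row_of_tabloid(1)[OF assms(1,2)] assms(3) by auto
  then show ?thesis using row_of_tabloid(2)[OF assms] label_nat[OF assms(1,2)] by simp
qed

lemma label_range: "T \<in> tabloids \<mu> \<Longrightarrow> label n T k \<in> {1..d}"
  using row_of_tabloid(1)[of T "residue n (k + 1)"] residue_range[OF n, of "k + 1"]
  by (auto simp: label_def length_tabloid)

lemma periodic_label: "periodic n (label n T)"
proof -
  have "residue n (k + int n + 1) = residue n (k + 1)" for k by (subst residue_eq_iff[OF n]) simp
  then show ?thesis by (simp add: periodic_def label_def)
qed

lemma tabloid_of_label: "T \<in> tabloids \<mu> \<Longrightarrow> tabloid_of n d (label n T) = T"
proof (rule nth_equalityI)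
  fix r assume T: "T \<in> tabloids \<mu>" and "r < length (tabloid_of n d (label n T))"
  then have r: "r < d" by (simp add: tabloid_of_def)
  then have "T ! r \<subseteq> {1..n}" using T length_tabloid[OF T] by (auto simp: tabloids_def n_def)
  then show "tabloid_of n d (label n T) ! r = T ! r"
    using r label_eq_iff[OF T _ r] by (auto simp: tabloid_of_def)
qed (simp add: tabloid_of_def length_tabloid)

lemma count_window: "count_list (window n 0 f) a = card {x \<in> {1..n}. f (int x - 1) = a}"
proof -
  have "{x \<in> {1..n}. f (int x - 1) = a} = Suc ` {i \<in> {0..<n}. f (int i) = a}"
    by (auto simp: image_iff Bex_def) (metis Suc_le_D Suc_le_lessD add_diff_cancel_left' of_nat_Suc)
  then have "card {x \<in> {1..n}. f (int x - 1) = a} = card {i \<in> {0..<n}. f (int i) = a}"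
    by (simp add: card_image)
  also have "\<dots> = length (filter (\<lambda>i. f (int i) = a) [0..<n])"
    by (subst distinct_card[symmetric]) (auto intro!: arg_cong[where f = card])
  also have "\<dots> = count_list (window n 0 f) a"
    by (simp add: window_def count_list_eq_length_filter filter_map comp_def eq_commute[of a])
  finally show ?thesis by simp
qed

lemma has_content_label:
  assumes T: "T \<in> tabloids \<mu>" shows "has_content n (content \<mu>) (label n T)"
  unfolding has_content_def
proof (intro conjI allI periodic_label)
  fix a
  show "count_list (window n 0 (label n T)) a = content \<mu> a"
  proof (cases "1 \<le> a \<and> a \<le> d")
    case True
    define r where "r = d - a"
    have r: "r < d" "d - r = a" using True by (auto simp: r_def)
    have "{x \<in> {1..n}. label n T (int x - 1) = a} = T ! r"
    proof -
      have "T ! r \<subseteq> {1..n}" using T r length_tabloid[OF T] by (auto simp: tabloids_def n_def)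
      then show ?thesis using label_eq_iff[OF T _ r(1)] r(2) by auto
    qed
    then show ?thesis using T r True by (simp add: count_window content_def tabloids_def d_def r_def)
  next
    case False
    then have eq: "{x \<in> {1..n}. label n T (int x - 1) = a} = {}" using label_range[OF T] by auto
    show ?thesis unfolding count_window eq using False by (auto simp: content_def d_def)
  qed
qed

lemma content_range: "has_content n (content \<mu>) f \<Longrightarrow> f k \<in> {1..d}"
proof -
  assume f: "has_content n (content \<mu>) f"
  have per: "periodic n f" using f by (simp add: has_content_def)
  have "f k = window n k f ! 0" using n by simp
  also have "\<dots> \<in> set (window n k f)" using n by (intro nth_mem) simp
  finally have "count_list (window n k f) (f k) \<noteq> 0" by (simp add: count_list_0_iff)
  then have "content \<mu> (f k) \<noteq> 0" using has_content_window[OF f] by simp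
  then show ?thesis by (auto simp: content_def d_def split: if_splits)
qed

lemma tabloid_of_content:
  assumes f: "has_content n (content \<mu>) f"
  shows "tabloid_of n d f \<in> tabloids \<mu>" "label n (tabloid_of n d f) = f"
proof -
  let ?T = "tabloid_of n d f"
  have row: "?T ! r = {x \<in> {1..n}. f (int x - 1) = d - r}" if "r < d" for r using that by (simp add: tabloid_of_def)
  have "card (?T ! r) = \<mu> ! r" if r: "r < d" for r
  proof -
    have "card (?T ! r) = count_list (window n 0 f) (d - r)" unfolding row[OF r] count_window ..
    also have "\<dots> = content \<mu> (d - r)" using f by (simp add: has_content_def)
    finally have "card (?T ! r) = content \<mu> (d - r)" .
    then show ?thesis using r by (auto simp: content_def d_def)
  qed
  moreover have "?T ! r \<inter> ?T ! s = {}" if "r < d" "s < d" "r \<noteq> s" for r s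
    using that by (auto simp: row)
  moreover have "\<Union> (set ?T) = {1..n}"
  proof
    show "{1..n} \<subseteq> \<Union> (set ?T)"
    proof
      fix x assume x: "x \<in> {1..n}"
      have "f (int x - 1) \<in> {1..d}" using content_range[OF f] .
      then have "d - f (int x - 1) < d" "d - (d - f (int x - 1)) = f (int x - 1)" by auto
      then show "x \<in> \<Union> (set ?T)" using x by (auto simp: tabloid_of_def intro!: bexI[of _ "d - f (int x - 1)"])
    qed
  qed (auto simp: tabloid_of_def)
  ultimately show T: "?T \<in> tabloids \<mu>"
    by (simp add: tabloids_def n_def[symmetric] d_def[symmetric]) (simp add: tabloid_of_def)
  show "label n ?T = f"
  proof
    fix k
    let ?x = "residue n (k + 1)"
    have x: "?x \<in> {1..n}" using residue_range[OF n] .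
    have dvd: "int n dvd (int ?x - 1) - k" using int_residue[OF n, of "k + 1"] by (simp add: algebra_simps)
    have fx: "f (int ?x - 1) = f k"
      using periodic_dvd[OF _ dvd] f by (simp add: has_content_def)
    have "f k \<in> {1..d}" using content_range[OF f] .
    then have r: "d - f k < d" "d - (d - f k) = f k" by auto
    have "?x \<in> ?T ! (d - f k)" using row[OF r(1)] x fx r(2) by simp
    then have "row_of ?T ?x = d - f k" using row_of_tabloid(2)[OF T x r(1)] by simp
    then show "label n ?T k = f k" using r(2) length_tabloid[OF T] by (simp add: label_def)
  qed
qed

lemma Des_iff_descent:
  assumes T: "T \<in> tabloids \<mu>"
  shows "residue n k \<in> Des n T \<longleftrightarrow> descent (label n T) (k - 1)"
proof -
  have rows: "row_of T (residue n k) < d" "row_of T (residue n (k + 1)) < d"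
    using row_of_tabloid(1)[OF T] residue_range[OF n] by auto
  have "residue n k \<in> Des n T \<longleftrightarrow> row_of T (residue n k) < row_of T (residue n (k + 1))"
    using residue_range[OF n] by (simp add: Des_def next_class_residue[OF n])
  also have "\<dots> \<longleftrightarrow> descent (label n T) (k - 1)"
    using rows by (auto simp: descent_def label_def length_tabloid[OF T])
  finally show ?thesis .
qed

lemma exchange_tabloid:
  assumes T: "T \<in> tabloids \<mu>" and i: "i \<in> {1..n}"
  shows "exchange n i T \<in> tabloids \<mu>" "label n (exchange n i T) = swap_at n (int i - 1) (label n T)"
proof -
  let ?t = "transpose i (next_class n i)"
  have nx: "next_class n i \<in> {1..n}" unfolding next_class_def by (rule residue_range[OF n])
  have len: "length T = d" by (rule length_tabloid[OF T])
  have nth: "exchange n i T ! r = ?t ` (T ! r)" if "r < d" for r using that len by (simp add: exchange_def)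
  have inj: "inj ?t" by simp
  have img: "?t ` {1..n} = {1..n}" using i nx by (simp add: transpose_image_eq)
  have "\<Union> (set (exchange n i T)) = ?t ` \<Union> (set T)" by (auto simp: exchange_def)
  then have "\<Union> (set (exchange n i T)) = {1..n}" using T img by (simp add: tabloids_def n_def)
  moreover have "card (exchange n i T ! r) = \<mu> ! r" if "r < d" for r
    using that T by (simp add: nth card_image tabloids_def d_def)
  moreover have "exchange n i T ! r \<inter> exchange n i T ! s = {}" if "r < d" "s < d" "r \<noteq> s" for r s
    using that T by (simp add: nth image_Int[OF inj, symmetric] tabloids_def d_def)
  ultimately show E: "exchange n i T \<in> tabloids \<mu>"
    by (simp add: tabloids_def n_def[symmetric] d_def[symmetric]) (simp add: exchange_def len)
  have row: "row_of (exchange n i T) x = row_of T (?t x)" if x: "x \<in> {1..n}" for x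
  proof -
    have tx: "?t x \<in> {1..n}" using x img by blast
    have r: "row_of T (?t x) < d" by (rule row_of_tabloid(1)[OF T tx])
    have "?t x \<in> T ! row_of T (?t x)" using row_of_tabloid(2)[OF T tx r] by simp
    then have "?t (?t x) \<in> exchange n i T ! row_of T (?t x)" unfolding nth[OF r] by (rule imageI)
    then show ?thesis using row_of_tabloid(2)[OF E x r] by simp
  qed
  show "label n (exchange n i T) = swap_at n (int i - 1) (label n T)"
  proof
    fix k
    let ?x = "residue n (k + 1)"
    have i_eq: "i = residue n (int i)" using i by simp
    have xi: "?x = i \<longleftrightarrow> int n dvd k - (int i - 1)"
      using residue_eq_iff[OF n, of "k + 1" "int i"] i_eq by (simp add: algebra_simps)
    have xni: "?x = next_class n i \<longleftrightarrow> int n dvd k - (int i - 1) - 1"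
      unfolding next_class_def using residue_eq_iff[OF n, of "k + 1" "int i + 1"] by (simp add: algebra_simps)
    have label: "label n (exchange n i T) k = d - row_of T (?t ?x)"
      using row[OF residue_range[OF n]] length_tabloid[OF E] by (simp add: label_def)
    have lab: "label n T m = d - row_of T (residue n (m + 1))" for m by (simp add: label_def len)
    consider "?x = i" | "?x \<noteq> i" "?x = next_class n i" | "?x \<noteq> i" "?x \<noteq> next_class n i" by blast
    then show "label n (exchange n i T) k = swap_at n (int i - 1) (label n T) k"
    proof cases
      case 1
      then have "?t ?x = residue n (k + 1 + 1)" using next_class_residue[OF n, of "k + 1"] by simp
      then show ?thesis using 1 xi by (simp add: label lab swap_at_def)
    next
      case 2
      then have "int n dvd k - (int i - 1) - 1" using xni by simp
      then have "residue n k = residue n (int i)" by (subst residue_eq_iff[OF n]) (simp add: algebra_simps)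
      then have t: "?t ?x = residue n (k - 1 + 1)" using 2 i_eq by simp
      have "swap_at n (int i - 1) (label n T) k = label n T (k - 1)"
        using 2 xi xni by (simp only: swap_at_def if_True if_False simp_thms)
      then show ?thesis unfolding label t lab ..
    next
      case 3
      then show ?thesis using xi xni by (simp add: label lab swap_at_def)
    qed
  qed
qed

lemma knuth_move_of_type_iff:
  "knuth_move_of_type \<mu> (residue n k) T T' \<longleftrightarrow>
    T \<in> tabloids \<mu> \<and> T' \<in> tabloids \<mu> \<and> kmove n (k - 1) (label n T) (label n T')"
proof (cases "T \<in> tabloids \<mu> \<and> T' \<in> tabloids \<mu>")
  case True
  then have T: "T \<in> tabloids \<mu>" "T' \<in> tabloids \<mu>" by auto
  have e: "k + 1 - 1 = k - 1 + 1" by simp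
  note D = Des_iff_descent[OF T(1), of k] Des_iff_descent[OF T(2), of k]
    Des_iff_descent[OF T(1), of "k + 1", unfolded e] Des_iff_descent[OF T(2), of "k + 1", unfolded e]
  have ex: "(\<exists>i \<in> {1..n}. T' = exchange n i T) \<longleftrightarrow> (\<exists>j. label n T' = swap_at n j (label n T))"
  proof
    assume "\<exists>i \<in> {1..n}. T' = exchange n i T"
    then show "\<exists>j. label n T' = swap_at n j (label n T)" using exchange_tabloid(2)[OF T(1)] by blast
  next
    assume "\<exists>j. label n T' = swap_at n j (label n T)"
    then obtain j where j: "label n T' = swap_at n j (label n T)" by blast
    let ?i = "residue n (j + 1)"
    have i: "?i \<in> {1..n}" using residue_range[OF n] .
    have "int n dvd (int ?i - 1) - j" using int_residue[OF n, of "j + 1"] by (simp add: algebra_simps)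
    then have "label n (exchange n ?i T) = label n T'"
      using exchange_tabloid(2)[OF T(1) i] swap_at_cong j by metis
    then have "exchange n ?i T = T'"
      using tabloid_of_label[OF exchange_tabloid(1)[OF T(1) i]] tabloid_of_label[OF T(2)] by metis
    then show "\<exists>i \<in> {1..n}. T' = exchange n i T" using i by blast
  qed
  show ?thesis
    unfolding knuth_move_of_type_def knuth_move_def Let_def n_def[symmetric]
    using T ex D unfolding next_class_residue[OF n] kmove_def by auto
qed (auto simp: knuth_move_of_type_def knuth_move_def Let_def)

text \<open>An exchange at \<open>j\<close> reverses the comparison at \<open>j\<close>, and affects the descents at \<open>j - 1\<close>, \<open>j\<close> and
  \<open>j + 1\<close> only. As the descent sets are incomparable, a descent at \<open>j - 1\<close> or \<open>j + 1\<close> changes in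
  the direction opposite to that at \<open>j\<close>.\<close>

lemma knuth_move_has_type:
  assumes "knuth_move \<mu> T T'"
  shows "\<exists>k. knuth_move_of_type \<mu> (residue n k) T T'"
proof -
  have T: "T \<in> tabloids \<mu>" "T' \<in> tabloids \<mu>" and "\<exists>i \<in> {1..n}. T' = exchange n i T"
    and "\<not> Des n T \<subseteq> Des n T'" "\<not> Des n T' \<subseteq> Des n T"
    using assms by (auto simp: knuth_move_def Let_def n_def)
  then obtain i where i: "i \<in> {1..n}" "T' = exchange n i T" by blast
  define f g j where "f = label n T" and "g = label n T'" and "j = int i - 1"
  have g: "g = swap_at n j f" using exchange_tabloid(2)[OF T(1) i(1)] i(2) by (simp add: f_def g_def j_def)
  have per: "periodic n f" "periodic n g" using periodic_label by (simp_all add: f_def g_def)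
  obtain x where x: "x \<in> Des n T" "x \<notin> Des n T'" using \<open>\<not> Des n T \<subseteq> Des n T'\<close> by blast
  obtain y where y: "y \<in> Des n T'" "y \<notin> Des n T" using \<open>\<not> Des n T' \<subseteq> Des n T\<close> by blast
  have xy: "x \<in> {1..n}" "y \<in> {1..n}" using x y by (auto simp: Des_def)
  have dx: "descent f (int x - 1)" "\<not> descent g (int x - 1)"
    using x Des_iff_descent[OF T(1), of "int x"] Des_iff_descent[OF T(2), of "int x"] xy by (simp_all add: f_def g_def)
  have dy: "descent g (int y - 1)" "\<not> descent f (int y - 1)"
    using y Des_iff_descent[OF T(1), of "int y"] Des_iff_descent[OF T(2), of "int y"] xy by (simp_all add: f_def g_def)
  have dper: "descent f k = descent f l \<and> descent g k = descent g l" if "int n dvd k - l" for k l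
    using periodic_dvd[OF per(1) that] periodic_dvd[OF per(2) that]
      periodic_dvd[OF per(1), of "k + 1" "l + 1"] periodic_dvd[OF per(2), of "k + 1" "l + 1"] that
    by (simp add: descent_def)
  have near: "int n dvd k - (j - 1) \<or> int n dvd k - j \<or> int n dvd k - (j + 1)"
    if "descent f k \<noteq> descent g k" for k
  proof (rule ccontr)
    assume *: "\<not> ?thesis"
    have e: "k - (j + 1) = k - j - 1" "k + 1 - j = k - (j - 1)" "k + 1 - j - 1 = k - j" by simp_all
    have "g k = f k" "g (k + 1) = f (k + 1)"
      using * unfolding g swap_at_def e by auto
    then show False using that by (simp add: descent_def)
  qed
  have "n \<noteq> 1"
  proof
    assume "n = 1"
    then have "f (int x - 1 + 1) = f (int x - 1)" using periodicD[OF per(1), of "int x - 1"] by simp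
    then show False using dx(1) by (simp add: descent_def)
  qed
  then have n2: "2 \<le> n" using n by simp
  have gj: "g j = f (j + 1)" "g (j + 1) = f j"
    using dvd_shift(2)[OF n2, of j j] by (simp_all add: g swap_at_def)
  have ne: "f j \<noteq> f (j + 1)"
  proof
    assume eq: "f j = f (j + 1)"
    have "g = f"
    proof
      fix k
      show "g k = f k"
        using eq periodic_dvd[OF per(1), of k j] periodic_dvd[OF per(1), of "k + 1" "j + 1"]
          periodic_dvd[OF per(1), of k "j + 1"] periodic_dvd[OF per(1), of "k - 1" j]
        by (auto simp: g swap_at_def algebra_simps)
    qed
    then show False using dx by simp
  qed
  have kmove: "kmove n k f g" if "descent f k \<noteq> descent g k" "descent f (k + 1) \<noteq> descent g (k + 1)"
    "descent f k \<noteq> descent f (k + 1)" for k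
    using that g unfolding kmove_def by blast
  have jj: "descent f j \<noteq> descent g j" using gj ne by (auto simp: descent_def)
  have "\<exists>k. kmove n k f g"
  proof -
    have "\<exists>z. descent f z \<noteq> descent g z \<and> descent f z \<noteq> descent f j"
      using dx dy by (cases "descent f j") blast+
    then obtain z where z: "descent f z \<noteq> descent g z" "descent f z \<noteq> descent f j" by blast
    have "\<not> int n dvd z - j" using z(2) dper by blast
    then consider "int n dvd z - (j - 1)" | "int n dvd z - (j + 1)" using near[OF z(1)] by blast
    then show ?thesis
    proof cases
      case 1
      then have "kmove n (j - 1) f g" using dper[OF 1] z jj by (intro kmove) auto
      then show ?thesis by blast
    next
      case 2
      then have "kmove n j f g" using dper[OF 2] z jj by (intro kmove) auto
      then show ?thesis by blast
    qed
  qed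
  then obtain k where "kmove n k f g" by blast
  then have "knuth_move_of_type \<mu> (residue n (k + 1)) T T'"
    unfolding knuth_move_of_type_iff using T by (simp add: f_def g_def)
  then show ?thesis by blast
qed


section \<open>Affine evacuation\<close>

text \<open>Going back from \<open>k\<close>, one meets the entries of the rows from top to bottom; hence the rows, counted
  from the bottom, increase weakly from \<open>k + 1\<close> to \<open>k + n\<close>.\<close>

lemma RRSS_tabloid:
  "RRSS \<mu> k \<in> tabloids \<mu>" "sorted (window n k (label n (RRSS \<mu> k)))"
proof -
  let ?T = "RRSS \<mu> k"
  define pos where "pos s = residue n (k - int s)" for s
  define S where "S r = sum_list (take r \<mu>)" for r
  have S: "S 0 = 0" "S d = n" "\<And>r. r < d \<Longrightarrow> S (Suc r) = S r + \<mu> ! r"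
    "\<And>r r'. r \<le> r' \<Longrightarrow> S r \<le> S r'"
    using sum_list_take_mono by (auto simp: S_def d_def n_def take_Suc_conv_app_nth)
  have inj: "inj_on pos {0..<n}"
  proof
    fix s t assume st: "s \<in> {0..<n}" "t \<in> {0..<n}" "pos s = pos t"
    then have "int n dvd int t - int s" using residue_eq_iff[OF n, of "k - int s" "k - int t"] by (simp add: pos_def)
    moreover have "\<bar>int t - int s\<bar> < int n" using st by auto
    ultimately have "int t - int s = 0" using dvd_imp_le_int by (metis abs_of_nat not_less)
    then show "s = t" by simp
  qed
  have "pos ` {0..<n} \<subseteq> {1..n}" using residue_range[OF n] by (auto simp: pos_def simp del: atLeastAtMost_iff)
  moreover have "card (pos ` {0..<n}) = card {1..n}" using inj by (simp add: card_image)
  ultimately have surj: "pos ` {0..<n} = {1..n}" by (intro card_subset_eq) simp_all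
  have nth: "?T ! r = pos ` {S r..<S (Suc r)}" if r: "r < d" for r
  proof -
    have "{k - int (S (Suc r)) + 1..k - int (S r)} = (\<lambda>s. k - int s) ` {S r..<S (Suc r)}"
    proof (intro equalityI subsetI)
      fix x assume "x \<in> {k - int (S (Suc r)) + 1..k - int (S r)}"
      then have "x = k - int (nat (k - x))" "nat (k - x) \<in> {S r..<S (Suc r)}" by auto
      then show "x \<in> (\<lambda>s. k - int s) ` {S r..<S (Suc r)}" by blast
    qed auto
    then show ?thesis
      using nth_rrss_rows[of r \<mu> n k] r
      by (simp add: RRSS_def n_def[symmetric] d_def[symmetric] S_def[symmetric] image_image pos_def)
  qed
  have sub: "{S r..<S (Suc r)} \<subseteq> {0..<n}" if "r < d" for r using S(2) S(4)[of "Suc r" d] that by auto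
  have len: "length ?T = d" by (simp add: RRSS_def length_rrss_rows d_def)
  have "card (?T ! r) = \<mu> ! r" if "r < d" for r
    using card_image[OF inj_on_subset[OF inj sub[OF that]]] nth[OF that] S(3)[OF that] by simp
  moreover have "?T ! r \<inter> ?T ! r' = {}" if "r < d" "r' < d" "r \<noteq> r'" for r r'
  proof -
    have disjoint: "{S r..<S (Suc r)} \<inter> {S r'..<S (Suc r')} = {}"
      using S(4)[of "Suc r" r'] S(4)[of "Suc r'" r] that(3) by (cases "r < r'") auto
    show ?thesis
      unfolding nth[OF that(1)] nth[OF that(2)]
        inj_on_image_Int[OF inj sub[OF that(1)] sub[OF that(2)], symmetric] disjoint by simp
  qed
  moreover have "\<Union> (set ?T) = {1..n}"
  proof
    show "{1..n} \<subseteq> \<Union> (set ?T)"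
    proof
      fix x assume "x \<in> {1..n}"
      then obtain s where s: "s < n" "x = pos s" using surj by fastforce
      then obtain r where r: "r < d" "S r \<le> s" "s < S (Suc r)"
        using row_containing[of s \<mu>] by (auto simp: S_def d_def n_def)
      then have "x \<in> ?T ! r" using nth s(2) by auto
      then show "x \<in> \<Union> (set ?T)" using r(1) len by (metis UnionI nth_mem)
    qed
    show "\<Union> (set ?T) \<subseteq> {1..n}"
    proof
      fix x assume "x \<in> \<Union> (set ?T)"
      then obtain r where "r < d" "x \<in> ?T ! r" using len by (auto simp: in_set_conv_nth)
      then show "x \<in> {1..n}" using nth sub surj by blast
    qed
  qed
  ultimately show T: "?T \<in> tabloids \<mu>"
    using len by (simp add: tabloids_def n_def[symmetric] d_def[symmetric])
  have row: "\<exists>r < d. S r \<le> s \<and> s < S (Suc r) \<and> label n ?T (k - 1 - int s) = d - r" if s: "s < n" for s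
  proof -
    obtain r where r: "r < d" "S r \<le> s" "s < S (Suc r)"
      using row_containing[of s \<mu>] s by (auto simp: S_def d_def n_def)
    have "pos s \<in> {1..n}" using surj s by auto
    moreover have "pos s \<in> ?T ! r" using nth[OF r(1)] r by auto
    ultimately have "row_of ?T (pos s) = r" using row_of_tabloid(2)[OF T _ r(1)] by simp
    moreover have "k - 1 - int s + 1 = k - int s" by simp
    ultimately have "label n ?T (k - 1 - int s) = d - r" by (simp add: label_def len pos_def)
    then show ?thesis using r by blast
  qed
  have "sorted (window n (k - int n) (label n ?T))"
    unfolding sorted_iff_nth_mono
  proof (intro allI impI)
    fix i j assume ij: "i \<le> j" "j < length (window n (k - int n) (label n ?T))"
    define s t where "s = n - Suc i" and "t = n - Suc j"
    have st: "s < n" "t < n" "t \<le> s" using ij n by (auto simp: s_def t_def)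
    have e: "k - int n + int i = k - 1 - int s" "k - int n + int j = k - 1 - int t"
      using ij by (auto simp: s_def t_def)
    obtain r r' where r: "S r \<le> s" "s < S (Suc r)" "label n ?T (k - 1 - int s) = d - r"
      and r': "S r' \<le> t" "t < S (Suc r')" "label n ?T (k - 1 - int t) = d - r'"
      using row[OF st(1)] row[OF st(2)] by blast
    have "r' \<le> r"
    proof (rule ccontr)
      assume "\<not> r' \<le> r"
      then have "S (Suc r) \<le> S r'" by (intro S(4)) simp
      then show False using r r' st(3) by simp
    qed
    then show "window n (k - int n) (label n ?T) ! i \<le> window n (k - int n) (label n ?T) ! j"
    proof -
      have "i < n" "j < n" using ij by simp_all
      then show ?thesis using \<open>r' \<le> r\<close> unfolding nth_window[OF \<open>i < n\<close>] nth_window[OF \<open>j < n\<close>] e r(3) r'(3) by simp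
    qed
  qed
  then show "sorted (window n k (label n ?T))"
    using window_add_period[OF periodic_label, of "k - int n" ?T] by simp
qed

lemma RRSS_eqI:
  assumes "has_content n (content \<mu>) f" "sorted (window n k f)"
  shows "label n (RRSS \<mu> k) = f"
  using sorted_unique[OF n has_content_label[OF RRSS_tabloid(1)] assms(1) RRSS_tabloid(2) assms(2)] .

lemma evac_word:
  assumes f: "has_content n (content \<mu>) f"
  shows "has_content n (content \<mu>) (evac_word d n f)"
    and "kmove n k f g \<Longrightarrow> kmove n (int n - 3 - k) (evac_word d n f) (evac_word d n g)"
    and "sorted (window n p f) \<Longrightarrow> sorted (window n (- p) (evac_word d n f))"
proof -
  have per: "periodic n f" using f by (simp add: has_content_def)
  let ?g = "cyclic_rc d n f"
  have perg: "periodic n ?g" by (rule periodic_cyclic_rc[OF per])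
  have range: "\<forall>x \<in> set (window n 0 f). x \<in> {1..d}"
    using content_range[OF f] by (auto simp: window_def simp del: atLeastAtMost_iff)
  have g: "has_content n (\<lambda>a. content \<mu> (longest_perm d a)) ?g"
    unfolding has_content_def
  proof (intro conjI allI perg)
    fix a
    have win: "window n 0 ?g = reverse_complement d (window n 0 f)" using window_cyclic_rc[of n 0 d f] by simp
    show "count_list (window n 0 ?g) a = content \<mu> (longest_perm d a)"
    proof (cases "a \<in> {1..d}")
      case True
      then show ?thesis
        unfolding win count_reverse_complement[OF range] using f by (simp add: has_content_def longest_perm_def)
    next
      case False
      then have "content \<mu> a = 0" by (auto simp: content_def d_def)
      then show ?thesis
        unfolding win count_reverse_complement[OF range] using False by (auto simp: longest_perm_def)
    qed
  qed
  show "has_content n (content \<mu>) (evac_word d n f)"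
    unfolding has_content_def evac_word_def
  proof (intro conjI allI reflections(1)[OF n perg])
    fix a
    have "longest_perm d (longest_perm d a) = a" by (auto simp: longest_perm_def)
    then show "count_list (window n 0 (foldr reflect (longest_word d) ?g)) a = content \<mu> a"
      using reflections(5)[OF n perg g, of "longest_word d" "longest_perm d a"] longest_word(2) by simp
  qed
  show "kmove n (int n - 3 - k) (evac_word d n f) (evac_word d n g)" if k: "kmove n k f g"
  proof -
    have "\<forall>k. f k \<le> d" "\<forall>k. g k \<le> d"
      using content_range[OF f] content_range[OF has_content_kmove[OF n f k]] by auto
    moreover have "n \<noteq> 1" using not_kmove_1 per k by blast
    ultimately show ?thesis
      unfolding evac_word_def using reflections(4)[OF n perg] kmove_cyclic_rc[OF _ _ k] by blast
  qed
  show "sorted (window n (- p) (evac_word d n f))" if "sorted (window n p f)"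
    unfolding evac_word_def
    using reflections(3)[OF n perg] window_cyclic_rc[of n p d f] sorted_reverse_complement[OF that] by metis
qed

text \<open>Applied twice, \<open>evac_word\<close> preserves the types of moves and the words that are sorted in a window.\<close>

lemma evac_word_involution:
  assumes f: "has_content n (content \<mu>) f"
  shows "evac_word d n (evac_word d n f) = f"
proof -
  have "(\<lambda>f. evac_word d n (evac_word d n f)) f = (\<lambda>f. f) f"
  proof (rule equivariant_unique[OF n, where c = "content \<mu>" and s = "\<lambda>k. k"
        and F = "\<lambda>f. evac_word d n (evac_word d n f)" and G = "\<lambda>f. f"])
    fix f g k assume "has_content n (content \<mu>) f" "kmove n k f g"
    then show "kmove n k (evac_word d n (evac_word d n f)) (evac_word d n (evac_word d n g))"
      using evac_word(2)[OF evac_word(1), of f "int n - 3 - k" "evac_word d n g"] evac_word(2)[of f k g] by simp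
  next
    fix f p assume fp: "has_content n (content \<mu>) f" "sorted (window n p f)"
    have "sorted (window n p (evac_word d n (evac_word d n f)))"
      using evac_word(3)[OF evac_word(1)[OF fp(1)] evac_word(3)[OF fp]] by simp
    then show "evac_word d n (evac_word d n f) = f"
      using sorted_unique[OF n evac_word(1)[OF evac_word(1)[OF fp(1)]] fp(1) _ fp(2)] by blast
  next
    show "periodic n (evac_word d n (evac_word d n f))" if "has_content n (content \<mu>) f" for f
      using evac_word(1)[OF evac_word(1)[OF that]] by (simp add: has_content_def)
  qed (use f in \<open>auto simp: has_content_def\<close>)
  then show ?thesis .
qed

definition tabloid_evac :: "tabloid \<Rightarrow> tabloid" where
  "tabloid_evac = restrict (\<lambda>T. tabloid_of n d (evac_word d n (label n T))) (tabloids \<mu>)"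

lemma tabloid_evac:
  assumes T: "T \<in> tabloids \<mu>"
  shows "tabloid_evac T \<in> tabloids \<mu>" "label n (tabloid_evac T) = evac_word d n (label n T)"
    "tabloid_evac (tabloid_evac T) = T"
proof -
  have c: "has_content n (content \<mu>) (evac_word d n (label n T))"
    using evac_word(1)[OF has_content_label[OF T]] .
  show *: "tabloid_evac T \<in> tabloids \<mu>" "label n (tabloid_evac T) = evac_word d n (label n T)"
    using tabloid_of_content[OF c] T by (simp_all add: tabloid_evac_def)
  show "tabloid_evac (tabloid_evac T) = T"
    using * evac_word_involution[OF has_content_label[OF T]] tabloid_of_label[OF T] by (simp add: tabloid_evac_def)
qed

lemma label_inject: "T \<in> tabloids \<mu> \<Longrightarrow> T' \<in> tabloids \<mu> \<Longrightarrow> label n T = label n T' \<Longrightarrow> T = T'"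
  using tabloid_of_label by metis

lemma type_tabloid_evac:
  assumes "knuth_move_of_type \<mu> (residue n k) T T'"
  shows "knuth_move_of_type \<mu> (residue n (int n - k - 1)) (tabloid_evac T) (tabloid_evac T')"
proof -
  have T: "T \<in> tabloids \<mu>" "T' \<in> tabloids \<mu>" "kmove n (k - 1) (label n T) (label n T')"
    using assms by (simp_all add: knuth_move_of_type_iff)
  have "int n - 3 - (k - 1) = int n - k - 1 - 1" by simp
  then show ?thesis
    using evac_word(2)[OF has_content_label[OF T(1)] T(3)] tabloid_evac(1,2)[OF T(1)] tabloid_evac(1,2)[OF T(2)]
    by (simp add: knuth_move_of_type_iff)
qed

text \<open>An involution that preserves adjacency is an automorphism.\<close>

lemma is_affine_evacuation_tabloid_evac: "is_affine_evacuation \<mu> tabloid_evac"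
proof -
  have move: "knuth_move \<mu> (tabloid_evac T) (tabloid_evac T')" if "knuth_move \<mu> T T'" for T T'
    using knuth_move_has_type[OF that] type_tabloid_evac by (auto simp: knuth_move_of_type_def Let_def)
  have "bij_betw tabloid_evac (tabloids \<mu>) (tabloids \<mu>)"
    by (rule bij_betw_byWitness[where f' = tabloid_evac]) (auto simp: tabloid_evac)
  moreover have "knuth_move \<mu> (tabloid_evac T) (tabloid_evac T') \<longleftrightarrow> knuth_move \<mu> T T'"
    if "T \<in> tabloids \<mu>" "T' \<in> tabloids \<mu>" for T T'
    using move[of T T'] move[of "tabloid_evac T" "tabloid_evac T'"] tabloid_evac(3) that by auto
  moreover have "tabloid_evac (RRSS \<mu> k) = RRSS \<mu> (int n - k)" for k
  proof (rule label_inject)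
    let ?f = "label n (RRSS \<mu> k)"
    have c: "has_content n (content \<mu>) ?f" using has_content_label[OF RRSS_tabloid(1)] .
    have "sorted (window n (- k) (evac_word d n ?f))" by (rule evac_word(3)[OF c RRSS_tabloid(2)])
    moreover have "periodic n (evac_word d n ?f)" using evac_word(1)[OF c] by (simp add: has_content_def)
    ultimately have "sorted (window n (int n - k) (evac_word d n ?f))"
      using window_add_period[of n "evac_word d n ?f" "- k"] by simp
    then have "label n (RRSS \<mu> (int n - k)) = evac_word d n ?f" using RRSS_eqI[OF evac_word(1)[OF c]] by simp
    then show "label n (tabloid_evac (RRSS \<mu> k)) = label n (RRSS \<mu> (int n - k))"
      using tabloid_evac(2)[OF RRSS_tabloid(1)] by simp
  qed (auto simp: tabloid_evac RRSS_tabloid)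
  ultimately show ?thesis
    using type_tabloid_evac by (simp add: is_affine_evacuation_def graph_automorphism_def Let_def n_def)
qed

lemma is_affine_evacuation_unique:
  assumes e: "is_affine_evacuation \<mu> e" and T: "T \<in> tabloids \<mu>"
  shows "e T = tabloid_evac T"
proof -
  have bij: "bij_betw e (tabloids \<mu>) (tabloids \<mu>)"
    and rrss: "\<And>k. e (RRSS \<mu> k) = RRSS \<mu> (int n - k)"
    and types: "\<And>k T T'. knuth_move_of_type \<mu> (residue n k) T T' \<Longrightarrow>
      knuth_move_of_type \<mu> (residue n (int n - k - 1)) (e T) (e T')"
    using e by (auto simp: is_affine_evacuation_def graph_automorphism_def Let_def n_def)
  have "(\<lambda>f. label n (e (tabloid_of n d f))) (label n T) = evac_word d n (label n T)"
  proof (rule equivariant_unique[OF n, where c = "content \<mu>" and s = "\<lambda>k. int n - 3 - k"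
        and F = "\<lambda>f. label n (e (tabloid_of n d f))" and G = "evac_word d n"])
    fix f g k assume f: "has_content n (content \<mu>) f" and k: "kmove n k f g"
    have g: "has_content n (content \<mu>) g" using has_content_kmove[OF n f k] .
    have "knuth_move_of_type \<mu> (residue n (k + 1)) (tabloid_of n d f) (tabloid_of n d g)"
      using k tabloid_of_content[OF f] tabloid_of_content[OF g] by (simp add: knuth_move_of_type_iff)
    moreover have "int n - (k + 1) - 1 - 1 = int n - 3 - k" by simp
    ultimately show "kmove n (int n - 3 - k) (label n (e (tabloid_of n d f))) (label n (e (tabloid_of n d g)))"
      using types knuth_move_of_type_iff by metis
    show "kmove n (int n - 3 - k) (evac_word d n f) (evac_word d n g)" by (rule evac_word(2)[OF f k])
  next
    fix f p assume f: "has_content n (content \<mu>) f" and p: "sorted (window n p f)"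
    have "tabloid_of n d f = RRSS \<mu> p"
      using RRSS_eqI[OF f p] tabloid_of_label[OF RRSS_tabloid(1)] by metis
    then have "e (tabloid_of n d f) = tabloid_evac (RRSS \<mu> p)"
      using rrss is_affine_evacuation_tabloid_evac by (simp add: is_affine_evacuation_def Let_def n_def)
    then show "label n (e (tabloid_of n d f)) = evac_word d n f"
      using tabloid_evac(2)[OF RRSS_tabloid(1)] RRSS_eqI[OF f p] by simp
  next
    show "periodic n (evac_word d n f)" if "has_content n (content \<mu>) f" for f
      using evac_word(1)[OF that] by (simp add: has_content_def)
  qed (use has_content_label[OF T] periodic_label in auto)
  then have "label n (e T) = label n (tabloid_evac T)" using tabloid_of_label[OF T] tabloid_evac(2)[OF T] by simp
  moreover have "e T \<in> tabloids \<mu>" using bij T by (auto simp: bij_betw_def)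
  ultimately show ?thesis using label_inject tabloid_evac(1)[OF T] by blast
qed

lemma affine_evacuation_eq: "affine_evacuation \<mu> = tabloid_evac"
  unfolding affine_evacuation_def
proof (rule the_equality)
  show "tabloid_evac \<in> extensional (tabloids \<mu>) \<and> is_affine_evacuation \<mu> tabloid_evac"
    using is_affine_evacuation_tabloid_evac by (simp add: tabloid_evac_def)
  fix e assume "e \<in> extensional (tabloids \<mu>) \<and> is_affine_evacuation \<mu> e"
  then show "e = tabloid_evac"
    using is_affine_evacuation_unique by (intro extensionalityI[of _ "tabloids \<mu>"]) (auto simp: tabloid_evac_def)
qed

section \<open>RSK and affine evacuation\<close>

text \<open>The array of a tabloid is sorted by rows; sorted by entries instead, it has the word \<open>v\<close> as its
  bottom row.\<close>

lemma tabloid_rsk_eq: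
  assumes T: "T \<in> tabloids \<mu>"
  defines "v \<equiv> window n 0 (label n T)"
  shows "tabloid_rsk T = (insertion_tableau (position_word d v), insertion_tableau v)"
proof -
  have len: "length T = d" by (rule length_tabloid[OF T])
  have enum: "enumerate 1 (rev T) = map (\<lambda>a. (a, T ! (d - a))) [1..<Suc d]"
    by (rule nth_equalityI) (simp_all add: nth_enumerate_eq rev_nth len del: upt_Suc)
  have rows: "sorted_list_of_set (T ! (d - a)) = positions a v" if a: "a \<in> {1..d}" for a
  proof -
    have r: "d - a < d" "d - (d - a) = a" using a by auto
    have sub: "T ! (d - a) \<subseteq> {1..n}" using T r len by (auto simp: tabloids_def n_def)
    have v: "v ! (x - 1) = label n T (int x - 1)" if "x \<in> {1..n}" for x
    proof -
      have "x - 1 < n" "int (x - 1) = int x - 1" using that by auto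
      then show ?thesis by (simp add: v_def)
    qed
    have "set (positions a v) = {x \<in> {1..n}. v ! (x - 1) = a}"
      by (auto simp: positions_def v_def simp del: upt_Suc nth_window)
    also have "\<dots> = T ! (d - a)"
    proof (intro equalityI subsetI)
      fix x assume "x \<in> {x \<in> {1..n}. v ! (x - 1) = a}"
      then have x: "x \<in> {1..n}" "v ! (x - 1) = a" by blast+
      then show "x \<in> T ! (d - a)" using label_eq_iff[OF T x(1) r(1)] r(2) v[OF x(1)] by simp
    next
      fix x assume x: "x \<in> T ! (d - a)"
      then have x1: "x \<in> {1..n}" using sub by blast
      then have "v ! (x - 1) = a" using label_eq_iff[OF T x1 r(1)] r(2) v[OF x1] x by simp
      then show "x \<in> {x \<in> {1..n}. v ! (x - 1) = a}" using x1 by blast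
    qed
    finally have set: "set (positions a v) = T ! (d - a)" .
    have "sorted (positions a v)" "distinct (positions a v)"
      by (simp_all add: positions_def sorted_wrt_filter del: upt_Suc)
    then show ?thesis unfolding set[symmetric] by (simp add: sorted_list_of_set_sort_remdups sorted_sort_id)
  qed
  have "tabloid_array T = concat (map (\<lambda>a. map (Pair a) (sorted_list_of_set (T ! (d - a)))) [1..<Suc d])"
    unfolding tabloid_array_def enum by (simp add: comp_def del: upt_Suc)
  also have "map (\<lambda>a. map (Pair a) (sorted_list_of_set (T ! (d - a)))) [1..<Suc d]
      = map (\<lambda>a. map (Pair a) (positions a v)) [1..<Suc d]"
  proof (rule map_cong[OF refl])
    fix a assume "a \<in> set [1..<Suc d]"
    then have "a \<in> {1..d}" by auto
    then show "map (Pair a) (sorted_list_of_set (T ! (d - a))) = map (Pair a) (positions a v)"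
      using rows by simp
  qed
  finally have "tabloid_array T = concat (map (\<lambda>a. map (Pair a) (positions a v)) [1..<Suc d])" .
  moreover have "rsk (concat (map (\<lambda>a. map (Pair a) (positions a v)) [1..<Suc d]))
    = prod.swap (rsk (columns {1..d} v n))"
    using rsk_positions[of "[1..<Suc d]" v] by (simp add: v_def atLeastLessThanSuc_atLeastAtMost del: upt_Suc)
  ultimately have rsk: "tabloid_rsk T = rsk (concat (map (\<lambda>a. map (Pair a) (positions a v)) [1..<Suc d]))"
    "tabloid_rsk T = prod.swap (rsk (columns {1..d} v n))" by (simp_all add: tabloid_rsk_def)
  have "map snd (columns {1..d} v n) = v"
  proof -
    have "filter (\<lambda>x. v ! (x - 1) \<in> {1..d}) [1..<Suc n] = [1..<Suc n]"
      unfolding filter_id_conv using label_range[OF T] by (auto simp: v_def simp del: upt_Suc atLeastAtMost_iff)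
    then have "map snd (columns {1..d} v n) = map (\<lambda>x. v ! (x - 1)) [1..<Suc n]" by (simp add: columns_def comp_def del: upt_Suc)
    also have "\<dots> = v" by (rule nth_equalityI) (simp_all add: v_def del: upt_Suc)
    finally show ?thesis .
  qed
  then have "snd (tabloid_rsk T) = insertion_tableau v" using rsk(2) fst_rsk[of "columns {1..d} v n"] by simp
  moreover have "fst (tabloid_rsk T) = insertion_tableau (position_word d v)"
    unfolding rsk(1) fst_rsk by (simp add: position_word_def map_concat comp_def del: upt_Suc)
  ultimately show ?thesis by (simp add: prod_eq_iff)
qed

theorem tabloid_rsk_evacuation:
  assumes T: "T \<in> tabloids \<mu>" and PQ: "tabloid_rsk T = (P, Q)"
  shows "tabloid_rsk (affine_evacuation \<mu> T) = (evac n P, evac_star d Q)"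
proof -
  let ?f = "label n T"
  define v where "v = window n 0 ?f"
  define u where "u = reverse_complement d v"
  have range: "\<forall>x \<in> set v. x \<in> {1..d}"
    using label_range[OF T] by (auto simp: v_def window_def simp del: atLeastAtMost_iff)
  have P: "P = insertion_tableau (position_word d v)" and Q: "Q = insertion_tableau v"
    using tabloid_rsk_eq[OF T] PQ by (simp_all add: v_def)
  have "window n 0 (cyclic_rc d n ?f) = u" using window_cyclic_rc[of n 0 d ?f] by (simp add: u_def v_def)
  then have "window n 0 (evac_word d n ?f) = foldr s_word (longest_word d) u"
    unfolding evac_word_def using reflections(2)[OF n periodic_cyclic_rc[OF periodic_label]] by simp
  then have rsk: "tabloid_rsk (affine_evacuation \<mu> T) =
      (insertion_tableau (position_word d (foldr s_word (longest_word d) u)),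
       insertion_tableau (foldr s_word (longest_word d) u))"
    unfolding affine_evacuation_eq using tabloid_rsk_eq[OF tabloid_evac(1)[OF T]] tabloid_evac(2)[OF T] by simp
  have "position_word d (foldr s_word is u) \<approx> position_word d u" if "set is \<subseteq> {1..<d}" for "is"
    using that
  proof (induction "is")
    case (Cons i "is")
    then show ?case using position_word_s_word[of i d "foldr s_word is u"] plactic_trans by auto
  qed simp
  then have "insertion_tableau (position_word d (foldr s_word (longest_word d) u))
      = insertion_tableau (position_word d u)"
    using insertion_tableau_plactic longest_word(1) by blast
  also have "position_word d u = reverse_complement n (position_word d v)"
    using position_word_reverse_complement[OF range] by (simp add: u_def v_def)
  also have "insertion_tableau \<dots> = evac n P"
    unfolding P by (rule evac_insertion_tableau[symmetric])
      (auto simp: position_word_def positions_def v_def simp del: upt_Suc)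
  finally have 1: "insertion_tableau (position_word d (foldr s_word (longest_word d) u)) = evac n P" .
  have "evac d Q = insertion_tableau u"
    unfolding Q u_def by (rule evac_insertion_tableau) (use range in auto)
  then have "evac_star d Q = insertion_tableau (foldr s_word (longest_word d) u)"
    using perm_action_insertion_tableau[OF longest_word(1), of d u] longest_word(2) by (simp add: evac_star_def)
  then show ?thesis using rsk 1 by simp
qed

end

text \<open>For the empty composition there are no residues, and cyclic words are not available.\<close>

lemma tabloid_rsk_evacuation_empty: "tabloid_rsk (affine_evacuation [] []) = (evac 0 [], evac_star 0 [])"
proof -
  have tabs: "tabloids [] = {[]}" by (auto simp: tabloids_def)
  have no_move: "\<not> knuth_move [] T T'" for T T' by (simp add: knuth_move_def Let_def)
  have rrss: "RRSS [] k = []" for k by (simp add: RRSS_def)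
  have "affine_evacuation [] = restrict (\<lambda>T. []) {[]}"
    unfolding affine_evacuation_def
  proof (rule the_equality)
    show "restrict (\<lambda>T. []) {[]} \<in> extensional (tabloids []) \<and> is_affine_evacuation [] (restrict (\<lambda>T. []) {[]})"
      by (auto simp: tabs is_affine_evacuation_def graph_automorphism_def no_move rrss
          knuth_move_of_type_def Let_def bij_betw_def)
    fix e :: "tabloid \<Rightarrow> tabloid"
    assume "e \<in> extensional (tabloids []) \<and> is_affine_evacuation [] e"
    then have "e \<in> extensional {[]}" "e [] = []"
      by (auto simp: tabs is_affine_evacuation_def graph_automorphism_def Let_def bij_betw_def)
    then show "e = restrict (\<lambda>T. []) {[]}" by (intro extensionalityI[of _ "{[]}"]) auto
  qed
  then have e: "affine_evacuation [] [] = []" by simp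
  have nil: "insertion_tableau [] = []" by (simp add: insertion_tableau_def)
  have "simple_product [] = longest_perm 0" by (auto simp: simple_product_def longest_perm_def)
  then have "perm_action 0 (longest_perm 0) [] = []"
    using perm_action_insertion_tableau[of "[]" 0 "[]"] nil by simp
  then show ?thesis
    by (simp add: e tabloid_rsk_def tabloid_array_def evac_star_def evac_def nil)
qed

theorem proposition3p23:
  fixes \<mu> :: "nat list" and n d :: nat and T :: tabloid and P Q :: tableau
  assumes "composition_of \<mu> n"
    and "length \<mu> = d"
    and "T \<in> tabloids \<mu>"
    and "tabloid_rsk T = (P, Q)"
  shows "tabloid_rsk (affine_evacuation \<mu> T) = (evac n P, evac_star d Q)"
proof (cases "n = 0")
  case True
  then have "\<mu> = []" using assms(1) by (cases \<mu>) (auto simp: composition_of_def)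
  moreover from this have "T = []" using assms(3) by (simp add: tabloids_def)
  moreover from this have "P = []" "Q = []"
    using assms(4) by (simp_all add: tabloid_rsk_def tabloid_array_def)
  ultimately show ?thesis using tabloid_rsk_evacuation_empty assms(2) True by simp
next
  case False
  then show ?thesis
    using tabloid_rsk_evacuation[of n \<mu> d T P Q] assms by (simp add: composition_of_def)
qed

end
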